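(* Let $\Omega\subset\mathbb{R}$ be a bounded open interval, let $m,s^+,s^-,\mu_0^+,\tau_{1/2}^+>0$ be constants, let $1\ge\theta>\rho>7/8$, and let $p>1$. Let $T>0$ and let $(f,g)$ and $(F,G)$ be two positive strong solutions on $[0,T]$ (in the sense defined in the context) of the two-phase thin-film system, emanating from the same initial value $(f_0,g_0)\in H^{4\theta}_B(\Omega)\times H^{4\theta}_B(\Omega)$ with $f_0,g_0>0$ on $\bar\Omega$. Then $(f,g)=(F,G)$ on $[0,T]$.
   Context: The two-phase thin-film system (written for $f$ and $f+g$) is $$ \begin{cases} f_t+\big(p_{11}(f,g)f_{xxx}+p_{12}(f,g)(f+g)_{xxx}\big)_x=0,\\ (f+g)_t+\big(p_{21}(f,g)f_{xxx}+p_{22}(f,g)(f+g)_{xxx}+C_p|g|^{p+2}\Phi((f+g)_{xxx})\big)_x=0, \end{cases} $$ for $t\in(0,T)$, $x\in\Omega$, with boundary conditions $f_x=f_{xxx}=g_x=g_{xxx}=0$ on $\partial\Omega$, where $\Phi(d)=|d|^{p-1}d$, $C_p=\frac{|s^+|^p}{(p+2)\mu_0^+|\tau_{1/2}^+|^{p-1}}>0$ and $$p_{11}=\tfrac{s^-}{3}f^3,\quad p_{12}=ms^+\big(\tfrac13f^3+\tfrac12f^2g\big),\quad p_{21}=p_{11}+\tfrac{s^-}{2}f^2g,\quad p_{22}=p_{12}+ms^+\big(fg^2+\tfrac12f^2g\big)+\tfrac{s^+}{3\mu_0^+}g^3.$$ For $7/2<4\rho\le4$, $H^{4\rho}_B(\Omega)=\{v\in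 H^{4\rho}(\Omega): v_x=v_{xxx}=0\text{ on }\partial\Omega\}$, where $H^s(\Omega)$ is the $L_2$-based Bessel potential space. A positive strong solution on $[0,T]$ with initial datum $u_0=(f_0,g_0)$ is a pair $u=(f,g)$ with $u(0)=u_0$, $$u\in C([0,T];H^{4\theta}_B(\Omega)^2)\cap C((0,T];H^4_B(\Omega)^2)\cap C^1((0,T];L_2(\Omega)^2),$$ $u\in C^\nu([0,T];H^{4\rho}_B(\Omega)^2)$ for $\nu\in(0,\theta-\rho)$, $f,g>0$ on $[0,T]\times\bar\Omega$, such that the two differential equations hold in $L_2(\Omega)$ for all positive times in the interval. *)

theory Defs
  imports "HOL-Analysis.Analysis"
begin

text \<open>
  Throughout, \<open>\<Omega>\<close> is the interval \<open>{a<..<b}\<close>. Functions of \<open>x\<close> have type \<open>real \<Rightarrow> real\<close>; only their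
  values on \<open>{a..b}\<close> matter, and elements of \<open>H\<^sup>s(\<Omega>)\<close> are identified with their continuous
  representatives on \<open>{a..b}\<close>. A time-dependent function is written \<open>u t x\<close>.
\<close>

subsection \<open>Function spaces on a bounded interval\<close>

definition L2_space :: "real \<Rightarrow> real \<Rightarrow> (real \<Rightarrow> real) set" where
  "L2_space a b = {v. v \<in> borel_measurable (lebesgue_on {a<..<b}) \<and>
     integrable (lebesgue_on {a<..<b}) (\<lambda>x. (v x)\<^sup>2)}"

definition L2_norm_on :: "real \<Rightarrow> real \<Rightarrow> (real \<Rightarrow> real) \<Rightarrow> real" where
  "L2_norm_on a b v = sqrt (LINT x|lebesgue_on {a<..<b}. (v x)\<^sup>2)"

text \<open>
  The Bessel potential space \<open>H\<^sup>s(\<real>)\<close> consists of the inverse Fourier transforms of those \<open>h\<close> for which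
  \<open>(1 + \<xi>\<^sup>2)\<^bsup>s/2\<^esup> h \<in> L\<^sub>2(\<real>)\<close>, normed by the \<open>L\<^sub>2\<close>-norm of \<open>(1 + \<xi>\<^sup>2)\<^bsup>s/2\<^esup> h\<close>. For \<open>s > 1/2\<close>, the only
  range in which the definitions below are meaningful (here \<open>7/2 < s \<le> 4\<close>), such an \<open>h\<close> is
  integrable, so that the inverse Fourier transform is an absolutely convergent integral, and it is the
  continuous representative. \<open>H\<^sup>s(\<Omega>)\<close> is the space of restrictions to \<open>\<Omega>\<close> with the quotient norm.
  Complex-valued extensions of real functions are harmless, since passing to the real part does not
  increase the norm.
\<close>

definition inverse_fourier :: "(real \<Rightarrow> complex) \<Rightarrow> real \<Rightarrow> complex" where
  "inverse_fourier h x = (LINT \<xi>|lborel. cis (x * \<xi>) * h \<xi>) / complex_of_real (sqrt (2 * pi))"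

definition bessel_weighted_L2 :: "real \<Rightarrow> (real \<Rightarrow> complex) set" where
  "bessel_weighted_L2 s = {h. h \<in> borel_measurable lborel \<and>
     integrable lborel (\<lambda>\<xi>. (1 + \<xi>\<^sup>2) powr s * (cmod (h \<xi>))\<^sup>2)}"

definition bessel_extensions :: "real \<Rightarrow> real \<Rightarrow> real \<Rightarrow> (real \<Rightarrow> real) \<Rightarrow> (real \<Rightarrow> complex) set" where
  "bessel_extensions s a b v = {h \<in> bessel_weighted_L2 s.
     \<forall>x\<in>{a..b}. inverse_fourier h x = complex_of_real (v x)}"

definition Hs_space :: "real \<Rightarrow> real \<Rightarrow> real \<Rightarrow> (real \<Rightarrow> real) set" where
  "Hs_space s a b = {v. bessel_extensions s a b v \<noteq> {}}"

definition Hs_norm :: "real \<Rightarrow> real \<Rightarrow> real \<Rightarrow> (real \<Rightarrow> real) \<Rightarrow> real" where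
  "Hs_norm s a b v = (INF h\<in>bessel_extensions s a b v.
     sqrt (LINT \<xi>|lborel. (1 + \<xi>\<^sup>2) powr s * (cmod (h \<xi>))\<^sup>2))"

text \<open>
  The derivative is one-sided at \<open>a\<close> and \<open>b\<close>. Since \<open>H\<^sup>s(\<Omega>)\<close> embeds into \<open>C\<^sup>3([a,b])\<close> for \<open>s > 7/2\<close>,
  the first three derivatives of its elements are classical derivatives.
\<close>

definition dx :: "real \<Rightarrow> real \<Rightarrow> (real \<Rightarrow> real) \<Rightarrow> real \<Rightarrow> real" where
  "dx a b v x = vector_derivative v (at x within {a..b})"

definition HsB_space :: "real \<Rightarrow> real \<Rightarrow> real \<Rightarrow> (real \<Rightarrow> real) set" where
  "HsB_space s a b = {v \<in> Hs_space s a b. \<forall>x\<in>{a, b}. dx a b v x = 0 \<and> (dx a b ^^ 3) v x = 0}"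

definition test_functions :: "real \<Rightarrow> real \<Rightarrow> (real \<Rightarrow> real) set" where
  "test_functions a b = {\<phi>. (\<forall>n x. (deriv ^^ n) \<phi> differentiable at x) \<and>
     (\<exists>c d. a < c \<and> d < b \<and> (\<forall>x. x \<notin> {c..d} \<longrightarrow> \<phi> x = 0))}"

text \<open>\<open>v \<in> H\<^sup>1(\<Omega>)\<close> with distributional derivative \<open>w\<close>\<close>

definition has_weak_derivative_L2 ::
  "real \<Rightarrow> real \<Rightarrow> (real \<Rightarrow> real) \<Rightarrow> (real \<Rightarrow> real) \<Rightarrow> bool" where
  "has_weak_derivative_L2 a b v w \<longleftrightarrow> v \<in> L2_space a b \<and> w \<in> L2_space a b \<and>
     (\<forall>\<phi>\<in>test_functions a b.
       (LINT x|lebesgue_on {a<..<b}. v x * deriv \<phi> x) = - (LINT x|lebesgue_on {a<..<b}. w x * \<phi> x))"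

subsection \<open>Functions of time with values in a normed function space\<close>

text \<open>The space is given by its carrier \<open>X\<close> and its norm \<open>N\<close>.\<close>

definition continuous_into ::
  "(real \<Rightarrow> real) set \<Rightarrow> ((real \<Rightarrow> real) \<Rightarrow> real) \<Rightarrow> real set \<Rightarrow> (real \<Rightarrow> real \<Rightarrow> real) \<Rightarrow> bool" where
  "continuous_into X N I u \<longleftrightarrow> (\<forall>t\<in>I. u t \<in> X) \<and>
     (\<forall>t\<in>I. ((\<lambda>\<tau>. N (\<lambda>x. u \<tau> x - u t x)) \<longlongrightarrow> 0) (at t within I))"

definition hoelder_into ::
  "(real \<Rightarrow> real) set \<Rightarrow> ((real \<Rightarrow> real) \<Rightarrow> real) \<Rightarrow> real \<Rightarrow> real set \<Rightarrow> (real \<Rightarrow> real \<Rightarrow> real) \<Rightarrow> bool" where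
  "hoelder_into X N \<nu> I u \<longleftrightarrow> (\<forall>t\<in>I. u t \<in> X) \<and>
     (\<exists>K. \<forall>t\<in>I. \<forall>\<tau>\<in>I. N (\<lambda>x. u \<tau> x - u t x) \<le> K * \<bar>\<tau> - t\<bar> powr \<nu>)"

text \<open>\<open>u \<in> C\<^sup>1(I; X)\<close> with time derivative \<open>u'\<close>, one-sided at end points belonging to \<open>I\<close>\<close>

definition C1_into ::
  "(real \<Rightarrow> real) set \<Rightarrow> ((real \<Rightarrow> real) \<Rightarrow> real) \<Rightarrow> real set \<Rightarrow>
   (real \<Rightarrow> real \<Rightarrow> real) \<Rightarrow> (real \<Rightarrow> real \<Rightarrow> real) \<Rightarrow> bool" where
  "C1_into X N I u u' \<longleftrightarrow> (\<forall>t\<in>I. u t \<in> X) \<and> continuous_into X N I u' \<and>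
     (\<forall>t\<in>I. ((\<lambda>\<tau>. N (\<lambda>x. (u \<tau> x - u t x) / (\<tau> - t) - u' t x)) \<longlongrightarrow> 0) (at t within I))"

subsection \<open>The two-phase thin-film system\<close>

text \<open>The constants \<open>s\<^sup>+\<close>, \<open>s\<^sup>-\<close>, \<open>\<mu>\<^sub>0\<^sup>+\<close>, \<open>\<tau>\<^sub>1\<^sub>/\<^sub>2\<^sup>+\<close> are written \<open>sp\<close>, \<open>sm\<close>, \<open>\<mu>0\<close>, \<open>\<tau>h\<close>.\<close>

definition Phi :: "real \<Rightarrow> real \<Rightarrow> real" where
  "Phi p d = \<bar>d\<bar> powr (p - 1) * d"

definition C_const :: "real \<Rightarrow> real \<Rightarrow> real \<Rightarrow> real \<Rightarrow> real" where
  "C_const sp \<mu>0 \<tau>h p = \<bar>sp\<bar> powr p / ((p + 2) * \<mu>0 * \<bar>\<tau>h\<bar> powr (p - 1))"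

definition p11 :: "real \<Rightarrow> real \<Rightarrow> real \<Rightarrow> real" where
  "p11 sm f g = sm / 3 * f ^ 3"

definition p12 :: "real \<Rightarrow> real \<Rightarrow> real \<Rightarrow> real \<Rightarrow> real" where
  "p12 m sp f g = m * sp * (1 / 3 * f ^ 3 + 1 / 2 * f\<^sup>2 * g)"

definition p21 :: "real \<Rightarrow> real \<Rightarrow> real \<Rightarrow> real" where
  "p21 sm f g = p11 sm f g + sm / 2 * f\<^sup>2 * g"

definition p22 :: "real \<Rightarrow> real \<Rightarrow> real \<Rightarrow> real \<Rightarrow> real \<Rightarrow> real" where
  "p22 m sp \<mu>0 f g =
     p12 m sp f g + m * sp * (f * g\<^sup>2 + 1 / 2 * f\<^sup>2 * g) + sp / (3 * \<mu>0) * g ^ 3"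

text \<open>The expressions under the outer \<open>x\<close>-derivatives in the equations for \<open>f\<close> and \<open>f + g\<close>\<close>

definition flux1 ::
  "real \<Rightarrow> real \<Rightarrow> real \<Rightarrow> real \<Rightarrow> real \<Rightarrow> (real \<Rightarrow> real) \<Rightarrow> (real \<Rightarrow> real) \<Rightarrow> real \<Rightarrow> real" where
  "flux1 a b m sp sm f g x =
     p11 sm (f x) (g x) * (dx a b ^^ 3) f x
     + p12 m sp (f x) (g x) * (dx a b ^^ 3) (\<lambda>y. f y + g y) x"

definition flux2 ::
  "real \<Rightarrow> real \<Rightarrow> real \<Rightarrow> real \<Rightarrow> real \<Rightarrow> real \<Rightarrow> real \<Rightarrow> real \<Rightarrow>
   (real \<Rightarrow> real) \<Rightarrow> (real \<Rightarrow> real) \<Rightarrow> real \<Rightarrow> real" where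
  "flux2 a b m sp sm \<mu>0 \<tau>h p f g x =
     p21 sm (f x) (g x) * (dx a b ^^ 3) f x
     + p22 m sp \<mu>0 (f x) (g x) * (dx a b ^^ 3) (\<lambda>y. f y + g y) x
     + C_const sp \<mu>0 \<tau>h p * \<bar>g x\<bar> powr (p + 2) * Phi p ((dx a b ^^ 3) (\<lambda>y. f y + g y) x)"

text \<open>
  Regularity in the product spaces is stated componentwise. The boundary conditions are part of
  membership in \<open>HsB_space\<close>. For \<open>f(t), g(t) \<in> H\<^sup>4(\<Omega>)\<close> the fluxes belong to \<open>H\<^sup>1(\<Omega>)\<close>, so their outer
  \<open>x\<close>-derivatives are weak derivatives in \<open>L\<^sub>2(\<Omega>)\<close>.
\<close>

definition positive_strong_solution ::
  "real \<Rightarrow> real \<Rightarrow> real \<Rightarrow> real \<Rightarrow> real \<Rightarrow> real \<Rightarrow> real \<Rightarrow> real \<Rightarrow> real \<Rightarrow> real \<Rightarrow> real \<Rightarrow>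
   (real \<Rightarrow> real) \<Rightarrow> (real \<Rightarrow> real) \<Rightarrow> (real \<Rightarrow> real \<Rightarrow> real) \<Rightarrow> (real \<Rightarrow> real \<Rightarrow> real) \<Rightarrow> bool" where
  "positive_strong_solution a b m sp sm \<mu>0 \<tau>h p \<theta> \<rho> T f0 g0 f g \<longleftrightarrow>
     (\<forall>x\<in>{a..b}. f 0 x = f0 x \<and> g 0 x = g0 x) \<and>
     (\<forall>u\<in>{f, g}.
        continuous_into (HsB_space (4 * \<theta>) a b) (Hs_norm (4 * \<theta>) a b) {0..T} u \<and>
        continuous_into (HsB_space 4 a b) (Hs_norm 4 a b) {0<..T} u \<and>
        (\<forall>\<nu>\<in>{0<..<\<theta> - \<rho>}.
           hoelder_into (HsB_space (4 * \<rho>) a b) (Hs_norm (4 * \<rho>) a b) \<nu> {0..T} u)) \<and>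
     (\<forall>t\<in>{0..T}. \<forall>x\<in>{a..b}. f t x > 0 \<and> g t x > 0) \<and>
     (\<exists>f_t g_t.
        C1_into (L2_space a b) (L2_norm_on a b) {0<..T} f f_t \<and>
        C1_into (L2_space a b) (L2_norm_on a b) {0<..T} g g_t \<and>
        (\<forall>t\<in>{0<..T}. \<exists>q1 q2.
           has_weak_derivative_L2 a b (flux1 a b m sp sm (f t) (g t)) q1 \<and>
           has_weak_derivative_L2 a b (flux2 a b m sp sm \<mu>0 \<tau>h p (f t) (g t)) q2 \<and>
           (AE x in lebesgue_on {a<..<b}. f_t t x + q1 x = 0) \<and>
           (AE x in lebesgue_on {a<..<b}. (f_t t x + g_t t x) + q2 x = 0)))"

end

theory Submission
  imports Defs
begin

text \<open>
  Write \<open>w = f - F\<close> and \<open>v = (f + g) - (F + G)\<close>. The mobility matrix becomes symmetric and positive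
  definite after multiplying its rows by \<open>s\<^sup>-\<close> and \<open>m s\<^sup>+\<close>, and \<open>\<Phi>\<close> is monotone. Hence testing the
  difference of the two systems with \<open>w - s\<^sup>- w\<^sub>x\<^sub>x\<close> and \<open>v - m s\<^sup>+ v\<^sub>x\<^sub>x\<close> shows that the energy
  \<open>\<integral> (s\<^sup>- w\<^sub>x\<^sup>2 + w\<^sup>2 + m s\<^sup>+ v\<^sub>x\<^sup>2 + v\<^sup>2) / 2\<close> satisfies \<open>Y' \<le> C Y\<close>: the third derivatives enter with a good
  sign, and the remaining terms are absorbed because \<open>H\<^sup>s(\<Omega>)\<close> embeds into \<open>C\<^sup>3([a,b])\<close> for \<open>s > 7/2\<close>, so that
  both solutions are bounded in \<open>C\<^sup>3\<close> and bounded away from zero up to \<open>t = 0\<close>. Since \<open>Y(0+) = 0\<close>,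
  Gronwall's inequality yields \<open>Y = 0\<close>.
\<close>

subsection \<open>Embedding of Bessel potential spaces\<close>

text \<open>The pairing is shaped by the available regularity: only spatial derivatives up to order
  three are classical functions, \<open>f_t\<close> lies merely in L2, and the outer derivative of a
  flux is weak. The test functions are just C^1, and moving one derivative onto them pairs
  \<open>w_x - s^- w_xxx\<close> and its analogue for \<open>v\<close> with the flux differences, so
  fourth derivatives never appear. The boundary conditions enter twice: vanishing third derivatives
  make the fluxes vanish at the end points, which admits test functions that do not vanish there,
  and vanishing first derivatives remove the boundary terms when the energy is differentiated in
  time. The squares of \<open>w\<close> and \<open>v\<close> themselves belong to the energy because
  the mobilities depend on the unknowns, so that differences of mobilities are controlled by
  \<open>\<bar>w\<bar> + \<bar>v\<bar>\<close>. A time derivative of \<open>w_x\<close> is not at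
  hand; the derivative of the energy is therefore computed from difference quotients, after an
  integration by parts in \<open>x\<close>.\<close>

lemma integrable_mult_if_squares_integrable:
  fixes u v :: "'a \<Rightarrow> real"
  assumes "u \<in> borel_measurable M" "v \<in> borel_measurable M"
    and "integrable M (\<lambda>x. (u x)\<^sup>2)" "integrable M (\<lambda>x. (v x)\<^sup>2)"
  shows "integrable M (\<lambda>x. u x * v x)"
proof (rule Bochner_Integration.integrable_bound)
  show "integrable M (\<lambda>x. (u x)\<^sup>2 + (v x)\<^sup>2)"
    using assms by auto
  show "AE x in M. norm (u x * v x) \<le> norm ((u x)\<^sup>2 + (v x)\<^sup>2)"
  proof (intro AE_I2)
    fix x
    have "0 \<le> (\<bar>u x\<bar> - \<bar>v x\<bar>)\<^sup>2" by simp
    then have "2 * \<bar>u x * v x\<bar> \<le> (u x)\<^sup>2 + (v x)\<^sup>2"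
      by (simp add: power2_diff abs_mult)
    then show "norm (u x * v x) \<le> norm ((u x)\<^sup>2 + (v x)\<^sup>2)"
      by (simp add: power2_eq_square)
  qed
qed (use assms in measurable)

lemma Cauchy_Schwarz_integral:
  fixes u v :: "'a \<Rightarrow> real"
  assumes "u \<in> borel_measurable M" "v \<in> borel_measurable M"
    and "integrable M (\<lambda>x. (u x)\<^sup>2)" "integrable M (\<lambda>x. (v x)\<^sup>2)"
  shows "\<bar>LINT x|M. u x * v x\<bar> \<le> sqrt (LINT x|M. (u x)\<^sup>2) * sqrt (LINT x|M. (v x)\<^sup>2)"
proof -
  define A where "A = (LINT x|M. (u x)\<^sup>2)"
  define B where "B = (LINT x|M. u x * v x)"
  define C where "C = (LINT x|M. (v x)\<^sup>2)"
  have uv: "integrable M (\<lambda>x. u x * v x)"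
    by (rule integrable_mult_if_squares_integrable[OF assms])
  have q: "0 \<le> A - 2 * t * B + t\<^sup>2 * C" for t
  proof -
    have "0 \<le> (LINT x|M. (u x - t * v x)\<^sup>2)"
      by (rule integral_nonneg_AE) auto
    also have "\<dots> = (LINT x|M. (u x)\<^sup>2 - (2 * t) * (u x * v x) + t\<^sup>2 * (v x)\<^sup>2)"
      by (intro Bochner_Integration.integral_cong) (auto simp: power2_eq_square algebra_simps)
    also have "\<dots> = A - 2 * t * B + t\<^sup>2 * C"
      unfolding A_def B_def C_def using assms uv by simp
    finally show ?thesis .
  qed
  have "C \<ge> 0" unfolding C_def by (rule integral_nonneg_AE) auto
  have "B\<^sup>2 \<le> A * C"
  proof (cases "C = 0")
    case True
    have "B = 0"
    proof (rule ccontr)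
      assume "B \<noteq> 0"
      \<comment> \<open>For \<open>C = 0\<close> the quadratic in \<open>t\<close> is linear, and
        this \<open>t\<close> gives it the value \<open>A - (A + 1) = -1\<close>.\<close>
      then show False using q[of "(A + 1) / (2 * B)"] True by (simp add: field_simps)
    qed
    then show ?thesis using True by simp
  next
    case False
    have eq: "A - 2 * (B / C) * B + (B / C)\<^sup>2 * C = A - B\<^sup>2 / C"
      using False by (simp add: field_simps power2_eq_square)
    have "B\<^sup>2 / C \<le> A" using q[of "B / C"] unfolding eq by simp
    then show ?thesis using False \<open>C \<ge> 0\<close> by (simp add: field_simps)
  qed
  then have "sqrt (B\<^sup>2) \<le> sqrt (A * C)"
    by (simp only: real_sqrt_le_iff)
  then show ?thesis
    by (simp add: A_def B_def C_def real_sqrt_mult)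
qed

text \<open>The function is at most 1 on \<open>{-1..1}\<close> and at most
  \<open>\<bar>\<xi>\<bar> powr (2 * r)\<close> elsewhere; the tails are integrable because
  \<open>2 * r < -1\<close>.\<close>

lemma integrable_japanese_bracket_powr:
  assumes "r < - 1 / 2"
  shows "integrable lborel (\<lambda>\<xi>::real. (1 + \<xi>\<^sup>2) powr r)"
proof (rule Bochner_Integration.integrable_bound)
  let ?I = "\<lambda>\<xi>::real. indicat_real {-1..1} \<xi>"
  let ?g = "\<lambda>\<xi>::real. indicat_real {1..} \<xi> * \<xi> powr (2 * r)"
  have "(\<lambda>\<xi>. \<xi> powr (2 * r)) absolutely_integrable_on {1..}"
    using has_integral_powr_to_inf[of "2 * r" 1] assms
    by (intro nonnegative_absolutely_integrable_1) (auto simp: integrable_on_def)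
  then have "integrable lebesgue ?g"
    by (simp add: set_integrable_def)
  then have g: "integrable lborel ?g"
    by (subst (asm) integrable_completion) auto
  \<comment> \<open>The left tail is the reflection of the right one.\<close>
  then have "integrable lborel (\<lambda>\<xi>. ?g (0 + (-1) * \<xi>))"
    by (intro lborel_integrable_real_affine) auto
  then have g': "integrable lborel (\<lambda>\<xi>. ?g (- \<xi>))" by simp
  have I: "integrable lborel ?I"
    by (rule integrable_real_indicator) auto
  show "integrable lborel (\<lambda>\<xi>. ?I \<xi> + (?g \<xi> + ?g (- \<xi>)))"
    by (intro Bochner_Integration.integrable_add g g' I)
  show "AE \<xi> in lborel. norm ((1 + \<xi>\<^sup>2) powr r) \<le> norm (?I \<xi> + (?g \<xi> + ?g (- \<xi>)))"
  proof (intro AE_I2)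
    fix \<xi> :: real
    have nn: "?I \<xi> \<ge> 0" "?g \<xi> \<ge> 0" "?g (- \<xi>) \<ge> 0" by auto
    have bnd: "(1 + \<xi>\<^sup>2) powr r \<le> (\<xi>\<^sup>2) powr r" if "\<xi> \<noteq> 0"
      using assms that by (intro powr_mono2') auto
    consider "\<bar>\<xi>\<bar> \<le> 1" | "\<xi> \<ge> 1" | "\<xi> \<le> -1" by linarith
    then have "(1 + \<xi>\<^sup>2) powr r \<le> ?I \<xi> + (?g \<xi> + ?g (- \<xi>))"
    proof cases
      case 1
      have "(1 + \<xi>\<^sup>2) powr r \<le> 1 powr r"
        using assms by (intro powr_mono2') auto
      then show ?thesis using 1 nn by (auto simp: indicator_def abs_le_iff)
    next
      case 2
      then have "(\<xi>\<^sup>2) powr r = \<xi> powr (2 * r)"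
        by (simp add: powr_powr flip: powr_numeral)
      then show ?thesis using 2 bnd nn by (auto simp: indicator_def split: if_splits)
    next
      case 3
      then have "(\<xi>\<^sup>2) powr r = ((- \<xi>)\<^sup>2) powr r" by simp
      also have "\<dots> = (- \<xi>) powr (2 * r)"
        using 3 powr_powr[of "- \<xi>" 2 r] powr_numeral[of "- \<xi>" "num.Bit0 num.One"] by simp
      finally show ?thesis using 3 bnd nn by (auto simp: indicator_def split: if_splits)
    qed
    then show "norm ((1 + \<xi>\<^sup>2) powr r) \<le> norm (?I \<xi> + (?g \<xi> + ?g (- \<xi>)))"
      using nn by simp
  qed
qed auto

section \<open>Moments of weighted square-integrable functions\<close>

definition bessel_norm :: "real \<Rightarrow> (real \<Rightarrow> complex) \<Rightarrow> real" where
  "bessel_norm s h = sqrt (LINT \<xi>|lborel. (1 + \<xi>\<^sup>2) powr s * (cmod (h \<xi>))\<^sup>2)"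

text \<open>The constant that Cauchy-Schwarz produces in \<open>bessel_moment\<close>: the L2 norm
  of \<open>(1 + \<xi>\<^sup>2) powr ((3 - s) / 2)\<close>. It is meaningful for
  \<open>3 - s < - 1 / 2\<close>, which is where the threshold \<open>7 / 2\<close>
  originates.\<close>

definition moment_const :: "real \<Rightarrow> real" where
  "moment_const s = sqrt (LINT \<xi>|lborel. (1 + \<xi>\<^sup>2) powr (3 - s))"

text \<open>For \<open>k \<le> 3\<close> the factor \<open>\<bar>\<xi>\<bar> ^ k\<close> is at most
  \<open>(1 + \<xi>\<^sup>2) powr (3 / 2)\<close>. Splitting this weight as
  \<open>(3 - s) / 2 + s / 2\<close> leaves a product of two square-integrable functions.\<close>

lemma bessel_moment:
  assumes h: "h \<in> bessel_weighted_L2 s" and s: "s > 7 / 2" and k: "k \<le> 3"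
  shows "integrable lborel (\<lambda>\<xi>. (\<i> * of_real \<xi>) ^ k * h \<xi>)" (is "integrable _ ?f")
    and "(LINT \<xi>|lborel. cmod ((\<i> * of_real \<xi>) ^ k * h \<xi>)) \<le> moment_const s * bessel_norm s h"
proof -
  let ?u = "\<lambda>\<xi>::real. (1 + \<xi>\<^sup>2) powr ((3 - s) / 2)"
  let ?v = "\<lambda>\<xi>. (1 + \<xi>\<^sup>2) powr (s / 2) * cmod (h \<xi>)"
  have hm [measurable]: "h \<in> borel_measurable lborel"
    and hi: "integrable lborel (\<lambda>\<xi>. (1 + \<xi>\<^sup>2) powr s * (cmod (h \<xi>))\<^sup>2)"
    using h by (auto simp: bessel_weighted_L2_def)
  have sq: "((1 + \<xi>\<^sup>2) powr (r / 2))\<^sup>2 = (1 + \<xi>\<^sup>2) powr r" for \<xi> r :: real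
    by (simp add: power2_eq_square flip: powr_add)
  have u2: "(\<lambda>\<xi>. (?u \<xi>)\<^sup>2) = (\<lambda>\<xi>. (1 + \<xi>\<^sup>2) powr (3 - s))"
    by (simp only: sq)
  have v2: "(\<lambda>\<xi>. (?v \<xi>)\<^sup>2) = (\<lambda>\<xi>. (1 + \<xi>\<^sup>2) powr s * (cmod (h \<xi>))\<^sup>2)"
    by (simp only: sq power_mult_distrib)
  have ui: "integrable lborel (\<lambda>\<xi>. (?u \<xi>)\<^sup>2)"
    unfolding u2 using s by (intro integrable_japanese_bracket_powr) auto
  have vi: "integrable lborel (\<lambda>\<xi>. (?v \<xi>)\<^sup>2)"
    unfolding v2 by (rule hi)
  have uvi: "integrable lborel (\<lambda>\<xi>. ?u \<xi> * ?v \<xi>)"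
    by (rule integrable_mult_if_squares_integrable[OF _ _ ui vi]) measurable
  have le: "cmod (?f \<xi>) \<le> ?u \<xi> * ?v \<xi>" for \<xi>
  proof -
    have "\<bar>\<xi>\<bar> ^ k \<le> (1 + \<xi>\<^sup>2) powr (3 / 2)"
    proof -
      have "\<bar>\<xi>\<bar> ^ k \<le> (sqrt (1 + \<xi>\<^sup>2)) ^ k"
        by (intro power_mono) (auto simp: real_le_rsqrt)
      also have "\<dots> \<le> (sqrt (1 + \<xi>\<^sup>2)) ^ 3"
        by (intro power_increasing k) auto
      also have "\<dots> = (1 + \<xi>\<^sup>2) powr (3 / 2)"
        by (simp add: powr_power add_pos_nonneg less_imp_neq[symmetric] flip: powr_half_sqrt)
      finally show ?thesis .
    qed
    also have "\<dots> = ?u \<xi> * (1 + \<xi>\<^sup>2) powr (s / 2)"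
      by (simp add: field_simps flip: powr_add)
    finally have "\<bar>\<xi>\<bar> ^ k * cmod (h \<xi>) \<le> ?u \<xi> * (1 + \<xi>\<^sup>2) powr (s / 2) * cmod (h \<xi>)"
      by (intro mult_right_mono) auto
    then show ?thesis by (simp add: norm_mult norm_power mult.assoc)
  qed
  have le': "norm (?f \<xi>) \<le> norm (?u \<xi> * ?v \<xi>)" for \<xi>
    using le[of \<xi>] by simp
  show fi: "integrable lborel ?f"
    by (rule Bochner_Integration.integrable_bound[OF uvi _ AE_I2[OF le']]) measurable
  have "(LINT \<xi>|lborel. cmod (?f \<xi>)) \<le> (LINT \<xi>|lborel. ?u \<xi> * ?v \<xi>)"
    using fi uvi le by (intro integral_mono integrable_norm) auto
  also have "\<dots> \<le> sqrt (LINT \<xi>|lborel. (?u \<xi>)\<^sup>2) * sqrt (LINT \<xi>|lborel. (?v \<xi>)\<^sup>2)"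
    using Cauchy_Schwarz_integral[OF _ _ ui vi] by (simp add: abs_le_iff)
  finally show "(LINT \<xi>|lborel. cmod (?f \<xi>)) \<le> moment_const s * bessel_norm s h"
    unfolding u2 v2 moment_const_def bessel_norm_def .
qed

section \<open>Continuity and differentiation of inverse Fourier transforms\<close>

lemma norm_inverse_fourier_le:
  "cmod (inverse_fourier h x) \<le> (LINT \<xi>|lborel. cmod (h \<xi>))"
proof -
  have "cmod (LINT \<xi>|lborel. cis (x * \<xi>) * h \<xi>) \<le> (LINT \<xi>|lborel. cmod (h \<xi>))"
    using integral_norm_bound[of lborel "\<lambda>\<xi>. cis (x * \<xi>) * h \<xi>"] by (simp add: norm_mult)
  moreover have "1 \<le> sqrt (2 * pi)" using pi_gt3 by simp
  moreover have "0 \<le> (LINT \<xi>|lborel. cmod (h \<xi>))" by (rule integral_nonneg_AE) auto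
  ultimately show ?thesis
    unfolding inverse_fourier_def norm_divide
    using mult_left_mono[of 1 "sqrt (2 * pi)" "LINT \<xi>|lborel. cmod (h \<xi>)"]
    by (simp add: divide_le_eq)
qed

lemma cis_measurable [measurable]: "(\<lambda>\<xi>. cis (x * \<xi>)) \<in> borel_measurable borel"
  by (intro borel_measurable_continuous_onI continuous_intros)

lemma continuous_inverse_fourier:
  assumes h: "integrable lborel h"
  shows "isCont (inverse_fourier h) x"
  unfolding continuous_at_sequentially
proof (intro allI impI)
  fix u :: "nat \<Rightarrow> real"
  assume u: "u \<longlonglongrightarrow> x"
  have [measurable]: "h \<in> borel_measurable lborel" using h by auto
  have "(\<lambda>n. LINT \<xi>|lborel. cis (u n * \<xi>) * h \<xi>) \<longlonglongrightarrow> (LINT \<xi>|lborel. cis (x * \<xi>) * h \<xi>)"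
  proof (rule integral_dominated_convergence)
    show "AE \<xi> in lborel. (\<lambda>n. cis (u n * \<xi>) * h \<xi>) \<longlonglongrightarrow> cis (x * \<xi>) * h \<xi>"
      by (intro AE_I2 tendsto_mult tendsto_const tendsto_cis u)
    show "AE \<xi> in lborel. norm (cis (u n * \<xi>) * h \<xi>) \<le> cmod (h \<xi>)" for n
      by (auto simp: norm_mult)
  qed (use h in auto)
  then show "(inverse_fourier h \<circ> u) \<longlonglongrightarrow> inverse_fourier h x"
    unfolding inverse_fourier_def o_def by (intro tendsto_intros) auto
qed

lemma norm_cis_diff_le: "cmod (cis s - cis t) \<le> \<bar>s - t\<bar>"
proof -
  have "cmod (cis s - cis t) = cmod (cis t) * cmod (cis (s - t) - 1)"
    unfolding norm_mult[symmetric] by (simp add: algebra_simps cis_mult)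
  also have "\<dots> = 2 * \<bar>sin ((s - t) / 2)\<bar>"
    using dist_exp_i_1[of "s - t"] by (simp add: cis_conv_exp)
  also have "\<dots> \<le> \<bar>s - t\<bar>"
    using abs_sin_x_le_abs_x[of "(s - t) / 2"] by simp
  finally show ?thesis .
qed

text \<open>Puts derivatives into the form of a limit of difference quotients, which can be
  evaluated along sequences and is thus accessible to dominated convergence.\<close>

lemma has_vector_derivative_iff_quotient:
  "(f has_vector_derivative D) (at x within S) \<longleftrightarrow>
   ((\<lambda>y. (f y - f x) /\<^sub>R (y - x)) \<longlongrightarrow> D) (at x within S)"
proof -
  have eq: "norm ((f y - f x) /\<^sub>R (y - x) - D) = norm (f y - f x - (y - x) *\<^sub>R D) / norm (y - x)"
    if "y \<noteq> x" for y
  proof -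
    have "(f y - f x) /\<^sub>R (y - x) - D = (f y - f x - (y - x) *\<^sub>R D) /\<^sub>R (y - x)"
      using that by (simp add: scaleR_diff_right)
    then show ?thesis by (simp add: divide_inverse mult.commute)
  qed
  have "((\<lambda>y. (f y - f x) /\<^sub>R (y - x)) \<longlongrightarrow> D) (at x within S) \<longleftrightarrow>
    ((\<lambda>y. norm ((f y - f x) /\<^sub>R (y - x) - D)) \<longlongrightarrow> 0) (at x within S)"
    by (subst Lim_null) (simp add: tendsto_norm_zero_iff)
  also have "\<dots> \<longleftrightarrow> ((\<lambda>y. norm (f y - f x - (y - x) *\<^sub>R D) / norm (y - x)) \<longlongrightarrow> 0) (at x within S)"
    by (intro Lim_cong_within refl eq)
  finally show ?thesis
    by (simp add: has_vector_derivative_def has_derivative_iff_norm bounded_linear_scaleR_left)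
qed

text \<open>The difference quotients of \<open>cis (x * \<xi>)\<close> in \<open>x\<close> are
  bounded by \<open>\<bar>\<xi>\<bar>\<close>, so \<open>\<bar>\<xi>\<bar> * cmod (h \<xi>)\<close>
  dominates and the derivative passes under the integral.\<close>

lemma has_vector_derivative_inverse_fourier:
  assumes h: "integrable lborel h" and h': "integrable lborel (\<lambda>\<xi>. \<i> * of_real \<xi> * h \<xi>)"
  shows "(inverse_fourier h has_vector_derivative
    inverse_fourier (\<lambda>\<xi>. \<i> * of_real \<xi> * h \<xi>) x) (at x)"
proof -
  let ?D = "\<lambda>y. (inverse_fourier h y - inverse_fourier h x) /\<^sub>R (y - x)"
  have hm [measurable]: "h \<in> borel_measurable lborel" using h by auto
  have ci: "integrable lborel (\<lambda>\<xi>. cis (y * \<xi>) * h \<xi>)" for y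
    by (rule Bochner_Integration.integrable_bound[OF h]) (auto simp: norm_mult)
  have "(?D \<longlongrightarrow> inverse_fourier (\<lambda>\<xi>. \<i> * of_real \<xi> * h \<xi>) x) (at x)"
    unfolding tendsto_at_iff_sequentially
  proof (intro allI impI)
    fix u :: "nat \<Rightarrow> real"
    assume u: "\<forall>i. u i \<in> UNIV - {x}" "u \<longlonglongrightarrow> x"
    let ?q = "\<lambda>n \<xi>. ((cis (u n * \<xi>) - cis (x * \<xi>)) /\<^sub>R (u n - x)) * h \<xi>"
    have "(\<lambda>n. LINT \<xi>|lborel. ?q n \<xi>) \<longlonglongrightarrow> (LINT \<xi>|lborel. cis (x * \<xi>) * (\<i> * of_real \<xi> * h \<xi>))"
    proof (rule integral_dominated_convergence)
      show "AE \<xi> in lborel. (\<lambda>n. ?q n \<xi>) \<longlonglongrightarrow> cis (x * \<xi>) * (\<i> * of_real \<xi> * h \<xi>)"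
      proof (intro AE_I2)
        fix \<xi> :: real
        have "((\<lambda>y. cis (y * \<xi>)) has_vector_derivative \<xi> *\<^sub>R (\<i> * cis (x * \<xi>))) (at x)"
          unfolding has_vector_derivative_def
          by (auto intro!: derivative_eq_intros simp: fun_eq_iff)
        then have "((\<lambda>y. (cis (y * \<xi>) - cis (x * \<xi>)) /\<^sub>R (y - x)) \<longlongrightarrow> \<xi> *\<^sub>R (\<i> * cis (x * \<xi>))) (at x)"
          by (simp add: has_vector_derivative_iff_quotient)
        then have "(\<lambda>n. (cis (u n * \<xi>) - cis (x * \<xi>)) /\<^sub>R (u n - x)) \<longlonglongrightarrow> \<xi> *\<^sub>R (\<i> * cis (x * \<xi>))"
          using u unfolding tendsto_at_iff_sequentially by (auto simp: o_def)
        then have "(\<lambda>n. ?q n \<xi>) \<longlonglongrightarrow> (\<xi> *\<^sub>R (\<i> * cis (x * \<xi>))) * h \<xi>"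
          by (rule tendsto_mult[OF _ tendsto_const])
        then show "(\<lambda>n. ?q n \<xi>) \<longlonglongrightarrow> cis (x * \<xi>) * (\<i> * of_real \<xi> * h \<xi>)"
          by (simp add: scaleR_conv_of_real mult_ac)
      qed
      show "AE \<xi> in lborel. norm (?q n \<xi>) \<le> cmod (\<i> * of_real \<xi> * h \<xi>)" for n
      proof (intro AE_I2)
        fix \<xi> :: real
        have "u n \<noteq> x" using u by auto
        have "cmod (cis (u n * \<xi>) - cis (x * \<xi>)) \<le> \<bar>u n - x\<bar> * \<bar>\<xi>\<bar>"
          using norm_cis_diff_le[of "u n * \<xi>" "x * \<xi>"] by (simp flip: abs_mult add: algebra_simps)
        then have "cmod ((cis (u n * \<xi>) - cis (x * \<xi>)) /\<^sub>R (u n - x)) \<le> \<bar>\<xi>\<bar>"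
          using \<open>u n \<noteq> x\<close> unfolding norm_scaleR by (simp add: field_simps)
        then show "norm (?q n \<xi>) \<le> cmod (\<i> * of_real \<xi> * h \<xi>)"
          unfolding norm_mult by (simp add: mult_right_mono)
      qed
    qed (use h' in auto)
    moreover have "(LINT \<xi>|lborel. ?q n \<xi>) = ((LINT \<xi>|lborel. cis (u n * \<xi>) * h \<xi>)
        - (LINT \<xi>|lborel. cis (x * \<xi>) * h \<xi>)) /\<^sub>R (u n - x)" for n
    proof -
      have "?q n = (\<lambda>\<xi>. (cis (u n * \<xi>) * h \<xi> - cis (x * \<xi>) * h \<xi>) /\<^sub>R (u n - x))"
        by (simp add: fun_eq_iff left_diff_distrib mult_scaleR_left)
      then show ?thesis
        by (simp only: integral_scaleR_right Bochner_Integration.integral_diff[OF ci ci])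
    qed
    ultimately have lim: "(\<lambda>n. ((LINT \<xi>|lborel. cis (u n * \<xi>) * h \<xi>)
        - (LINT \<xi>|lborel. cis (x * \<xi>) * h \<xi>)) /\<^sub>R (u n - x))
        \<longlonglongrightarrow> (LINT \<xi>|lborel. cis (x * \<xi>) * (\<i> * of_real \<xi> * h \<xi>))"
      by (simp only:)
    have D: "?D (u n) = (((LINT \<xi>|lborel. cis (u n * \<xi>) * h \<xi>)
        - (LINT \<xi>|lborel. cis (x * \<xi>) * h \<xi>)) /\<^sub>R (u n - x)) / complex_of_real (sqrt (2 * pi))" for n
      unfolding inverse_fourier_def by (simp only: diff_divide_distrib[symmetric] scaleR_conv_of_real times_divide_eq_right)
    show "(?D \<circ> u) \<longlonglongrightarrow> inverse_fourier (\<lambda>\<xi>. \<i> * of_real \<xi> * h \<xi>) x"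
      unfolding o_def D unfolding inverse_fourier_def
      by (rule tendsto_divide[OF lim tendsto_const]) simp
  qed
  then show ?thesis
    by (simp add: has_vector_derivative_iff_quotient)
qed

text \<open>Since \<open>dx\<close> is a total function, iterating it says nothing about existence
  of derivatives; existence is therefore recorded separately, one-sided at the end points.\<close>

definition C3_on :: "real \<Rightarrow> real \<Rightarrow> (real \<Rightarrow> real) \<Rightarrow> bool" where
  "C3_on a b v \<longleftrightarrow>
     (\<forall>k<3. \<forall>x\<in>{a..b}. ((dx a b ^^ k) v has_real_derivative (dx a b ^^ Suc k) v x) (at x within {a..b})) \<and>
     continuous_on {a..b} ((dx a b ^^ 3) v)"

lemma dx_eqI:
  assumes "a < b" "x \<in> {a..b}" "(w has_real_derivative d) (at x within {a..b})"
    and "\<And>y. y \<in> {a..b} \<Longrightarrow> v y = w y"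
  shows "(v has_real_derivative d) (at x within {a..b})" "dx a b v x = d"
proof -
  show *: "(v has_real_derivative d) (at x within {a..b})"
    using assms(2-4) has_vector_derivative_transform[of x "{a..b}" v w d]
    by (simp add: has_real_derivative_iff_has_vector_derivative)
  show "dx a b v x = d"
    unfolding dx_def
    using vector_derivative_within_closed_interval[OF assms(1,2)] *
    by (simp add: has_real_derivative_iff_has_vector_derivative)
qed

text \<open>Iterates of \<open>dx\<close> are identified by exhibiting a family \<open>D\<close> of
  successive derivatives that agrees with \<open>v\<close> on \<open>{a..b}\<close>: derivatives
  within a nondegenerate interval are unique, and values outside the interval do not matter.\<close>

lemma dx_iterate:
  assumes ab: "a < b"
    and D: "\<And>j x. j < n \<Longrightarrow> x \<in> {a..b} \<Longrightarrow> (D j has_real_derivative D (Suc j) x) (at x within {a..b})"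
    and v: "\<And>x. x \<in> {a..b} \<Longrightarrow> v x = D 0 x"
    and k: "k \<le> n" and x: "x \<in> {a..b}"
  shows "(dx a b ^^ k) v x = D k x"
  using k x
proof (induction k arbitrary: x)
  case (Suc k)
  then show ?case
    using dx_eqI(2)[OF ab _ D, of x k "(dx a b ^^ k) v"] by simp
qed (use v in simp)

lemma C3_onI:
  assumes ab: "a < b"
    and D: "\<And>j x. j < 3 \<Longrightarrow> x \<in> {a..b} \<Longrightarrow> (D j has_real_derivative D (Suc j) x) (at x within {a..b})"
    and v: "\<And>x. x \<in> {a..b} \<Longrightarrow> v x = D 0 x"
    and cont: "continuous_on {a..b} (D 3)"
  shows "C3_on a b v"
proof -
  have it: "(dx a b ^^ k) v y = D k y" if "k \<le> 3" "y \<in> {a..b}" for k y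
    using dx_iterate[OF ab D v that] .
  have "continuous_on {a..b} ((dx a b ^^ 3) v)"
  proof (rule continuous_on_eq[OF cont])
    show "D 3 x = (dx a b ^^ 3) v x" if "x \<in> {a..b}" for x
      using it[of 3 x] that by simp
  qed
  moreover have "((dx a b ^^ k) v has_real_derivative (dx a b ^^ Suc k) v x) (at x within {a..b})"
    if k: "k < 3" and x: "x \<in> {a..b}" for k x
  proof -
    have "((dx a b ^^ k) v has_real_derivative D (Suc k) x) (at x within {a..b})"
      using k by (intro dx_eqI(1)[OF ab x D[OF k x]] it) auto
    then show ?thesis using it[of "Suc k" x] k x by simp
  qed
  ultimately show ?thesis unfolding C3_on_def by blast
qed

lemma
  assumes h: "h \<in> bessel_extensions s a b v" and s: "s > 7 / 2" and ab: "a < b"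
  shows bessel_extension_imp_C3_on: "C3_on a b v"
    and dx_le_bessel_norm: "k \<le> 3 \<Longrightarrow> x \<in> {a..b} \<Longrightarrow>
      \<bar>(dx a b ^^ k) v x\<bar> \<le> moment_const s * bessel_norm s h"
proof -
  \<comment> \<open>Differentiation corresponds to the factor \<open>\<i> * \<xi>\<close> on the
    Fourier side. The real part is taken because an extension may be complex-valued outside
    \<open>{a..b}\<close>.\<close>
  define g where "g j = (\<lambda>\<xi>. (\<i> * of_real \<xi>) ^ j * h \<xi>)" for j
  define D where "D j x = Re (inverse_fourier (g j) x)" for j x
  have hw: "h \<in> bessel_weighted_L2 s" and hv: "\<And>x. x \<in> {a..b} \<Longrightarrow> inverse_fourier h x = of_real (v x)"
    using h by (auto simp: bessel_extensions_def)
  have gi: "integrable lborel (g j)" if "j \<le> 3" for j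
    unfolding g_def by (rule bessel_moment(1)[OF hw s that])
  have D: "(D j has_real_derivative D (Suc j) x) (at x within {a..b})" if "j < 3" for j x
  proof -
    have g_Suc: "g (Suc j) = (\<lambda>\<xi>. \<i> * of_real \<xi> * g j \<xi>)"
      by (simp add: g_def mult_ac)
    have "integrable lborel (g j)" "integrable lborel (\<lambda>\<xi>. \<i> * of_real \<xi> * g j \<xi>)"
      using gi[of j] gi[of "Suc j"] that unfolding g_Suc by auto
    from has_vector_derivative_inverse_fourier[OF this]
    have "(inverse_fourier (g j) has_vector_derivative inverse_fourier (g (Suc j)) x) (at x within {a..b})"
      unfolding g_Suc by (rule has_vector_derivative_at_within)
    from bounded_linear.has_vector_derivative[OF bounded_linear_Re this]
    show ?thesis
      by (simp add: D_def[abs_def] has_real_derivative_iff_has_vector_derivative)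
  qed
  have v: "v x = D 0 x" if "x \<in> {a..b}" for x
    using hv[OF that] by (simp add: D_def g_def)
  have cont: "continuous_on {a..b} (D 3)"
    unfolding D_def
    by (intro continuous_intros continuous_at_imp_continuous_on ballI continuous_inverse_fourier gi) auto
  show "C3_on a b v"
    by (rule C3_onI[OF ab D v cont])
  show "\<bar>(dx a b ^^ k) v x\<bar> \<le> moment_const s * bessel_norm s h" if k: "k \<le> 3" and x: "x \<in> {a..b}"
  proof -
    have "\<bar>(dx a b ^^ k) v x\<bar> = \<bar>D k x\<bar>"
      using dx_iterate[OF ab D v k x] by simp
    also have "\<dots> \<le> cmod (inverse_fourier (g k) x)"
      unfolding D_def by (rule abs_Re_le_cmod)
    also have "\<dots> \<le> (LINT \<xi>|lborel. cmod (g k \<xi>))"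
      by (rule norm_inverse_fourier_le)
    also have "\<dots> \<le> moment_const s * bessel_norm s h"
      unfolding g_def by (rule bessel_moment(2)[OF hw s k])
    finally show ?thesis .
  qed
qed

lemma Hs_imp_C3_on:
  assumes "v \<in> Hs_space s a b" "s > 7 / 2" "a < b"
  shows "C3_on a b v"
  using assms bessel_extension_imp_C3_on by (auto simp: Hs_space_def)

lemma moment_const_nonneg: "moment_const s \<ge> 0"
  unfolding moment_const_def by (intro real_sqrt_ge_zero integral_nonneg_AE) auto

text \<open>The estimate holds for every extension and hence for the infimum. The \<open>+ 1\<close>
  makes the constant strictly positive, so that it can be divided out before the infimum is
  taken.\<close>

lemma dx_le_Hs_norm:
  assumes v: "v \<in> Hs_space s a b" and "s > 7 / 2" "a < b" "k \<le> 3" "x \<in> {a..b}"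
  shows "\<bar>(dx a b ^^ k) v x\<bar> \<le> (moment_const s + 1) * Hs_norm s a b v"
proof -
  have ne: "bessel_extensions s a b v \<noteq> {}"
    using v by (simp add: Hs_space_def)
  have "\<bar>(dx a b ^^ k) v x\<bar> / (moment_const s + 1) \<le> Hs_norm s a b v"
    unfolding Hs_norm_def
  proof (rule cINF_greatest[OF ne])
    fix h
    assume h: "h \<in> bessel_extensions s a b v"
    have "bessel_norm s h \<ge> 0"
      unfolding bessel_norm_def by (intro real_sqrt_ge_zero integral_nonneg_AE) auto
    then have "\<bar>(dx a b ^^ k) v x\<bar> \<le> (moment_const s + 1) * bessel_norm s h"
      using dx_le_bessel_norm[OF h assms(2-5)] by (simp add: algebra_simps)
    then show "\<bar>(dx a b ^^ k) v x\<bar> / (moment_const s + 1)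
        \<le> sqrt (LINT \<xi>|lborel. (1 + \<xi>\<^sup>2) powr s * (cmod (h \<xi>))\<^sup>2)"
      using moment_const_nonneg[of s] by (simp add: bessel_norm_def field_simps)
  qed
  then show ?thesis
    using moment_const_nonneg[of s] by (simp add: field_simps)
qed

lemma integrable_lborel_cis_mult:
  "integrable lborel h \<Longrightarrow> integrable lborel (\<lambda>\<xi>. cis (x * \<xi>) * h \<xi>)"
  by (rule Bochner_Integration.integrable_bound[where f = h]) (auto simp: norm_mult)

text \<open>The Hoelder condition bounds the norm of \<open>u \<tau> - u t\<close>; for pointwise
  conclusions this difference must have an extension, and the difference of two extensions is
  one.\<close>

lemma Hs_space_diff:
  assumes "v \<in> Hs_space s a b" "w \<in> Hs_space s a b" and s: "s > 7 / 2"
  shows "(\<lambda>x. v x - w x) \<in> Hs_space s a b"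
proof -
  obtain h k where h: "h \<in> bessel_extensions s a b v" and k: "k \<in> bessel_extensions s a b w"
    using assms by (auto simp: Hs_space_def)
  then have hw: "h \<in> bessel_weighted_L2 s" and kw: "k \<in> bessel_weighted_L2 s"
    by (auto simp: bessel_extensions_def)
  then have [measurable]: "h \<in> borel_measurable lborel" "k \<in> borel_measurable lborel"
    by (auto simp: bessel_weighted_L2_def)
  have hi: "integrable lborel h" and ki: "integrable lborel k"
    using bessel_moment(1)[OF hw s, of 0] bessel_moment(1)[OF kw s, of 0] by auto
  let ?w = "\<lambda>\<xi>::real. (1 + \<xi>\<^sup>2) powr s"
  have "integrable lborel (\<lambda>\<xi>. ?w \<xi> * (cmod (h \<xi> - k \<xi>))\<^sup>2)"
  proof (rule Bochner_Integration.integrable_bound)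
    show "integrable lborel (\<lambda>\<xi>. 2 * (?w \<xi> * (cmod (h \<xi>))\<^sup>2) + 2 * (?w \<xi> * (cmod (k \<xi>))\<^sup>2))"
      using hw kw by (auto simp: bessel_weighted_L2_def)
    show "AE \<xi> in lborel. norm (?w \<xi> * (cmod (h \<xi> - k \<xi>))\<^sup>2)
        \<le> norm (2 * (?w \<xi> * (cmod (h \<xi>))\<^sup>2) + 2 * (?w \<xi> * (cmod (k \<xi>))\<^sup>2))"
    proof (intro AE_I2)
      fix \<xi> :: real
      have "(cmod (h \<xi> - k \<xi>))\<^sup>2 \<le> (cmod (h \<xi>) + cmod (k \<xi>))\<^sup>2"
        by (intro power_mono norm_triangle_ineq4) auto
      also have "\<dots> \<le> 2 * (cmod (h \<xi>))\<^sup>2 + 2 * (cmod (k \<xi>))\<^sup>2"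
        using zero_le_power2[of "cmod (h \<xi>) - cmod (k \<xi>)"] by (simp add: power2_sum power2_diff)
      finally have "?w \<xi> * (cmod (h \<xi> - k \<xi>))\<^sup>2 \<le> ?w \<xi> * (2 * (cmod (h \<xi>))\<^sup>2 + 2 * (cmod (k \<xi>))\<^sup>2)"
        by (intro mult_left_mono) auto
      then show "norm (?w \<xi> * (cmod (h \<xi> - k \<xi>))\<^sup>2)
        \<le> norm (2 * (?w \<xi> * (cmod (h \<xi>))\<^sup>2) + 2 * (?w \<xi> * (cmod (k \<xi>))\<^sup>2))"
        by (simp add: algebra_simps)
    qed
  qed measurable
  then have "(\<lambda>\<xi>. h \<xi> - k \<xi>) \<in> bessel_weighted_L2 s"
    by (simp add: bessel_weighted_L2_def)
  moreover have "inverse_fourier (\<lambda>\<xi>. h \<xi> - k \<xi>) x = inverse_fourier h x - inverse_fourier k x" for x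
    unfolding inverse_fourier_def
    by (simp add: right_diff_distrib integrable_lborel_cis_mult hi ki diff_divide_distrib)
  ultimately have "(\<lambda>\<xi>. h \<xi> - k \<xi>) \<in> bessel_extensions s a b (\<lambda>x. v x - w x)"
    using h k by (auto simp: bessel_extensions_def)
  then show ?thesis by (auto simp: Hs_space_def)
qed

lemma dx_linear:
  assumes v: "C3_on a b v" and w: "C3_on a b w" and ab: "a < b" and k: "k \<le> 3" and x: "x \<in> {a..b}"
  shows "(dx a b ^^ k) (\<lambda>x. c * v x + d * w x) x = c * (dx a b ^^ k) v x + d * (dx a b ^^ k) w x"
proof -
  define D where "D k x = c * (dx a b ^^ k) v x + d * (dx a b ^^ k) w x" for k x
  have D: "(D j has_real_derivative D (Suc j) x) (at x within {a..b})"
    if "j < 3" "x \<in> {a..b}" for j x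
  proof -
    have "((dx a b ^^ j) v has_real_derivative (dx a b ^^ Suc j) v x) (at x within {a..b})"
      "((dx a b ^^ j) w has_real_derivative (dx a b ^^ Suc j) w x) (at x within {a..b})"
      using v w that unfolding C3_on_def by blast+
    then show ?thesis
      unfolding D_def by (intro DERIV_add DERIV_cmult)
  qed
  have 0: "c * v x + d * w x = D 0 x" for x by (simp add: D_def)
  show ?thesis
    using dx_iterate[OF ab D 0 k x] by (simp add: D_def)
qed

lemma
  assumes "C3_on a b v" "C3_on a b w" "a < b" "k \<le> 3" "x \<in> {a..b}"
  shows dx_add: "(dx a b ^^ k) (\<lambda>x. v x + w x) x = (dx a b ^^ k) v x + (dx a b ^^ k) w x"
    and dx_diff: "(dx a b ^^ k) (\<lambda>x. v x - w x) x = (dx a b ^^ k) v x - (dx a b ^^ k) w x"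
  using dx_linear[OF assms, of 1 1] dx_linear[OF assms, of 1 "-1"] by simp_all

lemma C3_on_continuous:
  assumes "C3_on a b v" "k \<le> 3"
  shows "continuous_on {a..b} ((dx a b ^^ k) v)"
proof (cases "k = 3")
  case False
  then have "((dx a b ^^ k) v has_real_derivative (dx a b ^^ Suc k) v x) (at x within {a..b})"
    if "x \<in> {a..b}" for x
    using assms that unfolding C3_on_def by (metis le_neq_implies_less)
  then show ?thesis
    unfolding has_real_derivative_iff_has_vector_derivative by (rule continuous_on_vector_derivative)
qed (use assms in \<open>auto simp: C3_on_def\<close>)

subsection \<open>Weak derivatives and integration by parts\<close>

lemma measure_lebesgue_on_Ioo: "a \<le> b \<Longrightarrow> measure (lebesgue_on {a<..<b}) {a<..<b} = b - a"
  by (simp add: measure_restrict_space)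

lemma finite_measure_lebesgue_on_Ioo: "finite_measure (lebesgue_on {a<..<b::real})"
  by (rule finite_measureI, cases "a \<le> b") (simp_all add: emeasure_restrict_space)

lemma continuous_on_Icc_bound:
  assumes "continuous_on {a..b::real} (u :: real \<Rightarrow> real)"
  obtains B where "B \<ge> 0" "\<And>x. x \<in> {a..b} \<Longrightarrow> \<bar>u x\<bar> \<le> B"
proof -
  have "bounded (u ` {a..b})"
    by (intro compact_imp_bounded compact_continuous_image assms compact_Icc)
  then obtain B where "\<forall>x\<in>{a..b}. \<bar>u x\<bar> \<le> B"
    by (auto simp: bounded_iff)
  then show ?thesis
    by (intro that[of "max B 0"]) (auto intro: order_trans[OF _ max.cobounded1])
qed

lemma continuous_on_imp_L2:
  assumes "continuous_on {a..b} u"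
  shows "u \<in> L2_space a b"
proof -
  have c: "continuous_on {a<..<b} u"
    by (rule continuous_on_subset[OF assms]) auto
  then have m: "u \<in> borel_measurable (lebesgue_on {a<..<b})"
    by (intro continuous_imp_measurable_on_sets_lebesgue) auto
  obtain B where B: "\<And>x. x \<in> {a..b} \<Longrightarrow> \<bar>u x\<bar> \<le> B"
    using continuous_on_Icc_bound[OF assms] by metis
  have "integrable (lebesgue_on {a<..<b}) (\<lambda>x. (u x)\<^sup>2)"
  proof (rule finite_measure.integrable_const_bound[OF finite_measure_lebesgue_on_Ioo])
    show "AE x in lebesgue_on {a<..<b}. norm ((u x)\<^sup>2) \<le> B\<^sup>2"
    proof (intro AE_I2)
      fix x
      assume "x \<in> space (lebesgue_on {a<..<b})"
      then have "\<bar>u x\<bar>\<^sup>2 \<le> B\<^sup>2"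
        by (intro power_mono B) auto
      then show "norm ((u x)\<^sup>2) \<le> B\<^sup>2" by simp
    qed
  qed (use m in measurable)
  with m show ?thesis by (simp add: L2_space_def)
qed

lemma L2_mult_integrable:
  assumes "u \<in> L2_space a b" "v \<in> L2_space a b"
  shows "integrable (lebesgue_on {a<..<b}) (\<lambda>x. u x * v x)"
  using assms by (intro integrable_mult_if_squares_integrable) (auto simp: L2_space_def)

lemma L2_Cauchy_Schwarz:
  assumes "u \<in> L2_space a b" "v \<in> L2_space a b"
  shows "\<bar>LINT x|lebesgue_on {a<..<b}. u x * v x\<bar> \<le> L2_norm_on a b u * L2_norm_on a b v"
  using assms unfolding L2_norm_on_def by (intro Cauchy_Schwarz_integral) (auto simp: L2_space_def)

lemma L2_imp_integrable:
  assumes "u \<in> L2_space a b"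
  shows "integrable (lebesgue_on {a<..<b}) u"
  using L2_mult_integrable[OF assms, of "\<lambda>_. 1"] continuous_on_imp_L2[of a b "\<lambda>_. 1"] by simp

lemma continuous_on_integrable_Ioo:
  assumes "continuous_on {a..b::real} (u :: real \<Rightarrow> real)"
  shows "integrable (lebesgue_on {a<..<b}) u"
  by (intro L2_imp_integrable continuous_on_imp_L2 assms)

lemma integral_le_const_Ioo:
  assumes "integrable (lebesgue_on {a<..<b::real}) u" "a \<le> b" "\<And>x. x \<in> {a<..<b} \<Longrightarrow> u x \<le> (B::real)"
  shows "(LINT x|lebesgue_on {a<..<b}. u x) \<le> B * (b - a)"
proof -
  have "(LINT x|lebesgue_on {a<..<b}. u x) \<le> (LINT x|lebesgue_on {a<..<b}. B)"
    using assms by (intro integral_mono continuous_on_integrable_Ioo[of a b "\<lambda>_. B"]) auto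
  also have "\<dots> = B * (b - a)"
    using assms by (simp add: measure_lebesgue_on_Ioo)
  finally show ?thesis .
qed

lemma integral_FTC_Ioo:
  fixes H h :: "real \<Rightarrow> real"
  assumes "a \<le> b" "\<And>x. x \<in> {a..b} \<Longrightarrow> (H has_real_derivative h x) (at x within {a..b})"
    and "continuous_on {a..b} h"
  shows "(LINT x|lebesgue_on {a<..<b}. h x) = H b - H a"
proof -
  have "(h has_integral (H b - H a)) {a..b}"
    using assms by (intro fundamental_theorem_of_calculus)
      (auto simp: has_real_derivative_iff_has_vector_derivative)
  then have 1: "(h has_integral (H b - H a)) {a<..<b}"
    using has_integral_open_interval[of h "H b - H a" a b] by (simp add: box_real)
  have "(h has_integral (LINT x|lebesgue_on {a<..<b}. h x)) {a<..<b}"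
    by (intro has_integral_integral_lebesgue_on continuous_on_integrable_Ioo assms) auto
  with 1 show ?thesis using has_integral_unique by blast
qed

section \<open>Smooth cutoffs\<close>

lemma DERIV_imp_continuous_on:
  assumes "\<And>x. (f has_real_derivative f' x) (at x)"
  shows "continuous_on S f"
  using assms by (intro continuous_at_imp_continuous_on) (blast intro: DERIV_isCont)

text \<open>For \<open>p = 1\<close> this is the classical smooth function with a zero of infinite
  order at 0. The polynomial factor in \<open>1 / x\<close> makes the family closed under
  differentiation.\<close>

definition flat :: "(real \<Rightarrow> real) \<Rightarrow> real \<Rightarrow> real" where
  "flat p x = (if x > 0 then p (1 / x) * exp (- (1 / x)) else 0)"

lemma polynomial_times_exp_neg_tendsto_0:
  fixes p :: "real \<Rightarrow> real"
  assumes "real_polynomial_function p"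
  shows "((\<lambda>z. p z * exp (- z)) \<longlongrightarrow> 0) at_top"
proof -
  obtain c n where p: "p = (\<lambda>x. \<Sum>i\<le>n. c i * x ^ i)"
    using assms by (auto simp: real_polynomial_function_iff_sum)
  have "((\<lambda>z. \<Sum>i\<le>n. c i * (z ^ i / exp z)) \<longlongrightarrow> (\<Sum>i\<le>n. c i * 0)) at_top"
    by (intro tendsto_sum tendsto_mult tendsto_const tendsto_power_div_exp_0)
  then show ?thesis
    by (simp add: p sum_distrib_right exp_minus divide_inverse mult.assoc)
qed

lemma flat_tendsto_0:
  assumes "real_polynomial_function p"
  shows "(flat p \<longlongrightarrow> 0) (at 0)"
proof (rule filterlim_split_at)
  show "(flat p \<longlongrightarrow> 0) (at_left 0)"
    by (rule tendsto_eventually) (auto simp: flat_def eventually_at_filter)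
  have "((\<lambda>x. p (1 / x) * exp (- (1 / x))) \<longlongrightarrow> 0) (at_right 0)"
    using filterlim_compose[OF polynomial_times_exp_neg_tendsto_0[OF assms] filterlim_inverse_at_top_right]
    by (simp add: inverse_eq_divide)
  then show "(flat p \<longlongrightarrow> 0) (at_right 0)"
    by (rule Lim_transform_eventually) (auto simp: flat_def eventually_at_filter)
qed

text \<open>Both the polynomial and the exponential are functions of \<open>y = 1 / x\<close>, and
  the chain rule contributes \<open>- y\<^sup>2\<close>; at 0 the exponential beats every power of
  \<open>1 / x\<close>.\<close>

lemma has_real_derivative_flat:
  assumes p: "real_polynomial_function p" and p': "\<And>x. (p has_real_derivative p' x) (at x)"
  shows "(flat p has_real_derivative flat (\<lambda>y. y\<^sup>2 * (p y - p' y)) x) (at x)"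
proof (cases x "0 :: real" rule: linorder_cases)
  case less
  have "((\<lambda>_. 0) has_real_derivative 0) (at x)" by simp
  then have "(flat p has_real_derivative 0) (at x)"
    by (rule has_field_derivative_transform_within_open[of _ _ _ "{..<0}"])
       (use less in \<open>auto simp: flat_def\<close>)
  then show ?thesis using less by (simp add: flat_def)
next
  case greater
  have "((\<lambda>x. p (1 / x)) has_real_derivative p' (1 / x) * (- (1 / x\<^sup>2))) (at x)"
    by (rule DERIV_chain2[OF p'])
       (use greater in \<open>auto intro!: derivative_eq_intros simp: power2_eq_square\<close>)
  moreover have "((\<lambda>x. exp (- (1 / x))) has_real_derivative exp (- (1 / x)) * (1 / x\<^sup>2)) (at x)"
    using greater by (auto intro!: derivative_eq_intros simp: power2_eq_square)
  ultimately have "((\<lambda>x. p (1 / x) * exp (- (1 / x))) has_real_derivative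
      p' (1 / x) * (- (1 / x\<^sup>2)) * exp (- (1 / x)) + exp (- (1 / x)) * (1 / x\<^sup>2) * p (1 / x)) (at x)"
    by (rule DERIV_mult)
  then have "(flat p has_real_derivative
      p' (1 / x) * (- (1 / x\<^sup>2)) * exp (- (1 / x)) + exp (- (1 / x)) * (1 / x\<^sup>2) * p (1 / x)) (at x)"
    by (rule has_field_derivative_transform_within_open[of _ _ _ "{0<..}"])
       (use greater in \<open>auto simp: flat_def\<close>)
  then show ?thesis
    using greater by (simp add: flat_def algebra_simps power_divide)
next
  case equal
  \<comment> \<open>The difference quotient of \<open>flat p\<close> at 0 is again
    \<open>flat\<close> of a polynomial, namely of \<open>y * p y\<close>, and therefore tends to
    0.\<close>
  have "real_polynomial_function (\<lambda>y. y * p y)"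
    by (intro real_polynomial_function.intros(4) p real_polynomial_function.intros(1)) auto
  from flat_tendsto_0[OF this] have "((\<lambda>y. (flat p y - flat p 0) / (y - 0)) \<longlongrightarrow> 0) (at 0)"
    by (rule Lim_transform_eventually) (auto simp: flat_def eventually_at_filter)
  then have "(flat p has_real_derivative 0) (at 0)"
    by (simp add: has_field_derivative_iff)
  then show ?thesis using equal by (simp add: flat_def)
qed

text \<open>A class stable under differentiation: membership gives differentiability of all iterated
  derivatives, as \<open>test_functions\<close> demands, without formulas for them.\<close>

inductive_set smooth_generated :: "(real \<Rightarrow> real) set" where
  polynomial: "real_polynomial_function p \<Longrightarrow> p \<in> smooth_generated"
| flat: "real_polynomial_function p \<Longrightarrow> (\<lambda>x. flat p (\<alpha> * x + \<beta>)) \<in> smooth_generated"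
| add: "\<phi> \<in> smooth_generated \<Longrightarrow> \<psi> \<in> smooth_generated \<Longrightarrow> (\<lambda>x. \<phi> x + \<psi> x) \<in> smooth_generated"
| mult: "\<phi> \<in> smooth_generated \<Longrightarrow> \<psi> \<in> smooth_generated \<Longrightarrow> (\<lambda>x. \<phi> x * \<psi> x) \<in> smooth_generated"

lemma smooth_generated_derivative:
  assumes "\<phi> \<in> smooth_generated"
  shows "\<exists>\<phi>'\<in>smooth_generated. \<forall>x. (\<phi> has_real_derivative \<phi>' x) (at x)"
  using assms
proof induction
  case (polynomial p)
  then show ?case
    using has_real_derivative_polynomial_function smooth_generated.polynomial by metis
next
  case (flat p \<alpha> \<beta>)
  obtain p' where p': "real_polynomial_function p'" "\<And>x. (p has_real_derivative p' x) (at x)"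
    using has_real_derivative_polynomial_function flat by metis
  let ?q = "\<lambda>y. y\<^sup>2 * (p y - p' y)"
  have q: "real_polynomial_function ?q"
    by (intro real_polynomial_function.intros(4) real_polynomial_function_diff
        real_polynomial_function_power real_polynomial_function.intros(1)[OF bounded_linear_ident] flat p')
  have "((\<lambda>x. flat p (\<alpha> * x + \<beta>)) has_real_derivative flat ?q (\<alpha> * x + \<beta>) * \<alpha>) (at x)" for x
    by (rule DERIV_chain2[OF has_real_derivative_flat[OF flat p'(2)]])
       (auto intro!: derivative_eq_intros)
  moreover have "(\<lambda>x. flat ?q (\<alpha> * x + \<beta>) * \<alpha>) \<in> smooth_generated"
    by (intro smooth_generated.mult smooth_generated.flat q smooth_generated.polynomial) auto
  ultimately show ?case by (metis (no_types, lifting))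
next
  case (add \<phi> \<psi>)
  from add.IH obtain \<phi>' \<psi>' where "\<phi>' \<in> smooth_generated" "\<psi>' \<in> smooth_generated"
    "\<And>x. (\<phi> has_real_derivative \<phi>' x) (at x)" "\<And>x. (\<psi> has_real_derivative \<psi>' x) (at x)"
    by auto
  then show ?case
    by (intro bexI[of _ "\<lambda>x. \<phi>' x + \<psi>' x"]) (auto intro: DERIV_add smooth_generated.add)
next
  case (mult \<phi> \<psi>)
  from mult.IH obtain \<phi>' \<psi>' where "\<phi>' \<in> smooth_generated" "\<psi>' \<in> smooth_generated"
    "\<And>x. (\<phi> has_real_derivative \<phi>' x) (at x)" "\<And>x. (\<psi> has_real_derivative \<psi>' x) (at x)"
    by auto
  with mult show ?case
    by (intro bexI[of _ "\<lambda>x. \<phi>' x * \<psi> x + \<psi>' x * \<phi> x"])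
       (auto intro: DERIV_mult smooth_generated.add smooth_generated.mult)
qed

lemma smooth_generated_smooth:
  assumes "\<phi> \<in> smooth_generated"
  shows "(deriv ^^ n) \<phi> \<in> smooth_generated" "(deriv ^^ n) \<phi> differentiable at x"
proof -
  have d: "deriv \<psi> \<in> smooth_generated" if \<psi>: "\<psi> \<in> smooth_generated" for \<psi>
  proof -
    obtain \<psi>' where \<psi>': "\<psi>' \<in> smooth_generated" "\<And>x. (\<psi> has_real_derivative \<psi>' x) (at x)"
      using smooth_generated_derivative[OF \<psi>] by auto
    have "deriv \<psi> = \<psi>'" using DERIV_imp_deriv[OF \<psi>'(2)] by (rule ext)
    with \<psi>' show ?thesis by simp
  qed
  show *: "(deriv ^^ n) \<phi> \<in> smooth_generated" by (induction n) (use assms d in auto)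
  show "(deriv ^^ n) \<phi> differentiable at x"
    using smooth_generated_derivative[OF *] by (auto simp: real_differentiable_def)
qed

text \<open>Used with \<open>y\<close> the distance to an end point. It vanishes for
  \<open>real n * y \<le> 1\<close> and tends to 1 as \<open>n\<close> grows if
  \<open>y > 0\<close>; it has no plateau at 1, because pointwise convergence with the bound 1
  suffices for dominated convergence.\<close>

definition cutoff :: "nat \<Rightarrow> real \<Rightarrow> real" where
  "cutoff n y = flat (\<lambda>_. 1) (real n * y - 1)"

definition cutoff' :: "nat \<Rightarrow> real \<Rightarrow> real" where
  "cutoff' n y = real n * flat (\<lambda>z. z\<^sup>2) (real n * y - 1)"

lemma cutoff_bounds: "0 \<le> cutoff n y" "cutoff n y \<le> 1"
  by (auto simp: cutoff_def flat_def)

lemma cutoff'_nonneg: "0 \<le> cutoff' n y"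
  by (auto simp: cutoff'_def flat_def)

lemma cutoff_eq_0: "real n * y \<le> 1 \<Longrightarrow> cutoff n y = 0"
  by (simp add: cutoff_def flat_def)

text \<open>For fixed \<delta> the bound is of order \<open>1 / n\<close>: away from the end point
  the derivative of the cutoff disappears in the limit.\<close>

lemma cutoff'_le:
  assumes "\<delta> \<le> y" "real n * \<delta> > 1"
  shows "cutoff' n y \<le> real n / (real n * \<delta> - 1)\<^sup>2"
proof -
  have "n > 0" using assms(2) by (cases n) auto
  define z where "z = real n * y - 1"
  have z: "real n * \<delta> - 1 \<le> z" "z > 0"
    using assms mult_left_mono[OF assms(1), of "real n"] by (auto simp: z_def)
  have "cutoff' n y = real n * ((1 / z)\<^sup>2 * exp (- (1 / z)))"
    using z by (simp add: cutoff'_def flat_def z_def)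
  also have "\<dots> \<le> real n * ((1 / (real n * \<delta> - 1))\<^sup>2 * 1)"
    using z assms by (intro mult_left_mono mult_mono power_mono divide_left_mono) auto
  finally show ?thesis by (simp add: power_divide)
qed

lemma has_real_derivative_cutoff: "(cutoff n has_real_derivative cutoff' n y) (at y)"
proof -
  have p: "real_polynomial_function (\<lambda>_. 1)" by auto
  have "(flat (\<lambda>_. 1) has_real_derivative flat (\<lambda>z. z\<^sup>2 * (1 - 0)) (real n * y - 1)) (at (real n * y - 1))"
    by (rule has_real_derivative_flat[OF p]) auto
  then have "((\<lambda>y. flat (\<lambda>_. 1) (real n * y - 1)) has_real_derivative
      flat (\<lambda>z. z\<^sup>2 * (1 - 0)) (real n * y - 1) * real n) (at y)"
    by (rule DERIV_chain2) (auto intro!: derivative_eq_intros)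
  then show ?thesis by (simp add: cutoff_def[abs_def] cutoff'_def mult.commute)
qed

lemma continuous_on_cutoff': "continuous_on S (cutoff' n)"
proof -
  have p: "real_polynomial_function (\<lambda>z::real. z\<^sup>2)"
    by (intro real_polynomial_function_power real_polynomial_function.intros(1)) auto
  have p': "((\<lambda>z::real. z\<^sup>2) has_real_derivative 2 * x) (at x)" for x
    by (auto intro!: derivative_eq_intros)
  have "continuous_on UNIV (flat (\<lambda>z. z\<^sup>2))"
    by (rule DERIV_imp_continuous_on[OF has_real_derivative_flat[OF p p']])
  then have "continuous_on S (\<lambda>y. flat (\<lambda>z. z\<^sup>2) (real n * y - 1))"
    by (rule continuous_on_compose2) (auto intro!: continuous_intros)
  then show ?thesis unfolding cutoff'_def by (intro continuous_intros)
qed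

lemma continuous_on_cutoff_compose:
  assumes "continuous_on S f"
  shows "continuous_on S (\<lambda>x. cutoff n (f x))" "continuous_on S (\<lambda>x. cutoff' n (f x))"
  using continuous_on_compose2[OF DERIV_imp_continuous_on[OF has_real_derivative_cutoff, of UNIV] assms]
    continuous_on_compose2[OF continuous_on_cutoff'[of UNIV] assms] by auto

lemma cutoff_tendsto_1:
  assumes "y > 0"
  shows "(\<lambda>n. cutoff n y) \<longlonglongrightarrow> 1"
proof -
  have "filterlim (\<lambda>n. real n * y + (- 1)) at_top sequentially"
    using filterlim_tendsto_add_at_top[OF tendsto_const[of "-1"]
        filterlim_at_top_mult_tendsto_pos[OF tendsto_const assms filterlim_real_sequentially]]
    by (simp add: add.commute)
  then have f: "filterlim (\<lambda>n. real n * y - 1) at_top sequentially" by simp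
  have "((\<lambda>z::real. exp (- (inverse z))) \<longlongrightarrow> exp (- 0)) at_top"
    by (intro tendsto_intros tendsto_inverse_0_at_top filterlim_ident)
  then have "((\<lambda>z::real. exp (- (inverse z))) \<longlongrightarrow> 1) at_top" by simp
  then have "((\<lambda>z::real. flat (\<lambda>_. 1) z) \<longlongrightarrow> 1) at_top"
  proof (rule Lim_transform_eventually)
    show "eventually (\<lambda>z::real. exp (- (inverse z)) = flat (\<lambda>_. 1) z) at_top"
      using eventually_gt_at_top[of 0] by eventually_elim (simp add: flat_def inverse_eq_divide)
  qed
  from filterlim_compose[OF this f] show ?thesis unfolding cutoff_def .
qed

text \<open>\<open>cutoff' n\<close> acts as an approximate identity concentrated at the end point \<open>e\<close> at which \<open>Z\<close> vanishes.\<close>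

lemma boundary_layer_vanishes:
  fixes Z :: "real \<Rightarrow> real"
  assumes ab: "a < b" and Z: "continuous_on {a..b} Z" and e: "e \<in> {a..b}" "Z e = 0"
    and \<sigma>: "\<bar>\<sigma>\<bar> = 1" "\<And>x. x \<in> {a..b} \<Longrightarrow> \<sigma> * (x - e) \<ge> 0"
  shows "(\<lambda>n. LINT x|lebesgue_on {a<..<b}. \<bar>Z x\<bar> * cutoff' n (\<sigma> * (x - e))) \<longlonglongrightarrow> 0"
proof (rule LIMSEQ_I)
  fix r :: real
  assume r: "r > 0"
  let ?I = "\<lambda>n. LINT x|lebesgue_on {a<..<b}. \<bar>Z x\<bar> * cutoff' n (\<sigma> * (x - e))"
  define \<epsilon> where "\<epsilon> = r / 2"
  have "\<epsilon> > 0" using r by (simp add: \<epsilon>_def)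
  obtain M where "M \<ge> 0" and M: "\<And>x. x \<in> {a..b} \<Longrightarrow> \<bar>Z x\<bar> \<le> M"
    using continuous_on_Icc_bound[OF Z] by metis
  obtain \<delta> where \<delta>: "\<delta> > 0" "\<And>x. x \<in> {a..b} \<Longrightarrow> \<bar>x - e\<bar> < \<delta> \<Longrightarrow> \<bar>Z x\<bar> < \<epsilon>"
  proof -
    obtain d where "d > 0" "\<forall>x\<in>{a..b}. dist x e < d \<longrightarrow> dist (Z x) (Z e) < \<epsilon>"
      using Z e(1) \<open>\<epsilon> > 0\<close> unfolding continuous_on_iff by blast
    then show ?thesis using that[of d] e(2) by (auto simp: dist_real_def)
  qed
  have abs\<sigma>: "\<sigma> * (x - e) = \<bar>x - e\<bar>" if "x \<in> {a..b}" for x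
    using \<sigma>(2)[OF that] abs_mult[of \<sigma> "x - e"] \<sigma>(1) by simp
  have cont: "continuous_on {a..b} (\<lambda>x. cutoff' n (\<sigma> * (x - e)))" for n
    by (rule continuous_on_compose2[OF continuous_on_cutoff'[of UNIV]]) (auto intro!: continuous_intros)
  \<comment> \<open>The leading \<sigma> compensates the inner derivative, since
    \<open>\<sigma> * \<sigma> = 1\<close>.\<close>
  have der: "((\<lambda>x. \<sigma> * cutoff n (\<sigma> * (x - e))) has_real_derivative cutoff' n (\<sigma> * (x - e))) (at x within {a..b})" for n x
  proof -
    have "((\<lambda>x. cutoff n (\<sigma> * (x - e))) has_real_derivative cutoff' n (\<sigma> * (x - e)) * \<sigma>) (at x within {a..b})"
      by (rule DERIV_chain2[OF has_real_derivative_cutoff]) (auto intro!: derivative_eq_intros)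
    from DERIV_cmult[OF this, of \<sigma>] show ?thesis
      using \<sigma>(1) by (auto simp: abs_if split: if_splits)
  qed
  have tot: "(LINT x|lebesgue_on {a<..<b}. cutoff' n (\<sigma> * (x - e))) \<le> 1" for n
  proof -
    have "(LINT x|lebesgue_on {a<..<b}. cutoff' n (\<sigma> * (x - e)))
      = \<sigma> * cutoff n (\<sigma> * (b - e)) - \<sigma> * cutoff n (\<sigma> * (a - e))"
      using ab by (intro integral_FTC_Ioo der cont) auto
    also have "\<dots> \<le> 1"
      using cutoff_bounds[of n "\<sigma> * (b - e)"] cutoff_bounds[of n "\<sigma> * (a - e)"] \<sigma>(1)
      by (auto simp: abs_if split: if_splits)
    finally show ?thesis .
  qed
  define c where "c n = real n / (real n * \<delta> - 1)\<^sup>2" for n :: nat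
  \<comment> \<open>Near \<open>e\<close> the factor \<open>\<bar>Z x\<bar>\<close> is below
    \<epsilon> while \<open>cutoff'\<close> has mass at most 1; at distance at least \<delta> from
    \<open>e\<close>, \<open>cutoff'\<close> is at most \<open>c n\<close>, which tends to
    0.\<close>
  have bnd: "?I n \<le> \<epsilon> + M * c n * (b - a)" if n: "real n * \<delta> > 1" for n
  proof -
    have "?I n \<le> (LINT x|lebesgue_on {a<..<b}. \<epsilon> * cutoff' n (\<sigma> * (x - e)) + M * c n)"
    proof (intro integral_mono continuous_on_integrable_Ioo continuous_intros Z cont)
      fix x
      assume "x \<in> space (lebesgue_on {a<..<b})"
      then have x: "x \<in> {a..b}" by auto
      have c: "M * c n \<ge> 0" using \<open>M \<ge> 0\<close> by (simp add: c_def)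
      have p: "\<epsilon> * cutoff' n (\<sigma> * (x - e)) \<ge> 0" using \<open>\<epsilon> > 0\<close> cutoff'_nonneg by simp
      show "\<bar>Z x\<bar> * cutoff' n (\<sigma> * (x - e)) \<le> \<epsilon> * cutoff' n (\<sigma> * (x - e)) + M * c n"
      proof (cases "\<bar>x - e\<bar> < \<delta>")
        case True
        have "\<bar>Z x\<bar> * cutoff' n (\<sigma> * (x - e)) \<le> \<epsilon> * cutoff' n (\<sigma> * (x - e))"
          using \<delta>(2)[OF x True] by (intro mult_right_mono cutoff'_nonneg) auto
        with c show ?thesis by linarith
      next
        case False
        have "\<bar>Z x\<bar> * cutoff' n (\<sigma> * (x - e)) \<le> M * c n"
          unfolding c_def using False n x
          by (intro mult_mono M cutoff'_le cutoff'_nonneg) (simp_all add: abs\<sigma> \<open>M \<ge> 0\<close>)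
        with p show ?thesis by linarith
      qed
    qed
    also have "\<dots> = \<epsilon> * (LINT x|lebesgue_on {a<..<b}. cutoff' n (\<sigma> * (x - e))) + M * c n * (b - a)"
      using continuous_on_integrable_Ioo[OF cont[of n]] ab finite_measure_lebesgue_on_Ioo[of a b]
      by (simp add: measure_lebesgue_on_Ioo finite_measure.integrable_const)
    also have "\<dots> \<le> \<epsilon> * 1 + M * c n * (b - a)"
      using tot[of n] \<open>\<epsilon> > 0\<close> by (intro add_right_mono mult_left_mono) auto
    finally show ?thesis by simp
  qed
  have "c \<longlonglongrightarrow> 0"
  proof -
    have "(\<lambda>n. inverse (real n) * (inverse (\<delta> - inverse (real n)))\<^sup>2) \<longlonglongrightarrow> 0 * (inverse (\<delta> - 0))\<^sup>2"
      using \<delta>(1) by (intro tendsto_intros lim_inverse_n) auto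
    then have "(\<lambda>n. inverse (real n) * (inverse (\<delta> - inverse (real n)))\<^sup>2) \<longlonglongrightarrow> 0" by simp
    moreover have "eventually (\<lambda>n. inverse (real n) * (inverse (\<delta> - inverse (real n)))\<^sup>2 = c n) sequentially"
      using eventually_gt_at_top[of 0]
    proof eventually_elim
      case (elim n)
      have "\<delta> - inverse (real n) = (real n * \<delta> - 1) / real n"
        using elim by (simp add: field_simps)
      then show ?case
        using elim by (simp add: c_def power_divide power2_eq_square)
    qed
    ultimately show ?thesis by (rule Lim_transform_eventually)
  qed
  then have "(\<lambda>n. \<epsilon> + M * c n * (b - a)) \<longlonglongrightarrow> \<epsilon> + M * 0 * (b - a)"
    by (intro tendsto_intros)
  moreover have "\<epsilon> + M * 0 * (b - a) < r" using r by (simp add: \<epsilon>_def)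
  ultimately have "eventually (\<lambda>n. \<epsilon> + M * c n * (b - a) < r) sequentially"
    by (rule order_tendstoD(2))
  moreover have "eventually (\<lambda>n. real n * \<delta> > 1) sequentially"
  proof -
    have "eventually (\<lambda>n. real n > 1 / \<delta>) sequentially"
      using filterlim_real_sequentially unfolding filterlim_at_top_dense by blast
    then show ?thesis by eventually_elim (use \<delta>(1) in \<open>simp add: field_simps\<close>)
  qed
  ultimately have "eventually (\<lambda>n. norm (?I n - 0) < r) sequentially"
  proof eventually_elim
    case (elim n)
    have "?I n \<ge> 0" by (intro integral_nonneg_AE AE_I2 mult_nonneg_nonneg cutoff'_nonneg) auto
    with bnd[OF elim(2)] elim(1) show ?case by simp
  qed
  then show "\<exists>n0. \<forall>n\<ge>n0. norm (?I n - 0) < r"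
    by (simp add: eventually_sequentially)
qed

section \<open>Integration by parts up to the boundary\<close>

lemma polynomial_antiderivative:
  assumes "real_polynomial_function p"
  obtains P where "real_polynomial_function P" "\<And>x. (P has_real_derivative p x) (at x)"
proof -
  obtain c n where p: "p = (\<lambda>x. \<Sum>i\<le>n. c i * x ^ i)"
    using assms by (auto simp: real_polynomial_function_iff_sum)
  let ?P = "\<lambda>x. \<Sum>i\<le>n. c i / real (Suc i) * x ^ Suc i"
  have "real_polynomial_function ?P"
    by (intro real_polynomial_function_sum real_polynomial_function.intros(4)
        real_polynomial_function_power real_polynomial_function.intros(1)[OF bounded_linear_ident]
        real_polynomial_function.intros(2)) auto
  moreover have "(?P has_real_derivative p x) (at x)" for x
    unfolding p
  proof (rule DERIV_sum)
    fix i
    have "((\<lambda>x. c i / real (Suc i) * x ^ Suc i) has_real_derivative c i / real (Suc i) * (real (Suc i) * x ^ i)) (at x)"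
      using DERIV_cmult[OF DERIV_pow[of "Suc i" x], of "c i / real (Suc i)"] by (simp del: power_Suc)
    then show "((\<lambda>x. c i / real (Suc i) * x ^ Suc i) has_real_derivative c i * x ^ i) (at x)"
      by simp
  qed
  ultimately show ?thesis by (rule that)
qed

text \<open>For a polynomial factor the truncated product lies in \<open>smooth_generated\<close>
  and is thus an admissible test function; less regular factors are reached later by
  approximation.\<close>

lemma cutoff_polynomial_test_function:
  fixes a b :: real
  assumes P: "real_polynomial_function P" and P': "\<And>x. (P has_real_derivative P' x) (at x)" and n: "n > 0"
  defines "\<phi> \<equiv> \<lambda>x. P x * (cutoff n (x - a) * cutoff n (b - x))"
  shows "\<phi> \<in> test_functions a b"
    and "deriv \<phi> x = P' x * (cutoff n (x - a) * cutoff n (b - x))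
      + P x * (cutoff' n (x - a) * cutoff n (b - x) - cutoff n (x - a) * cutoff' n (b - x))"
proof -
  have 1: "cutoff n (x - a) = flat (\<lambda>_. 1) (real n * x + (- real n * a - 1))"
    "cutoff n (b - x) = flat (\<lambda>_. 1) (- real n * x + (real n * b - 1))" for x
    by (simp_all add: cutoff_def algebra_simps)
  have "\<phi> \<in> smooth_generated"
    unfolding \<phi>_def 1 by (intro smooth_generated.intros P real_polynomial_function.intros(2))
  moreover have "\<phi> x = 0" if "x \<notin> {a + 1 / real n..b - 1 / real n}" for x
  proof -
    have "real n * (x - a) \<le> 1 \<or> real n * (b - x) \<le> 1"
      using that n by (auto simp: field_simps)
    then show ?thesis by (auto simp: \<phi>_def cutoff_eq_0)
  qed
  then have "a < a + 1 / real n \<and> b - 1 / real n < b \<and>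
      (\<forall>x. x \<notin> {a + 1 / real n..b - 1 / real n} \<longrightarrow> \<phi> x = 0)"
    using n by simp
  then have "\<exists>c d. a < c \<and> d < b \<and> (\<forall>x. x \<notin> {c..d} \<longrightarrow> \<phi> x = 0)" by blast
  ultimately show "\<phi> \<in> test_functions a b"
    unfolding test_functions_def using smooth_generated_smooth(2) by blast
  have "((\<lambda>x. cutoff n (x - a)) has_real_derivative cutoff' n (x - a) * 1) (at x)"
    by (rule DERIV_chain2[OF has_real_derivative_cutoff]) (auto intro!: derivative_eq_intros)
  moreover have "((\<lambda>x. cutoff n (b - x)) has_real_derivative cutoff' n (b - x) * (- 1)) (at x)"
    by (rule DERIV_chain2[OF has_real_derivative_cutoff]) (auto intro!: derivative_eq_intros)
  ultimately have "(\<phi> has_real_derivative P' x * (cutoff n (x - a) * cutoff n (b - x))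
      + (cutoff' n (x - a) * 1 * cutoff n (b - x) + cutoff' n (b - x) * (- 1) * cutoff n (x - a)) * P x) (at x)"
    unfolding \<phi>_def by (intro DERIV_mult P')
  from DERIV_imp_deriv[OF this]
  show "deriv \<phi> x = P' x * (cutoff n (x - a) * cutoff n (b - x))
      + P x * (cutoff' n (x - a) * cutoff n (b - x) - cutoff n (x - a) * cutoff' n (b - x))"
    by (simp add: algebra_simps)
qed

lemma cutoff_integral_tendsto:
  assumes u: "integrable (lebesgue_on {a<..<b}) u"
  shows "(\<lambda>n. LINT x|lebesgue_on {a<..<b}. u x * (cutoff n (x - a) * cutoff n (b - x)))
    \<longlonglongrightarrow> (LINT x|lebesgue_on {a<..<b}. u x)"
proof (rule integral_dominated_convergence[where w = "\<lambda>x. \<bar>u x\<bar>"])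
  have cont: "continuous_on {a..b} (\<lambda>x. cutoff n (x - a) * cutoff n (b - x))" for n
  proof -
    show ?thesis
      by (intro continuous_on_mult continuous_on_cutoff_compose continuous_intros)
  qed
  have [measurable]: "u \<in> borel_measurable (lebesgue_on {a<..<b})" using u by auto
  have [measurable]: "(\<lambda>x. cutoff n (x - a) * cutoff n (b - x)) \<in> borel_measurable (lebesgue_on {a<..<b})" for n
    using continuous_on_integrable_Ioo[OF cont[of n]] by auto
  show "(\<lambda>x. u x * (cutoff n (x - a) * cutoff n (b - x))) \<in> borel_measurable (lebesgue_on {a<..<b})" for n
    by measurable
  show "AE x in lebesgue_on {a<..<b}. (\<lambda>n. u x * (cutoff n (x - a) * cutoff n (b - x))) \<longlonglongrightarrow> u x"
  proof (intro AE_I2)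
    fix x
    assume "x \<in> space (lebesgue_on {a<..<b})"
    then have "(\<lambda>n. u x * (cutoff n (x - a) * cutoff n (b - x))) \<longlonglongrightarrow> u x * (1 * 1)"
      by (intro tendsto_mult tendsto_const cutoff_tendsto_1) auto
    then show "(\<lambda>n. u x * (cutoff n (x - a) * cutoff n (b - x))) \<longlonglongrightarrow> u x" by simp
  qed
  show "AE x in lebesgue_on {a<..<b}. norm (u x * (cutoff n (x - a) * cutoff n (b - x))) \<le> \<bar>u x\<bar>" for n
  proof (intro AE_I2)
    fix x
    have "\<bar>u x\<bar> * (cutoff n (x - a) * cutoff n (b - x)) \<le> \<bar>u x\<bar> * (1 * 1)"
      by (intro mult_left_mono mult_mono cutoff_bounds) auto
    then show "norm (u x * (cutoff n (x - a) * cutoff n (b - x))) \<le> \<bar>u x\<bar>"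
      by (simp add: abs_mult cutoff_bounds)
  qed
qed (use u in auto)

text \<open>The weak derivative may only be tested with functions supported away from the end
  points, so \<open>P\<close> is truncated. Differentiating the cutoffs leaves boundary layer terms,
  which vanish in the limit because \<open>J\<close> is zero at both ends.\<close>

lemma weak_derivative_by_parts_polynomial:
  assumes ab: "a < b" and w: "has_weak_derivative_L2 a b J q"
    and J: "continuous_on {a..b} J" "J a = 0" "J b = 0"
    and P: "real_polynomial_function P" "\<And>x. (P has_real_derivative P' x) (at x)" "continuous_on {a..b} P'"
  shows "(LINT x|lebesgue_on {a<..<b}. P x * q x) = - (LINT x|lebesgue_on {a<..<b}. P' x * J x)"
proof -
  let ?L = "lebesgue_on {a<..<b}"
  let ?c = "\<lambda>n x. cutoff n (x - a) * cutoff n (b - x)"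
  let ?c' = "\<lambda>n x. cutoff' n (x - a) * cutoff n (b - x) - cutoff n (x - a) * cutoff' n (b - x)"
  have contP: "continuous_on {a..b} P"
    by (rule DERIV_imp_continuous_on[OF P(2)])
  have JP: "continuous_on {a..b} (\<lambda>x. J x * P x)"
    by (intro continuous_intros J contP)
  have shift: "continuous_on {a..b} (\<lambda>x. cutoff n (x - a))" "continuous_on {a..b} (\<lambda>x. cutoff n (b - x))"
    "continuous_on {a..b} (\<lambda>x. cutoff' n (x - a))" "continuous_on {a..b} (\<lambda>x. cutoff' n (b - x))" for n
    by (intro continuous_on_cutoff_compose continuous_intros)+
  have q: "q \<in> L2_space a b" using w by (simp add: has_weak_derivative_L2_def)
  have Pq: "integrable ?L (\<lambda>x. P x * q x)"
    by (intro L2_mult_integrable continuous_on_imp_L2 contP q)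
  have P'J: "integrable ?L (\<lambda>x. P' x * J x)"
    by (intro continuous_on_integrable_Ioo continuous_intros J P)
  have id: "(LINT x|?L. (P' x * J x) * ?c n x) + (LINT x|?L. (J x * P x) * ?c' n x)
      = - (LINT x|?L. (P x * q x) * ?c n x)" if n: "n > 0" for n
  proof -
    have "(LINT x|?L. (P' x * J x) * ?c n x) + (LINT x|?L. (J x * P x) * ?c' n x)
      = (LINT x|?L. (P' x * J x) * ?c n x + (J x * P x) * ?c' n x)"
      by (intro Bochner_Integration.integral_add[symmetric] continuous_on_integrable_Ioo
          continuous_intros J P contP shift)
    also have "\<dots> = (LINT x|?L. J x * deriv (\<lambda>x. P x * ?c n x) x)"
      unfolding cutoff_polynomial_test_function(2)[OF P(1,2) n] by (simp add: algebra_simps)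
    also have "\<dots> = - (LINT x|?L. q x * (P x * ?c n x))"
      using w cutoff_polynomial_test_function(1)[OF P(1,2) n, of a b]
      unfolding has_weak_derivative_L2_def by blast
    finally show ?thesis by (simp add: mult_ac)
  qed
  have "(\<lambda>n. LINT x|?L. (J x * P x) * ?c' n x) \<longlonglongrightarrow> 0"
  proof (rule Lim_null_comparison)
    \<comment> \<open>The factors 1 and -1 are the orientations \<sigma> of
      \<open>boundary_layer_vanishes\<close> at the left and at the right end point.\<close>
    let ?B = "\<lambda>n. (LINT x|?L. \<bar>J x * P x\<bar> * cutoff' n (1 * (x - a))) + (LINT x|?L. \<bar>J x * P x\<bar> * cutoff' n (- 1 * (x - b)))"
    have "?B \<longlonglongrightarrow> 0 + 0"
      using ab J by (intro tendsto_add boundary_layer_vanishes JP) auto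
    then show "?B \<longlonglongrightarrow> 0" by simp
    show "eventually (\<lambda>n. norm (LINT x|?L. (J x * P x) * ?c' n x) \<le> ?B n) sequentially"
    proof (intro always_eventually allI)
      fix n
      have "norm (LINT x|?L. (J x * P x) * ?c' n x) \<le> (LINT x|?L. norm ((J x * P x) * ?c' n x))"
        by (rule integral_norm_bound)
      also have "\<dots> \<le> (LINT x|?L. \<bar>J x * P x\<bar> * cutoff' n (1 * (x - a)) + \<bar>J x * P x\<bar> * cutoff' n (- 1 * (x - b)))"
      proof (intro integral_mono)
        fix x
        have c: "0 \<le> cutoff' n (x - a) * cutoff n (b - x)" "0 \<le> cutoff n (x - a) * cutoff' n (b - x)"
          "cutoff' n (x - a) * cutoff n (b - x) \<le> cutoff' n (x - a) * 1"
          "cutoff n (x - a) * cutoff' n (b - x) \<le> 1 * cutoff' n (b - x)"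
          by (intro mult_nonneg_nonneg mult_left_mono mult_right_mono cutoff_bounds cutoff'_nonneg)+
        then have "\<bar>?c' n x\<bar> \<le> cutoff' n (x - a) + cutoff' n (b - x)"
          by (simp add: abs_le_iff)
        then have "\<bar>J x * P x\<bar> * \<bar>?c' n x\<bar> \<le> \<bar>J x * P x\<bar> * (cutoff' n (x - a) + cutoff' n (b - x))"
          by (intro mult_left_mono) auto
        then show "norm ((J x * P x) * ?c' n x)
            \<le> \<bar>J x * P x\<bar> * cutoff' n (1 * (x - a)) + \<bar>J x * P x\<bar> * cutoff' n (- 1 * (x - b))"
          unfolding real_norm_def abs_mult[of "J x * P x"] by (simp add: distrib_left)
      qed (auto intro!: continuous_on_integrable_Ioo continuous_intros JP shift)
      also have "\<dots> = ?B n"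
        by (rule Bochner_Integration.integral_add)
           (auto intro!: continuous_on_integrable_Ioo continuous_intros JP shift)
      finally show "norm (LINT x|?L. (J x * P x) * ?c' n x) \<le> ?B n" .
    qed
  qed
  from tendsto_add[OF cutoff_integral_tendsto[OF P'J] this]
  have "(\<lambda>n. (LINT x|?L. (P' x * J x) * ?c n x) + (LINT x|?L. (J x * P x) * ?c' n x)) \<longlonglongrightarrow> (LINT x|?L. P' x * J x)"
    by simp
  moreover have "eventually (\<lambda>n. (LINT x|?L. (P' x * J x) * ?c n x) + (LINT x|?L. (J x * P x) * ?c' n x)
      = - (LINT x|?L. (P x * q x) * ?c n x)) sequentially"
    using eventually_gt_at_top[of 0] by eventually_elim (rule id)
  ultimately have "(\<lambda>n. - (LINT x|?L. (P x * q x) * ?c n x)) \<longlonglongrightarrow> (LINT x|?L. P' x * J x)"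
    by (rule Lim_transform_eventually)
  with tendsto_minus[OF cutoff_integral_tendsto[OF Pq]]
  have "- (LINT x|?L. P x * q x) = (LINT x|?L. P' x * J x)"
    by (rule LIMSEQ_unique)
  then show ?thesis by simp
qed

text \<open>The energy argument tests with functions that are only C^1. Approximating \<psi>'
  uniformly by polynomials and integrating them also approximates \<psi>, and both integrals are
  stable under such perturbations.\<close>

lemma weak_derivative_by_parts:
  assumes ab: "a < b" and w: "has_weak_derivative_L2 a b J q"
    and J: "continuous_on {a..b} J" "J a = 0" "J b = 0"
    and \<psi>: "\<And>x. x \<in> {a..b} \<Longrightarrow> (\<psi> has_real_derivative \<psi>' x) (at x within {a..b})"
    and \<psi>': "continuous_on {a..b} \<psi>'"
  shows "(LINT x|lebesgue_on {a<..<b}. \<psi> x * q x) = - (LINT x|lebesgue_on {a<..<b}. \<psi>' x * J x)"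
proof -
  let ?L = "lebesgue_on {a<..<b}"
  define X where "X = (LINT x|?L. \<psi> x * q x) + (LINT x|?L. \<psi>' x * J x)"
  define C where "C = (b - a) * (LINT x|?L. \<bar>q x\<bar>) + (LINT x|?L. \<bar>J x\<bar>)"
  have q: "q \<in> L2_space a b" using w by (simp add: has_weak_derivative_L2_def)
  note qi = L2_imp_integrable[OF q]
  have cont\<psi>: "continuous_on {a..b} \<psi>"
    using \<psi> by (rule DERIV_continuous_on)
  have bound: "\<bar>X\<bar> \<le> \<epsilon> * C" if "\<epsilon> > 0" for \<epsilon>
  proof -
    obtain p where p: "real_polynomial_function p" "\<And>x. x \<in> {a..b} \<Longrightarrow> \<bar>\<psi>' x - p x\<bar> < \<epsilon>"
      using Stone_Weierstrass_real_polynomial_function[OF compact_Icc \<psi>' \<open>\<epsilon> > 0\<close>] by metis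
    obtain P0 where P0: "real_polynomial_function P0" "\<And>x. (P0 has_real_derivative p x) (at x)"
      using polynomial_antiderivative[OF p(1)] by metis
    \<comment> \<open>The additive constant makes \<open>P a = \<psi> a\<close>, so that closeness
      of the derivatives controls \<open>\<psi> - P\<close> on the whole interval.\<close>
    define P where "P x = P0 x + (\<psi> a - P0 a)" for x
    have P: "real_polynomial_function P" "\<And>x. (P has_real_derivative p x) (at x)"
      unfolding P_def
      by (intro real_polynomial_function.intros(2,3) P0)
         (use DERIV_add[OF P0(2) DERIV_const] in simp)
    have contp: "continuous_on {a..b} p"
      using p(1) by (simp add: continuous_on_polymonial_function real_polynomial_function_eq)
    have contP: "continuous_on {a..b} P"
      by (rule DERIV_imp_continuous_on[OF P(2)])
    have close: "\<bar>\<psi> x - P x\<bar> \<le> \<epsilon> * (b - a)" if x: "x \<in> {a..b}" for x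
    proof -
      have "norm ((\<psi> x - P x) - (\<psi> a - P a)) \<le> \<epsilon> * norm (x - a)"
      proof (rule field_differentiable_bound[of "{a..b}" _ "\<lambda>x. \<psi>' x - p x"])
        show "((\<lambda>x. \<psi> x - P x) has_real_derivative \<psi>' z - p z) (at z within {a..b})" if "z \<in> {a..b}" for z
          by (rule DERIV_diff[OF \<psi>[OF that] has_field_derivative_at_within[OF P(2)]])
        show "norm (\<psi>' z - p z) \<le> \<epsilon>" if "z \<in> {a..b}" for z
          using p(2)[OF that] by simp
      qed (use x ab in auto)
      also have "\<dots> \<le> \<epsilon> * (b - a)"
        using x \<open>\<epsilon> > 0\<close> by (intro mult_left_mono) auto
      finally show ?thesis by (simp add: P_def)
    qed
    have i: "integrable ?L (\<lambda>x. \<psi> x * q x)" "integrable ?L (\<lambda>x. P x * q x)"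
      "integrable ?L (\<lambda>x. \<psi>' x * J x)" "integrable ?L (\<lambda>x. p x * J x)"
      by (intro L2_mult_integrable continuous_on_imp_L2 cont\<psi> contP contp \<psi>' J q)+
    have i2: "integrable ?L (\<lambda>x. (\<psi> x - P x) * q x)" "integrable ?L (\<lambda>x. (\<psi>' x - p x) * J x)"
      by (intro L2_mult_integrable continuous_on_imp_L2 continuous_intros cont\<psi> contP contp \<psi>' J q)+
    have "X = (LINT x|?L. (\<psi> x - P x) * q x) + (LINT x|?L. (\<psi>' x - p x) * J x)"
      using weak_derivative_by_parts_polynomial[OF ab w J P contp] i
      by (simp add: X_def left_diff_distrib)
    also have "\<bar>\<dots>\<bar> \<le> (LINT x|?L. \<bar>(\<psi> x - P x) * q x\<bar>) + (LINT x|?L. \<bar>(\<psi>' x - p x) * J x\<bar>)"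
      by (intro order_trans[OF abs_triangle_ineq] add_mono integral_abs_bound)
    also have "\<dots> \<le> (LINT x|?L. \<epsilon> * (b - a) * \<bar>q x\<bar>) + (LINT x|?L. \<epsilon> * \<bar>J x\<bar>)"
    proof (intro add_mono integral_mono integrable_abs i2 integrable_mult_right qi continuous_on_integrable_Ioo J)
      fix x
      assume "x \<in> space ?L"
      then have x: "x \<in> {a..b}" by auto
      show "\<bar>(\<psi> x - P x) * q x\<bar> \<le> \<epsilon> * (b - a) * \<bar>q x\<bar>"
        unfolding abs_mult by (intro mult_right_mono close x) auto
      show "\<bar>(\<psi>' x - p x) * J x\<bar> \<le> \<epsilon> * \<bar>J x\<bar>"
        unfolding abs_mult using p(2)[OF x] by (intro mult_right_mono) auto
    qed
    also have "\<dots> = \<epsilon> * C" by (simp add: C_def distrib_left mult.assoc)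
    finally show ?thesis .
  qed
  have "X = 0"
  proof (rule ccontr)
    assume "X \<noteq> 0"
    have "C \<ge> 0" unfolding C_def using ab by (intro add_nonneg_nonneg mult_nonneg_nonneg integral_nonneg_AE) auto
    \<comment> \<open>With \<epsilon> equal to \<open>\<bar>X\<bar> / (2 * (C + 1))\<close> the
      right side stays below \<open>\<bar>X\<bar> / 2\<close>; the \<open>+ 1\<close> guards against
      \<open>C = 0\<close>.\<close>
    have "\<bar>X\<bar> \<le> \<bar>X\<bar> / (2 * (C + 1)) * C"
      using \<open>X \<noteq> 0\<close> \<open>C \<ge> 0\<close> by (intro bound) auto
    then have "\<bar>X\<bar> * (2 * (C + 1)) \<le> \<bar>X\<bar> * C"
      using \<open>C \<ge> 0\<close> by (simp add: field_simps)
    then show False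
      using \<open>X \<noteq> 0\<close> \<open>C \<ge> 0\<close> by (simp add: mult_le_cancel_left)
  qed
  then show ?thesis by (simp add: X_def)
qed

subsection \<open>Dissipation\<close>

lemma has_real_derivative_Phi:
  assumes p: "p > 1"
  shows "(Phi p has_real_derivative p * \<bar>x\<bar> powr (p - 1)) (at x)"
proof (cases x "0 :: real" rule: linorder_cases)
  case greater
  have "((\<lambda>y. y powr p) has_real_derivative p * x powr (p - 1)) (at x)"
    using greater by (rule has_real_derivative_powr)
  then have "(Phi p has_real_derivative p * x powr (p - 1)) (at x)"
  proof (rule has_field_derivative_transform_within_open[of _ _ _ "{0<..}"])
    show "y powr p = Phi p y" if "y \<in> {0<..}" for y
      using that powr_add[of y "p - 1" 1] by (simp add: Phi_def)
  qed (use greater in auto)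
  then show ?thesis using greater by simp
next
  case less
  have "((\<lambda>y. y powr p) has_real_derivative p * (- x) powr (p - 1)) (at (- x))"
    using less by (intro has_real_derivative_powr) auto
  then have "((\<lambda>y. (- y) powr p) has_real_derivative p * (- x) powr (p - 1) * (- 1)) (at x)"
    by (rule DERIV_chain2) (auto intro!: derivative_eq_intros)
  from DERIV_minus[OF this]
  have "((\<lambda>y. - ((- y) powr p)) has_real_derivative p * (- x) powr (p - 1)) (at x)" by simp
  then have "(Phi p has_real_derivative p * (- x) powr (p - 1)) (at x)"
  proof (rule has_field_derivative_transform_within_open[of _ _ _ "{..<0}"])
    show "- ((- y) powr p) = Phi p y" if "y \<in> {..<0}" for y
      using that powr_add[of "- y" "p - 1" 1] by (simp add: Phi_def)
  qed (use less in auto)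
  then show ?thesis using less by simp
next
  case equal
  \<comment> \<open>The difference quotient of \<open>Phi p\<close> at 0 equals
    \<open>\<bar>y\<bar> powr (p - 1)\<close>, which tends to 0 since \<open>p > 1\<close>.\<close>
  have "((\<lambda>y::real. \<bar>y\<bar> powr (p - 1)) \<longlongrightarrow> \<bar>0\<bar> powr (p - 1)) (at 0)"
    using p by (intro tendsto_intros) auto
  then have "((\<lambda>y. (Phi p y - Phi p 0) / (y - 0)) \<longlongrightarrow> 0) (at 0)"
  proof (rule Lim_transform_eventually[THEN tendsto_eq_rhs])
    show "eventually (\<lambda>y. \<bar>y\<bar> powr (p - 1) = (Phi p y - Phi p 0) / (y - 0)) (at 0)"
      by (auto simp: Phi_def eventually_at_filter)
  qed simp
  then show ?thesis using equal by (simp add: has_field_derivative_iff)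
qed

lemma Phi_mono:
  assumes "p > 1" "x \<le> y"
  shows "Phi p x \<le> Phi p y"
  by (rule DERIV_nonneg_imp_nondecreasing[OF assms(2)])
     (use has_real_derivative_Phi[OF assms(1)] assms(1) in force)

text \<open>The form in which monotonicity enters the energy estimate: the nonlinear flux difference
  paired with the difference of the third derivatives has a favourable sign.\<close>

lemma Phi_monotone_product:
  assumes "p > 1"
  shows "0 \<le> (Phi p x - Phi p y) * (x - y)"
  using Phi_mono[OF assms, of x y] Phi_mono[OF assms, of y x]
  by (cases "x \<le> y") (auto intro: mult_nonneg_nonneg mult_nonpos_nonpos)

text \<open>For the pairing of the nonlinear flux with first derivatives, where monotonicity gives
  no sign.\<close>

lemma Phi_Lipschitz:
  assumes p: "p > 1" and x: "\<bar>x\<bar> \<le> M" and y: "\<bar>y\<bar> \<le> M"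
  shows "\<bar>Phi p x - Phi p y\<bar> \<le> p * M powr (p - 1) * \<bar>x - y\<bar>"
proof -
  have "norm (Phi p x - Phi p y) \<le> p * M powr (p - 1) * norm (x - y)"
  proof (rule field_differentiable_bound[of "{-M..M}" "Phi p" "\<lambda>z. p * \<bar>z\<bar> powr (p - 1)"])
    show "(Phi p has_real_derivative p * \<bar>z\<bar> powr (p - 1)) (at z within {-M..M})" for z
      by (rule has_field_derivative_at_within[OF has_real_derivative_Phi[OF p]])
    show "norm (p * \<bar>z\<bar> powr (p - 1)) \<le> p * M powr (p - 1)" if "z \<in> {-M..M}" for z
      using p that by (auto simp: abs_mult intro!: powr_mono2)
  qed (use x y in auto)
  then show ?thesis by simp
qed

text \<open>Boundedness and Lipschitz continuity on a square with one common constant. In this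
  combination the class is closed under products, so the mobilities are covered by following their
  structure.\<close>

definition lip2 :: "real \<Rightarrow> real \<Rightarrow> (real \<Rightarrow> real \<Rightarrow> real) \<Rightarrow> bool" where
  "lip2 \<delta> M h \<longleftrightarrow> (\<exists>L\<ge>0. \<forall>x\<in>{\<delta>..M}. \<forall>y\<in>{\<delta>..M}. \<bar>h x y\<bar> \<le> L \<and>
     (\<forall>x'\<in>{\<delta>..M}. \<forall>y'\<in>{\<delta>..M}. \<bar>h x y - h x' y'\<bar> \<le> L * (\<bar>x - x'\<bar> + \<bar>y - y'\<bar>)))"

lemma lip2I:
  assumes "L \<ge> 0" "L' \<ge> 0"
    and "\<And>x y. x \<in> {\<delta>..M} \<Longrightarrow> y \<in> {\<delta>..M} \<Longrightarrow> \<bar>h x y\<bar> \<le> L"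
    and "\<And>x y x' y'. x \<in> {\<delta>..M} \<Longrightarrow> y \<in> {\<delta>..M} \<Longrightarrow> x' \<in> {\<delta>..M} \<Longrightarrow> y' \<in> {\<delta>..M} \<Longrightarrow>
      \<bar>h x y - h x' y'\<bar> \<le> L' * (\<bar>x - x'\<bar> + \<bar>y - y'\<bar>)"
  shows "lip2 \<delta> M h"
  unfolding lip2_def
proof (intro exI[of _ "L + L'"] conjI ballI)
  fix x y x' y'
  assume *: "x \<in> {\<delta>..M}" "y \<in> {\<delta>..M}"
  show "\<bar>h x y\<bar> \<le> L + L'" using assms(3)[OF *] assms(2) by linarith
  assume **: "x' \<in> {\<delta>..M}" "y' \<in> {\<delta>..M}"
  have "L' * (\<bar>x - x'\<bar> + \<bar>y - y'\<bar>) \<le> (L + L') * (\<bar>x - x'\<bar> + \<bar>y - y'\<bar>)"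
    using assms(1) by (intro mult_right_mono) auto
  then show "\<bar>h x y - h x' y'\<bar> \<le> (L + L') * (\<bar>x - x'\<bar> + \<bar>y - y'\<bar>)"
    using assms(4)[OF * **] by linarith
qed (use assms in auto)

lemma lip2_const: "lip2 \<delta> M (\<lambda>_ _. c)"
  by (rule lip2I[of "\<bar>c\<bar>" 0]) auto

lemma lip2_fst: "lip2 \<delta> M (\<lambda>x _. x)"
  by (rule lip2I[of "\<bar>\<delta>\<bar> + \<bar>M\<bar>" 1]) auto

lemma lip2_snd: "lip2 \<delta> M (\<lambda>_ y. y)"
  by (rule lip2I[of "\<bar>\<delta>\<bar> + \<bar>M\<bar>" 1]) auto

lemma lip2_add:
  assumes "lip2 \<delta> M h" "lip2 \<delta> M k"
  shows "lip2 \<delta> M (\<lambda>x y. h x y + k x y)"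
proof -
  obtain L where L: "L \<ge> 0" "\<And>x y. x \<in> {\<delta>..M} \<Longrightarrow> y \<in> {\<delta>..M} \<Longrightarrow> \<bar>h x y\<bar> \<le> L"
    "\<And>x y x' y'. x \<in> {\<delta>..M} \<Longrightarrow> y \<in> {\<delta>..M} \<Longrightarrow> x' \<in> {\<delta>..M} \<Longrightarrow> y' \<in> {\<delta>..M} \<Longrightarrow>
      \<bar>h x y - h x' y'\<bar> \<le> L * (\<bar>x - x'\<bar> + \<bar>y - y'\<bar>)"
    using assms(1) unfolding lip2_def by blast
  obtain K where K: "K \<ge> 0" "\<And>x y. x \<in> {\<delta>..M} \<Longrightarrow> y \<in> {\<delta>..M} \<Longrightarrow> \<bar>k x y\<bar> \<le> K"
    "\<And>x y x' y'. x \<in> {\<delta>..M} \<Longrightarrow> y \<in> {\<delta>..M} \<Longrightarrow> x' \<in> {\<delta>..M} \<Longrightarrow> y' \<in> {\<delta>..M} \<Longrightarrow>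
      \<bar>k x y - k x' y'\<bar> \<le> K * (\<bar>x - x'\<bar> + \<bar>y - y'\<bar>)"
    using assms(2) unfolding lip2_def by blast
  show ?thesis
  proof (rule lip2I[of "L + K" "L + K"])
    fix x y x' y'
    assume *: "x \<in> {\<delta>..M}" "y \<in> {\<delta>..M}"
    show "\<bar>h x y + k x y\<bar> \<le> L + K" using L(2)[OF *] K(2)[OF *] by linarith
    assume **: "x' \<in> {\<delta>..M}" "y' \<in> {\<delta>..M}"
    show "\<bar>h x y + k x y - (h x' y' + k x' y')\<bar> \<le> (L + K) * (\<bar>x - x'\<bar> + \<bar>y - y'\<bar>)"
      unfolding distrib_right[of L K] using L(3)[OF * **] K(3)[OF * **] by linarith
  qed (use L K in auto)
qed

lemma lip2_mult:
  assumes "lip2 \<delta> M h" "lip2 \<delta> M k"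
  shows "lip2 \<delta> M (\<lambda>x y. h x y * k x y)"
proof -
  obtain L where L: "L \<ge> 0" "\<And>x y. x \<in> {\<delta>..M} \<Longrightarrow> y \<in> {\<delta>..M} \<Longrightarrow> \<bar>h x y\<bar> \<le> L"
    "\<And>x y x' y'. x \<in> {\<delta>..M} \<Longrightarrow> y \<in> {\<delta>..M} \<Longrightarrow> x' \<in> {\<delta>..M} \<Longrightarrow> y' \<in> {\<delta>..M} \<Longrightarrow>
      \<bar>h x y - h x' y'\<bar> \<le> L * (\<bar>x - x'\<bar> + \<bar>y - y'\<bar>)"
    using assms(1) unfolding lip2_def by blast
  obtain K where K: "K \<ge> 0" "\<And>x y. x \<in> {\<delta>..M} \<Longrightarrow> y \<in> {\<delta>..M} \<Longrightarrow> \<bar>k x y\<bar> \<le> K"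
    "\<And>x y x' y'. x \<in> {\<delta>..M} \<Longrightarrow> y \<in> {\<delta>..M} \<Longrightarrow> x' \<in> {\<delta>..M} \<Longrightarrow> y' \<in> {\<delta>..M} \<Longrightarrow>
      \<bar>k x y - k x' y'\<bar> \<le> K * (\<bar>x - x'\<bar> + \<bar>y - y'\<bar>)"
    using assms(2) unfolding lip2_def by blast
  show ?thesis
  proof (rule lip2I[of "L * K" "2 * L * K"])
    fix x y x' y'
    assume *: "x \<in> {\<delta>..M}" "y \<in> {\<delta>..M}"
    show "\<bar>h x y * k x y\<bar> \<le> L * K"
      unfolding abs_mult by (intro mult_mono L K *) auto
    assume **: "x' \<in> {\<delta>..M}" "y' \<in> {\<delta>..M}"
    let ?d = "\<bar>x - x'\<bar> + \<bar>y - y'\<bar>"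
    have "\<bar>h x y * k x y - h x' y' * k x' y'\<bar> = \<bar>h x y * (k x y - k x' y') + (h x y - h x' y') * k x' y'\<bar>"
      by (simp add: algebra_simps)
    also have "\<dots> \<le> \<bar>h x y\<bar> * \<bar>k x y - k x' y'\<bar> + \<bar>h x y - h x' y'\<bar> * \<bar>k x' y'\<bar>"
      unfolding abs_mult[symmetric] by (rule abs_triangle_ineq)
    also have "\<dots> \<le> L * (K * ?d) + (L * ?d) * K"
      using L(1) K(1) by (intro add_mono mult_mono L(2,3) K(2,3) * **) auto
    finally show "\<bar>h x y * k x y - h x' y' * k x' y'\<bar> \<le> 2 * L * K * ?d"
      by (simp add: algebra_simps)
  qed (use L K in auto)
qed

text \<open>The lower bound \<delta> keeps the base positive, where \<open>powr\<close> is
  differentiable; for \<open>r \<ge> 1\<close> the derivative is largest at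
  \<open>M\<close>.\<close>

lemma lip2_powr:
  assumes "\<delta> > 0" "r \<ge> 1"
  shows "lip2 \<delta> M (\<lambda>_ y. \<bar>y\<bar> powr r)"
proof (rule lip2I[of "M powr r" "r * M powr (r - 1)"])
  fix x y x' y' :: real
  assume y: "y \<in> {\<delta>..M}"
  show "\<bar>\<bar>y\<bar> powr r\<bar> \<le> M powr r"
    using y assms by (auto intro!: powr_mono2)
  assume y': "y' \<in> {\<delta>..M}"
  have "norm (y powr r - y' powr r) \<le> r * M powr (r - 1) * norm (y - y')"
  proof (rule field_differentiable_bound[of "{\<delta>..M}" "\<lambda>y. y powr r" "\<lambda>z. r * z powr (r - 1)"])
    show "((\<lambda>y. y powr r) has_real_derivative r * z powr (r - 1)) (at z within {\<delta>..M})" if "z \<in> {\<delta>..M}" for z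
      using that assms by (intro has_field_derivative_at_within[OF has_real_derivative_powr]) auto
    show "norm (r * z powr (r - 1)) \<le> r * M powr (r - 1)" if "z \<in> {\<delta>..M}" for z
      using assms that by (auto simp: abs_mult intro!: powr_mono2)
  qed (use y y' in auto)
  also have "\<dots> \<le> r * M powr (r - 1) * (\<bar>x - x'\<bar> + \<bar>y - y'\<bar>)"
    using assms by (intro mult_left_mono) auto
  finally show "\<bar>\<bar>y\<bar> powr r - \<bar>y'\<bar> powr r\<bar> \<le> r * M powr (r - 1) * (\<bar>x - x'\<bar> + \<bar>y - y'\<bar>)"
    using y y' assms by simp
qed (use assms in auto)

lemma lip2_mobilities:
  "lip2 \<delta> M (p11 sm)" "lip2 \<delta> M (p12 m sp)" "lip2 \<delta> M (p21 sm)" "lip2 \<delta> M (p22 m sp \<mu>0)"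
proof -
  show p11: "lip2 \<delta> M (p11 sm)"
    unfolding p11_def[abs_def] power3_eq_cube by (intro lip2_mult lip2_const lip2_fst)
  show p12: "lip2 \<delta> M (p12 m sp)"
    unfolding p12_def[abs_def] power3_eq_cube power2_eq_square
    by (intro lip2_add lip2_mult lip2_const lip2_fst lip2_snd)
  show "lip2 \<delta> M (p21 sm)"
    unfolding p21_def[abs_def] power2_eq_square
    by (intro lip2_add lip2_mult lip2_const lip2_fst lip2_snd p11)
  show "lip2 \<delta> M (p22 m sp \<mu>0)"
    unfolding p22_def[abs_def] power3_eq_cube power2_eq_square
    by (intro lip2_add lip2_mult lip2_const lip2_fst lip2_snd p12)
qed

text \<open>
  After the rescaling \<open>X = s\<^sup>- w\<close>, \<open>Y = m s\<^sup>+ v\<close> the mobility matrix becomes symmetric; dropping the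
  \<open>g\<^sup>3\<close> term, its quadratic form equals \<open>f ((fZ)\<^sup>2 / 3 + (fZ) (gY) + (gY)\<^sup>2)\<close> with \<open>Z = X + Y\<close>.
\<close>

lemma mobility_coercive:
  assumes "m > 0" "sp > 0" "sm > 0" "\<mu>0 > 0" "\<delta> > 0" and f: "f \<ge> \<delta>" and g: "g \<ge> \<delta>"
  shows "\<delta> ^ 3 / 80 * (min sm (m * sp))\<^sup>2 * (w\<^sup>2 + v\<^sup>2) \<le>
    sm * w * (p11 sm f g * w + p12 m sp f g * v) + m * sp * v * (p21 sm f g * w + p22 m sp \<mu>0 f g * v)"
proof -
  define X where "X = sm * w"
  define Y where "Y = m * sp * v"
  define Z where "Z = X + Y"
  have pos: "f > 0" "g > 0" using assms by auto
  \<comment> \<open>The smallest eigenvalue of this form is about 0.066 (trace 4/3, determinant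
    1/12); 1/20 lies below it and leaves an explicit sum of squares.\<close>
  have quad: "1 / 20 * (A\<^sup>2 + B\<^sup>2) \<le> A\<^sup>2 / 3 + A * B + B\<^sup>2" for A B :: real
  proof -
    have "A\<^sup>2 / 3 + A * B + B\<^sup>2 - 1 / 20 * (A\<^sup>2 + B\<^sup>2) = 17 / 60 * (A + 30 / 17 * B)\<^sup>2 + 23 / 340 * B\<^sup>2"
      by (simp add: power2_eq_square field_simps)
    also have "\<dots> \<ge> 0" by (intro add_nonneg_nonneg mult_nonneg_nonneg) auto
    finally show ?thesis by linarith
  qed
  \<comment> \<open>Undoes the substitution \<open>Z = X + Y\<close>. The form on the right has
    smallest eigenvalue \<open>(3 - sqrt 5) / 2\<close>, which exceeds 1/4.\<close>
  have XY: "1 / 4 * (X\<^sup>2 + Y\<^sup>2) \<le> Z\<^sup>2 + Y\<^sup>2"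
  proof -
    have "Z\<^sup>2 + Y\<^sup>2 - 1 / 4 * (X\<^sup>2 + Y\<^sup>2) = 3 / 4 * (X + 4 / 3 * Y)\<^sup>2 + 5 / 12 * Y\<^sup>2"
      by (simp add: Z_def power2_eq_square field_simps)
    also have "\<dots> \<ge> 0" by (intro add_nonneg_nonneg mult_nonneg_nonneg) auto
    finally show ?thesis by linarith
  qed
  have min: "(min sm (m * sp))\<^sup>2 * (w\<^sup>2 + v\<^sup>2) \<le> X\<^sup>2 + Y\<^sup>2"
  proof -
    have "(min sm (m * sp))\<^sup>2 * w\<^sup>2 \<le> sm\<^sup>2 * w\<^sup>2" "(min sm (m * sp))\<^sup>2 * v\<^sup>2 \<le> (m * sp)\<^sup>2 * v\<^sup>2"
      using assms by (intro mult_right_mono power_mono; simp)+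
    then show ?thesis by (simp add: X_def Y_def power_mult_distrib distrib_left)
  qed
  \<comment> \<open>The 80 is 20 times 4 from the two quadratic forms; one factor \<delta> comes
    from the outer \<open>f\<close>, two more from the squares of \<open>f\<close> and
    \<open>g\<close>.\<close>
  have "\<delta> ^ 3 / 80 * (min sm (m * sp))\<^sup>2 * (w\<^sup>2 + v\<^sup>2) \<le> \<delta> ^ 3 / 80 * (X\<^sup>2 + Y\<^sup>2)"
    using mult_left_mono[OF min, of "\<delta> ^ 3 / 80"] assms by (simp add: mult.assoc)
  also have "\<dots> \<le> \<delta> ^ 3 / 20 * (Z\<^sup>2 + Y\<^sup>2)"
    using mult_left_mono[OF XY, of "\<delta> ^ 3 / 20"] assms by simp
  also have "\<dots> = \<delta> * (1 / 20 * (\<delta>\<^sup>2 * Z\<^sup>2 + \<delta>\<^sup>2 * Y\<^sup>2))"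
    by (simp add: power2_eq_square power3_eq_cube algebra_simps)
  also have "\<dots> \<le> f * (1 / 20 * (f\<^sup>2 * Z\<^sup>2 + g\<^sup>2 * Y\<^sup>2))"
  proof -
    have "\<delta>\<^sup>2 * Z\<^sup>2 \<le> f\<^sup>2 * Z\<^sup>2" "\<delta>\<^sup>2 * Y\<^sup>2 \<le> g\<^sup>2 * Y\<^sup>2"
      using assms by (intro mult_right_mono power_mono; simp)+
    then show ?thesis using assms pos by (intro mult_mono) auto
  qed
  also have "\<dots> \<le> f * ((f * Z)\<^sup>2 / 3 + (f * Z) * (g * Y) + (g * Y)\<^sup>2)"
    using quad[of "f * Z" "g * Y"] pos by (intro mult_left_mono) (auto simp: power_mult_distrib)
  also have "\<dots> \<le> f * ((f * Z)\<^sup>2 / 3 + (f * Z) * (g * Y) + (g * Y)\<^sup>2) + m * sp * sp / (3 * \<mu>0) * g ^ 3 * v\<^sup>2"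
    using assms pos by simp
  also have "\<dots> = sm * w * (p11 sm f g * w + p12 m sp f g * v) + m * sp * v * (p21 sm f g * w + p22 m sp \<mu>0 f g * v)"
    unfolding p11_def p12_def p21_def p22_def Z_def X_def Y_def
    using assms by (simp add: power2_eq_square power3_eq_cube field_simps)
  finally show ?thesis .
qed

text \<open>Young's inequality: \<open>A\<close> stands for the third derivatives and
  \<open>E\<close> for the lower order differences. The square is completed at
  \<open>A = K / (2 * c) * E\<close>.\<close>

lemma absorb_by_coercivity:
  fixes A E c K :: real
  assumes "c > 0" "K \<ge> 0"
  shows "- ((K\<^sup>2 / (4 * c) + K) * E\<^sup>2) \<le> c * A\<^sup>2 - K * A * E - K * E\<^sup>2"
proof -
  have "0 \<le> c * (A - K / (2 * c) * E)\<^sup>2" using assms by simp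
  also have "\<dots> = c * A\<^sup>2 - K * A * E + K\<^sup>2 / (4 * c) * E\<^sup>2"
    using assms by (simp add: power2_eq_square field_simps)
  finally show ?thesis by (simp add: algebra_simps)
qed

text \<open>The fluxes as functions of real numbers, with \<open>f3\<close> in place of the third
  derivative of \<open>f\<close> and \<open>d3\<close> in place of that of \<open>f + g\<close>. The
  dissipation estimate thereby becomes an inequality between numbers.\<close>

definition j1 where
  "j1 m sp sm f g f3 d3 = p11 sm f g * f3 + p12 m sp f g * d3"

definition j2 where
  "j2 m sp sm \<mu>0 \<tau>h p f g f3 d3 = p21 sm f g * f3 + p22 m sp \<mu>0 f g * d3
    + C_const sp \<mu>0 \<tau>h p * \<bar>g\<bar> powr (p + 2) * Phi p d3"

text \<open>The integrand of the energy estimate at a single point: \<open>w1\<close> and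
  \<open>v1\<close> are placeholders for the first derivatives of the differences. \<open>C\<close>
  depends only on the parameters and on the bounds \<delta> and \<open>M\<close>, so the inequality
  can be integrated and used at every time.\<close>

lemma flux_dissipation:
  assumes pos: "m > 0" "sp > 0" "sm > 0" "\<mu>0 > 0" "\<tau>h > 0" "p > 1" "\<delta> > 0" "M \<ge> 0"
  obtains C where "C \<ge> 0"
    "\<And>f g F G f3 d3 F3 D3 w1 v1. f \<in> {\<delta>..M} \<Longrightarrow> g \<in> {\<delta>..M} \<Longrightarrow> F \<in> {\<delta>..M} \<Longrightarrow> G \<in> {\<delta>..M} \<Longrightarrow>
      f3 \<in> {-M..M} \<Longrightarrow> d3 \<in> {-M..M} \<Longrightarrow> F3 \<in> {-M..M} \<Longrightarrow> D3 \<in> {-M..M} \<Longrightarrow>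
      - (C * ((f - F)\<^sup>2 + (f + g - (F + G))\<^sup>2 + w1\<^sup>2 + v1\<^sup>2)) \<le>
      (sm * (f3 - F3) - w1) * (j1 m sp sm f g f3 d3 - j1 m sp sm F G F3 D3)
      + (m * sp * (d3 - D3) - v1) * (j2 m sp sm \<mu>0 \<tau>h p f g f3 d3 - j2 m sp sm \<mu>0 \<tau>h p F G F3 D3)"
proof -
  define Cp where "Cp = C_const sp \<mu>0 \<tau>h p"
  have Cp: "Cp \<ge> 0" using pos by (simp add: Cp_def C_const_def)
  \<comment> \<open>Passes from \<open>g\<close> to the unknown \<open>f + g\<close> of the second
    equation, since \<open>\<bar>g - G\<bar>\<close> is at most the sum of the differences in
    \<open>f\<close> and in \<open>f + g\<close>; this costs the factor 2.\<close>
  have ex: "\<exists>L\<ge>0. \<forall>f g F G. f \<in> {\<delta>..M} \<longrightarrow> g \<in> {\<delta>..M} \<longrightarrow> F \<in> {\<delta>..M} \<longrightarrow> G \<in> {\<delta>..M} \<longrightarrow>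
      \<bar>h f g\<bar> \<le> L \<and> \<bar>h f g - h F G\<bar> \<le> L * (\<bar>f - F\<bar> + \<bar>f + g - (F + G)\<bar>)" if lip: "lip2 \<delta> M h" for h
  proof -
    from lip obtain L where L: "L \<ge> 0" "\<And>x y. x \<in> {\<delta>..M} \<Longrightarrow> y \<in> {\<delta>..M} \<Longrightarrow> \<bar>h x y\<bar> \<le> L"
      "\<And>x y x' y'. x \<in> {\<delta>..M} \<Longrightarrow> y \<in> {\<delta>..M} \<Longrightarrow> x' \<in> {\<delta>..M} \<Longrightarrow> y' \<in> {\<delta>..M} \<Longrightarrow>
        \<bar>h x y - h x' y'\<bar> \<le> L * (\<bar>x - x'\<bar> + \<bar>y - y'\<bar>)"
      unfolding lip2_def by blast
    show ?thesis
    proof (intro exI[of _ "2 * L"] conjI allI impI)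
      fix f g F G
      assume *: "f \<in> {\<delta>..M}" "g \<in> {\<delta>..M}" "F \<in> {\<delta>..M}" "G \<in> {\<delta>..M}"
      show "\<bar>h f g\<bar> \<le> 2 * L" using L(1) L(2)[OF *(1,2)] by linarith
      have "L * (\<bar>f - F\<bar> + \<bar>g - G\<bar>) \<le> L * (2 * (\<bar>f - F\<bar> + \<bar>f + g - (F + G)\<bar>))"
      proof (intro mult_left_mono L)
        have arith: "c + a \<le> 2 * (c + b)" if "a \<le> b + c" "0 \<le> b" for a b c :: real
          unfolding distrib_left using that by simp
        have "\<bar>g - G\<bar> = \<bar>(f + g - (F + G)) - (f - F)\<bar>" by simp
        also have "\<dots> \<le> \<bar>f + g - (F + G)\<bar> + \<bar>f - F\<bar>" by (rule abs_triangle_ineq4)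
        finally show "\<bar>f - F\<bar> + \<bar>g - G\<bar> \<le> 2 * (\<bar>f - F\<bar> + \<bar>f + g - (F + G)\<bar>)"
          by (rule arith) simp
      qed
      then show "\<bar>h f g - h F G\<bar> \<le> 2 * L * (\<bar>f - F\<bar> + \<bar>f + g - (F + G)\<bar>)"
        using L(3)[OF *] by linarith
    qed (use L in auto)
  qed
  obtain L1 where L1: "L1 \<ge> 0" "\<And>f g F G. f \<in> {\<delta>..M} \<Longrightarrow> g \<in> {\<delta>..M} \<Longrightarrow> F \<in> {\<delta>..M} \<Longrightarrow> G \<in> {\<delta>..M} \<Longrightarrow>
      \<bar>p11 sm f g\<bar> \<le> L1 \<and> \<bar>p11 sm f g - p11 sm F G\<bar> \<le> L1 * (\<bar>f - F\<bar> + \<bar>f + g - (F + G)\<bar>)"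
    using ex[OF lip2_mobilities(1)[of \<delta> M sm]] by blast
  obtain L2 where L2: "L2 \<ge> 0" "\<And>f g F G. f \<in> {\<delta>..M} \<Longrightarrow> g \<in> {\<delta>..M} \<Longrightarrow> F \<in> {\<delta>..M} \<Longrightarrow> G \<in> {\<delta>..M} \<Longrightarrow>
      \<bar>p12 m sp f g\<bar> \<le> L2 \<and> \<bar>p12 m sp f g - p12 m sp F G\<bar> \<le> L2 * (\<bar>f - F\<bar> + \<bar>f + g - (F + G)\<bar>)"
    using ex[OF lip2_mobilities(2)[of \<delta> M m sp]] by blast
  obtain L3 where L3: "L3 \<ge> 0" "\<And>f g F G. f \<in> {\<delta>..M} \<Longrightarrow> g \<in> {\<delta>..M} \<Longrightarrow> F \<in> {\<delta>..M} \<Longrightarrow> G \<in> {\<delta>..M} \<Longrightarrow>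
      \<bar>p21 sm f g\<bar> \<le> L3 \<and> \<bar>p21 sm f g - p21 sm F G\<bar> \<le> L3 * (\<bar>f - F\<bar> + \<bar>f + g - (F + G)\<bar>)"
    using ex[OF lip2_mobilities(3)[of \<delta> M sm]] by blast
  obtain L4 where L4: "L4 \<ge> 0" "\<And>f g F G. f \<in> {\<delta>..M} \<Longrightarrow> g \<in> {\<delta>..M} \<Longrightarrow> F \<in> {\<delta>..M} \<Longrightarrow> G \<in> {\<delta>..M} \<Longrightarrow>
      \<bar>p22 m sp \<mu>0 f g\<bar> \<le> L4 \<and> \<bar>p22 m sp \<mu>0 f g - p22 m sp \<mu>0 F G\<bar> \<le> L4 * (\<bar>f - F\<bar> + \<bar>f + g - (F + G)\<bar>)"
    using ex[OF lip2_mobilities(4)[of \<delta> M m sp \<mu>0]] by blast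
  have "lip2 \<delta> M (\<lambda>_ y. Cp * \<bar>y\<bar> powr (p + 2))"
    using pos by (intro lip2_mult lip2_const lip2_powr) auto
  from ex[OF this] obtain L5 where L5: "L5 \<ge> 0" "\<And>f g F G. f \<in> {\<delta>..M} \<Longrightarrow> g \<in> {\<delta>..M} \<Longrightarrow> F \<in> {\<delta>..M} \<Longrightarrow> G \<in> {\<delta>..M} \<Longrightarrow>
      \<bar>Cp * \<bar>g\<bar> powr (p + 2)\<bar> \<le> L5 \<and>
      \<bar>Cp * \<bar>g\<bar> powr (p + 2) - Cp * \<bar>G\<bar> powr (p + 2)\<bar> \<le> L5 * (\<bar>f - F\<bar> + \<bar>f + g - (F + G)\<bar>)"
    by blast
  define \<Lambda> where "\<Lambda> = p * M powr (p - 1)"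
  have \<Lambda>: "\<Lambda> \<ge> 0" "\<And>x y. x \<in> {-M..M} \<Longrightarrow> y \<in> {-M..M} \<Longrightarrow> \<bar>Phi p x - Phi p y\<bar> \<le> \<Lambda> * \<bar>x - y\<bar>"
    using pos Phi_Lipschitz[OF pos(6), of _ M] by (auto simp: \<Lambda>_def)
  have \<Lambda>0: "\<bar>Phi p x\<bar> \<le> \<Lambda> * M" if "x \<in> {-M..M}" for x
  proof -
    have "\<bar>Phi p x - Phi p 0\<bar> \<le> \<Lambda> * \<bar>x - 0\<bar>" using that pos by (intro \<Lambda>(2)) auto
    also have "\<dots> \<le> \<Lambda> * M" using that \<Lambda>(1) by (intro mult_left_mono) auto
    finally show ?thesis by (simp add: Phi_def)
  qed
  define K1 where "K1 = L1 * M + L2 * M"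
  define K2 where "K2 = L3 * M + L4 * M + L5 * (\<Lambda> * M)"
  define B where "B = L1 + L2 + L3 + L4 + L5 * \<Lambda> + K1 + K2"
  define c where "c = \<delta> ^ 3 / 80 * (min sm (m * sp))\<^sup>2"
  define K where "K = sm * B + m * sp * B + B"
  have K12: "K1 \<ge> 0" "K2 \<ge> 0" using L1 L2 L3 L4 L5 \<Lambda>(1) pos by (simp_all add: K1_def K2_def)
  have L5\<Lambda>: "0 \<le> L5 * \<Lambda>" using L5 \<Lambda> by simp
  have B: "B \<ge> 0" "L1 \<le> B" "L2 \<le> B" "L3 \<le> B" "K1 \<le> B" "K2 \<le> B" "L4 + L5 * \<Lambda> \<le> B"
    using L1(1) L2(1) L3(1) L4(1) K12 L5\<Lambda> by (auto simp: B_def)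
  have "min sm (m * sp) > 0" using pos by simp
  then have c: "c > 0" using pos unfolding c_def by (intro mult_pos_pos zero_less_power) auto
  have K: "K \<ge> 0" "sm * B \<le> K" "m * sp * B \<le> K" "B \<le> K" using pos B(1) by (auto simp: K_def)
  show ?thesis
  \<comment> \<open>The bracket is the constant of \<open>absorb_by_coercivity\<close> for
    coercivity \<open>c / 2\<close> and perturbation \<open>2 * K\<close>; the outer 4 bounds the
    square of a sum of four absolute values.\<close>
  proof (rule that[of "4 * ((2 * K)\<^sup>2 / (4 * (c / 2)) + 2 * K)"])
    fix f g F G f3 d3 F3 D3 w1 v1 :: real
    assume r: "f \<in> {\<delta>..M}" "g \<in> {\<delta>..M}" "F \<in> {\<delta>..M}" "G \<in> {\<delta>..M}"
      and r3: "f3 \<in> {-M..M}" "d3 \<in> {-M..M}" "F3 \<in> {-M..M}" "D3 \<in> {-M..M}"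
    define w where "w = f3 - F3"
    define v where "v = d3 - D3"
    define s where "s = \<bar>f - F\<bar> + \<bar>f + g - (F + G)\<bar>"
    define e where "e = \<bar>w1\<bar> + \<bar>v1\<bar>"
    define A where "A = \<bar>w\<bar> + \<bar>v\<bar>"
    have nn: "s \<ge> 0" "e \<ge> 0" "A \<ge> 0" by (auto simp: s_def e_def A_def)
    note l1 = L1(2)[OF r, folded s_def] and l2 = L2(2)[OF r, folded s_def] and l3 = L3(2)[OF r, folded s_def]
      and l4 = L4(2)[OF r, folded s_def] and l5 = L5(2)[OF r, folded s_def]
    \<comment> \<open>Freezing the coefficients at the first solution splits the flux differences:
      the mobility matrix acts on \<open>(w, v)\<close>, \<open>N\<close> is the nonlinear part, and
      \<open>R1\<close>, \<open>R2\<close> collect differences of coefficients times third order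
      quantities of the second solution, which are bounded.\<close>
    define R1 where "R1 = (p11 sm f g - p11 sm F G) * F3 + (p12 m sp f g - p12 m sp F G) * D3"
    define R2 where "R2 = (p21 sm f g - p21 sm F G) * F3 + (p22 m sp \<mu>0 f g - p22 m sp \<mu>0 F G) * D3
      + (Cp * \<bar>g\<bar> powr (p + 2) - Cp * \<bar>G\<bar> powr (p + 2)) * Phi p D3"
    define N where "N = Cp * \<bar>g\<bar> powr (p + 2) * (Phi p d3 - Phi p D3)"
    let ?J1 = "j1 m sp sm f g f3 d3 - j1 m sp sm F G F3 D3"
    let ?J2 = "j2 m sp sm \<mu>0 \<tau>h p f g f3 d3 - j2 m sp sm \<mu>0 \<tau>h p F G F3 D3"
    have J1: "?J1 = (p11 sm f g * w + p12 m sp f g * v) + R1"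
      unfolding j1_def R1_def w_def v_def by (simp add: algebra_simps)
    have J2: "?J2 = (p21 sm f g * w + p22 m sp \<mu>0 f g * v) + N + R2"
      unfolding j2_def R2_def N_def w_def v_def Cp_def by (simp add: algebra_simps)
    have abs3: "\<bar>F3\<bar> \<le> M" "\<bar>D3\<bar> \<le> M" using r3 by auto
    have R1: "\<bar>R1\<bar> \<le> K1 * s"
    proof -
      have "\<bar>R1\<bar> \<le> \<bar>p11 sm f g - p11 sm F G\<bar> * \<bar>F3\<bar> + \<bar>p12 m sp f g - p12 m sp F G\<bar> * \<bar>D3\<bar>"
        unfolding R1_def abs_mult[symmetric] by (rule abs_triangle_ineq)
      also have "\<dots> \<le> (L1 * s) * M + (L2 * s) * M"
        using l1 l2 abs3 nn(1) L1(1) L2(1) by (intro add_mono mult_mono) auto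
      finally show ?thesis by (simp add: K1_def algebra_simps)
    qed
    have R2: "\<bar>R2\<bar> \<le> K2 * s"
    proof -
      have "\<bar>R2\<bar> \<le> \<bar>p21 sm f g - p21 sm F G\<bar> * \<bar>F3\<bar> + \<bar>p22 m sp \<mu>0 f g - p22 m sp \<mu>0 F G\<bar> * \<bar>D3\<bar>
          + \<bar>Cp * \<bar>g\<bar> powr (p + 2) - Cp * \<bar>G\<bar> powr (p + 2)\<bar> * \<bar>Phi p D3\<bar>"
        unfolding R2_def abs_mult[symmetric] by (intro order_trans[OF abs_triangle_ineq] add_mono order_refl)
      also have "\<dots> \<le> (L3 * s) * M + (L4 * s) * M + (L5 * s) * (\<Lambda> * M)"
        using l3 l4 l5 abs3 nn(1) L3(1) L4(1) L5(1) \<Lambda>0[OF r3(4)] by (intro add_mono mult_mono) auto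
      finally show ?thesis by (simp add: K2_def algebra_simps)
    qed
    have N: "\<bar>N\<bar> \<le> L5 * \<Lambda> * \<bar>v\<bar>"
    proof -
      have "\<bar>N\<bar> = \<bar>Cp * \<bar>g\<bar> powr (p + 2)\<bar> * \<bar>Phi p d3 - Phi p D3\<bar>"
        unfolding N_def abs_mult[symmetric] ..
      also have "\<dots> \<le> L5 * (\<Lambda> * \<bar>v\<bar>)"
        unfolding v_def using l5 L5(1) by (intro mult_mono \<Lambda>(2) r3) auto
      finally show ?thesis by simp
    qed
    \<comment> \<open>The nonlinear part cooperates when paired with \<open>v\<close>, so this term
      needs no absorption.\<close>
    have Nv: "0 \<le> N * v"
    proof -
      have "N * v = Cp * \<bar>g\<bar> powr (p + 2) * ((Phi p d3 - Phi p D3) * (d3 - D3))"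
        unfolding N_def v_def by simp
      also have "\<dots> \<ge> 0" using Cp Phi_monotone_product[OF pos(6)] by simp
      finally show ?thesis .
    qed
    have R1B: "\<bar>R1\<bar> \<le> B * s" and R2B: "\<bar>R2\<bar> \<le> B * s"
      using R1 R2 mult_right_mono[OF B(5) nn(1)] mult_right_mono[OF B(6) nn(1)] by linarith+
    have J1B: "\<bar>?J1\<bar> \<le> B * (A + s)"
    proof -
      have "\<bar>?J1\<bar> \<le> \<bar>p11 sm f g\<bar> * \<bar>w\<bar> + \<bar>p12 m sp f g\<bar> * \<bar>v\<bar> + \<bar>R1\<bar>"
        unfolding J1 abs_mult[symmetric] by linarith
      also have "\<dots> \<le> B * \<bar>w\<bar> + B * \<bar>v\<bar> + B * s"
        using l1 l2 B R1B by (intro add_mono mult_right_mono) auto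
      finally show ?thesis by (simp add: A_def algebra_simps)
    qed
    have J2B: "\<bar>?J2\<bar> \<le> B * (A + s)"
    proof -
      have "\<bar>?J2\<bar> \<le> \<bar>p21 sm f g\<bar> * \<bar>w\<bar> + \<bar>p22 m sp \<mu>0 f g\<bar> * \<bar>v\<bar> + \<bar>N\<bar> + \<bar>R2\<bar>"
        unfolding J2 abs_mult[symmetric] by linarith
      also have "\<dots> \<le> B * \<bar>w\<bar> + L4 * \<bar>v\<bar> + L5 * \<Lambda> * \<bar>v\<bar> + B * s"
        using l3 l4 B R2B N by (intro add_mono mult_right_mono) auto
      also have "\<dots> \<le> B * \<bar>w\<bar> + B * \<bar>v\<bar> + B * s"
        using mult_right_mono[OF B(7) abs_ge_zero[of v]] by (simp add: distrib_right)
      finally show ?thesis by (simp add: A_def algebra_simps)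
    qed
    have coer: "c * (w\<^sup>2 + v\<^sup>2) \<le> sm * w * (p11 sm f g * w + p12 m sp f g * v)
        + m * sp * v * (p21 sm f g * w + p22 m sp \<mu>0 f g * v)"
      unfolding c_def using pos r by (intro mobility_coercive) auto
    have A2: "A\<^sup>2 \<le> 2 * (w\<^sup>2 + v\<^sup>2)"
      using sum_squares_bound[of "\<bar>w\<bar>" "\<bar>v\<bar>"] by (simp add: A_def power2_sum)
    have main: "(sm * w - w1) * ?J1 + (m * sp * v - v1) * ?J2
      = sm * w * (p11 sm f g * w + p12 m sp f g * v) + m * sp * v * (p21 sm f g * w + p22 m sp \<mu>0 f g * v)
        + m * sp * (N * v) + (sm * w * R1 + m * sp * v * R2 - w1 * ?J1 - v1 * ?J2)"
    proof -
      have "(sm * w - w1) * ?J1 + (m * sp * v - v1) * ?J2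
        = sm * w * ?J1 + m * sp * v * ?J2 - w1 * ?J1 - v1 * ?J2"
        by (simp only: left_diff_distrib)
      then show ?thesis unfolding J1 J2 by (simp add: distrib_left mult_ac)
    qed
    have t1: "\<bar>sm * w * R1\<bar> \<le> K * \<bar>w\<bar> * s"
    proof -
      have "\<bar>sm * w * R1\<bar> = sm * \<bar>w\<bar> * \<bar>R1\<bar>" using pos by (simp add: abs_mult)
      also have "\<dots> \<le> sm * \<bar>w\<bar> * (B * s)" using R1B pos by (intro mult_left_mono) auto
      also have "\<dots> = (sm * B) * (\<bar>w\<bar> * s)" by simp
      also have "\<dots> \<le> K * (\<bar>w\<bar> * s)" using K nn by (intro mult_right_mono) auto
      finally show ?thesis by simp
    qed
    have t2: "\<bar>m * sp * v * R2\<bar> \<le> K * \<bar>v\<bar> * s"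
    proof -
      have "\<bar>m * sp * v * R2\<bar> = m * sp * \<bar>v\<bar> * \<bar>R2\<bar>" using pos by (simp add: abs_mult)
      also have "\<dots> \<le> m * sp * \<bar>v\<bar> * (B * s)" using R2B pos by (intro mult_left_mono) auto
      also have "\<dots> = (m * sp * B) * (\<bar>v\<bar> * s)" by simp
      also have "\<dots> \<le> K * (\<bar>v\<bar> * s)" using K nn by (intro mult_right_mono) auto
      finally show ?thesis by simp
    qed
    \<comment> \<open>The pairings with \<open>w1\<close> and \<open>v1\<close> have no sign. Here
      the nonlinear part counts through its Lipschitz bound, contained in
      \<open>J2B\<close>.\<close>
    have t34: "\<bar>y * J\<bar> \<le> K * \<bar>y\<bar> * (A + s)" if "\<bar>J\<bar> \<le> B * (A + s)" for y J
    proof -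
      have "\<bar>y * J\<bar> \<le> \<bar>y\<bar> * (B * (A + s))" unfolding abs_mult using that by (intro mult_left_mono) auto
      also have "\<dots> = B * (\<bar>y\<bar> * (A + s))" by simp
      also have "\<dots> \<le> K * (\<bar>y\<bar> * (A + s))" using K nn by (intro mult_right_mono) auto
      finally show ?thesis by simp
    qed
    have "- (K * A * s + K * e * (A + s)) \<le> sm * w * R1 + m * sp * v * R2 - w1 * ?J1 - v1 * ?J2"
    proof -
      have "K * A * s = K * \<bar>w\<bar> * s + K * \<bar>v\<bar> * s" "K * e * (A + s) = K * \<bar>w1\<bar> * (A + s) + K * \<bar>v1\<bar> * (A + s)"
        by (simp_all add: A_def e_def algebra_simps)
      then show ?thesis
        using t1 t2 t34[OF J1B, of w1] t34[OF J2B, of v1] by linarith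
    qed
    \<comment> \<open>Brings the error into the shape of \<open>absorb_by_coercivity\<close> with
      \<open>E = s + e\<close>; the product \<open>e * s\<close> disappears in the square.\<close>
    moreover have "K * A * s + K * e * (A + s) \<le> 2 * K * A * (s + e) + 2 * K * (s + e)\<^sup>2"
    proof -
      have "K * A * s + K * e * (A + s) = K * (A * (s + e) + e * s)" by (simp add: algebra_simps)
      also have "\<dots> \<le> K * (2 * (A * (s + e)) + 2 * (s + e)\<^sup>2)"
        using nn K by (intro mult_left_mono) (auto simp: power2_eq_square algebra_simps)
      finally show ?thesis by (simp add: algebra_simps)
    qed
    \<comment> \<open>Only half of \<open>c\<close> remains because \<open>A\<close> is a sum of
      absolute values and \<open>A2\<close> loses a factor 2.\<close>
    moreover have "c / 2 * A\<^sup>2 \<le> c * (w\<^sup>2 + v\<^sup>2)"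
      using mult_left_mono[OF A2, of "c / 2"] c by simp
    moreover have "0 \<le> m * sp * (N * v)" using pos Nv by simp
    ultimately have "c / 2 * A\<^sup>2 - 2 * K * A * (s + e) - 2 * K * (s + e)\<^sup>2
        \<le> (sm * w - w1) * ?J1 + (m * sp * v - v1) * ?J2"
      unfolding main using coer by linarith
    moreover have "- (((2 * K)\<^sup>2 / (4 * (c / 2)) + 2 * K) * (s + e)\<^sup>2)
        \<le> c / 2 * A\<^sup>2 - 2 * K * A * (s + e) - 2 * K * (s + e)\<^sup>2"
      using c K by (intro absorb_by_coercivity) auto
    moreover have "(s + e)\<^sup>2 \<le> 4 * ((f - F)\<^sup>2 + (f + g - (F + G))\<^sup>2 + w1\<^sup>2 + v1\<^sup>2)"
    proof -
      have sq: "(a + b)\<^sup>2 \<le> 2 * (a\<^sup>2 + b\<^sup>2)" for a b :: real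
        using sum_squares_bound[of a b] by (simp add: power2_sum)
      have "s\<^sup>2 \<le> 2 * ((f - F)\<^sup>2 + (f + g - (F + G))\<^sup>2)" "e\<^sup>2 \<le> 2 * (w1\<^sup>2 + v1\<^sup>2)"
        using sq[of "\<bar>f - F\<bar>" "\<bar>f + g - (F + G)\<bar>"] sq[of "\<bar>w1\<bar>" "\<bar>v1\<bar>"] by (simp_all add: s_def e_def)
      with sq[of s e] show ?thesis unfolding distrib_left by linarith
    qed
    then have "((2 * K)\<^sup>2 / (4 * (c / 2)) + 2 * K) * (s + e)\<^sup>2
        \<le> ((2 * K)\<^sup>2 / (4 * (c / 2)) + 2 * K) * (4 * ((f - F)\<^sup>2 + (f + g - (F + G))\<^sup>2 + w1\<^sup>2 + v1\<^sup>2))"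
      using c K by (intro mult_left_mono) auto
    ultimately show "- (4 * ((2 * K)\<^sup>2 / (4 * (c / 2)) + 2 * K) * ((f - F)\<^sup>2 + (f + g - (F + G))\<^sup>2 + w1\<^sup>2 + v1\<^sup>2))
        \<le> (sm * (f3 - F3) - w1) * ?J1 + (m * sp * (d3 - D3) - v1) * ?J2"
      unfolding w_def v_def by (simp only: mult_ac)
  qed (use c K in auto)
qed

subsection \<open>Energy\<close>

lemma L2_space_linear:
  assumes "u \<in> L2_space a b" "v \<in> L2_space a b"
  shows "(\<lambda>x. c * u x + d * v x) \<in> L2_space a b"
proof -
  have "integrable (lebesgue_on {a<..<b}) (\<lambda>x. c\<^sup>2 * (u x)\<^sup>2 + 2 * c * d * (u x * v x) + d\<^sup>2 * (v x)\<^sup>2)"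
    using assms L2_mult_integrable[OF assms] by (auto simp: L2_space_def)
  moreover have "(\<lambda>x. (c * u x + d * v x)\<^sup>2) = (\<lambda>x. c\<^sup>2 * (u x)\<^sup>2 + 2 * c * d * (u x * v x) + d\<^sup>2 * (v x)\<^sup>2)"
    by (simp add: fun_eq_iff power2_eq_square algebra_simps)
  ultimately show ?thesis
    using assms by (auto simp: L2_space_def)
qed

lemma L2_norm_linear_le:
  assumes "u \<in> L2_space a b" "v \<in> L2_space a b"
  shows "L2_norm_on a b (\<lambda>x. c * u x + d * v x) \<le> \<bar>c\<bar> * L2_norm_on a b u + \<bar>d\<bar> * L2_norm_on a b v"
proof -
  let ?L = "lebesgue_on {a<..<b}"
  have nn: "L2_norm_on a b u \<ge> 0" "L2_norm_on a b v \<ge> 0"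
    unfolding L2_norm_on_def by (intro real_sqrt_ge_zero integral_nonneg_AE; simp)+
  have sq: "(LINT x|?L. (u x)\<^sup>2) = (L2_norm_on a b u)\<^sup>2" "(LINT x|?L. (v x)\<^sup>2) = (L2_norm_on a b v)\<^sup>2"
    unfolding L2_norm_on_def by (intro real_sqrt_pow2[symmetric] integral_nonneg_AE; simp)+
  have i: "integrable ?L (\<lambda>x. (u x)\<^sup>2)" "integrable ?L (\<lambda>x. (v x)\<^sup>2)" "integrable ?L (\<lambda>x. u x * v x)"
    using assms L2_mult_integrable[OF assms] by (auto simp: L2_space_def)
  have "(LINT x|?L. (c * u x + d * v x)\<^sup>2)
    = (LINT x|?L. c\<^sup>2 * (u x)\<^sup>2 + (2 * c * d) * (u x * v x) + d\<^sup>2 * (v x)\<^sup>2)"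
    by (intro Bochner_Integration.integral_cong) (auto simp: power2_eq_square algebra_simps)
  also have "\<dots> = c\<^sup>2 * (LINT x|?L. (u x)\<^sup>2) + (2 * c * d) * (LINT x|?L. u x * v x) + d\<^sup>2 * (LINT x|?L. (v x)\<^sup>2)"
    by (simp only: i integral_mult_right_zero integrable_mult_right Bochner_Integration.integral_add
        Bochner_Integration.integrable_add)
  also have "\<dots> \<le> c\<^sup>2 * (L2_norm_on a b u)\<^sup>2 + \<bar>2 * c * d\<bar> * (L2_norm_on a b u * L2_norm_on a b v)
      + d\<^sup>2 * (L2_norm_on a b v)\<^sup>2"
  proof (intro add_mono)
    have "(2 * c * d) * (LINT x|?L. u x * v x) \<le> \<bar>2 * c * d\<bar> * \<bar>LINT x|?L. u x * v x\<bar>"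
      unfolding abs_mult[symmetric] by (rule abs_ge_self)
    also have "\<dots> \<le> \<bar>2 * c * d\<bar> * (L2_norm_on a b u * L2_norm_on a b v)"
      by (intro mult_left_mono L2_Cauchy_Schwarz assms abs_ge_zero)
    finally show "(2 * c * d) * (LINT x|?L. u x * v x) \<le> \<bar>2 * c * d\<bar> * (L2_norm_on a b u * L2_norm_on a b v)" .
  qed (simp_all only: sq order_refl)
  also have "\<dots> = (\<bar>c\<bar> * L2_norm_on a b u + \<bar>d\<bar> * L2_norm_on a b v)\<^sup>2"
    by (simp add: power2_sum power_mult_distrib abs_mult)
  finally have "(LINT x|?L. (c * u x + d * v x)\<^sup>2) \<le> (\<bar>c\<bar> * L2_norm_on a b u + \<bar>d\<bar> * L2_norm_on a b v)\<^sup>2" .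
  then show ?thesis
    unfolding L2_norm_on_def[of a b "\<lambda>x. c * u x + d * v x"] using nn by (intro real_le_lsqrt) auto
qed

text \<open>The part of \<open>C1_into\<close> that concerns one time \<open>t\<close>, in a form
  that passes to the differences of the solutions. Membership in L2 is included because a
  non-integrable function has integral 0 by convention, so that a small norm alone would say
  nothing.\<close>

definition L2_derivative ::
  "real \<Rightarrow> real \<Rightarrow> real set \<Rightarrow> (real \<Rightarrow> real \<Rightarrow> real) \<Rightarrow> (real \<Rightarrow> real) \<Rightarrow> real \<Rightarrow> bool" where
  "L2_derivative a b I u u' t \<longleftrightarrow> (\<forall>\<tau>\<in>I. u \<tau> \<in> L2_space a b) \<and> u' \<in> L2_space a b \<and>
     ((\<lambda>\<tau>. L2_norm_on a b (\<lambda>x. (u \<tau> x - u t x) / (\<tau> - t) - u' x)) \<longlongrightarrow> 0) (at t within I)"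

lemma L2_derivative_linear:
  assumes u: "L2_derivative a b I u u' t" and v: "L2_derivative a b I v v' t" and t: "t \<in> I"
  shows "L2_derivative a b I (\<lambda>\<tau> x. c * u \<tau> x + d * v \<tau> x) (\<lambda>x. c * u' x + d * v' x) t"
proof -
  let ?q = "\<lambda>u u' \<tau> x. (u \<tau> x - u t x) / (\<tau> - t) - u' x"
  have q: "?q u u' \<tau> \<in> L2_space a b" if "L2_derivative a b I u u' t" "\<tau> \<in> I" for u u' \<tau>
  proof -
    have "(\<lambda>x. 1 / (\<tau> - t) * (1 * u \<tau> x + (- 1) * u t x) + (- 1) * u' x) \<in> L2_space a b"
      using that t unfolding L2_derivative_def by (intro L2_space_linear) auto
    then show ?thesis by (simp add: field_simps)
  qed
  have "((\<lambda>\<tau>. L2_norm_on a b (?q (\<lambda>\<tau> x. c * u \<tau> x + d * v \<tau> x) (\<lambda>x. c * u' x + d * v' x) \<tau>)) \<longlongrightarrow> 0) (at t within I)"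
  proof (rule Lim_null_comparison)
    show "((\<lambda>\<tau>. \<bar>c\<bar> * L2_norm_on a b (?q u u' \<tau>) + \<bar>d\<bar> * L2_norm_on a b (?q v v' \<tau>)) \<longlongrightarrow> 0) (at t within I)"
      using u v unfolding L2_derivative_def
      by (intro tendsto_add_zero tendsto_mult_right_zero) auto
    show "\<forall>\<^sub>F \<tau> in at t within I. norm (L2_norm_on a b (?q (\<lambda>\<tau> x. c * u \<tau> x + d * v \<tau> x) (\<lambda>x. c * u' x + d * v' x) \<tau>))
        \<le> \<bar>c\<bar> * L2_norm_on a b (?q u u' \<tau>) + \<bar>d\<bar> * L2_norm_on a b (?q v v' \<tau>)"
      unfolding eventually_at_filter
    proof (intro always_eventually allI impI)
      fix \<tau>
      assume "\<tau> \<noteq> t" "\<tau> \<in> I"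
      have "?q (\<lambda>\<tau> x. c * u \<tau> x + d * v \<tau> x) (\<lambda>x. c * u' x + d * v' x) \<tau>
        = (\<lambda>x. c * ?q u u' \<tau> x + d * ?q v v' \<tau> x)"
        by (simp add: fun_eq_iff diff_divide_distrib add_divide_distrib right_diff_distrib)
      moreover have "L2_norm_on a b (?q (\<lambda>\<tau> x. c * u \<tau> x + d * v \<tau> x) (\<lambda>x. c * u' x + d * v' x) \<tau>) \<ge> 0"
        unfolding L2_norm_on_def by (intro real_sqrt_ge_zero integral_nonneg_AE) simp
      ultimately show "norm (L2_norm_on a b (?q (\<lambda>\<tau> x. c * u \<tau> x + d * v \<tau> x) (\<lambda>x. c * u' x + d * v' x) \<tau>))
        \<le> \<bar>c\<bar> * L2_norm_on a b (?q u u' \<tau>) + \<bar>d\<bar> * L2_norm_on a b (?q v v' \<tau>)"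
        using L2_norm_linear_le[OF q[OF u \<open>\<tau> \<in> I\<close>] q[OF v \<open>\<tau> \<in> I\<close>], of c d] by simp
    qed
  qed
  then show ?thesis
    using u v unfolding L2_derivative_def by (auto intro: L2_space_linear)
qed

lemma
  assumes "L2_derivative a b I u u' t" "L2_derivative a b I v v' t" "t \<in> I"
  shows L2_derivative_add: "L2_derivative a b I (\<lambda>\<tau> x. u \<tau> x + v \<tau> x) (\<lambda>x. u' x + v' x) t"
    and L2_derivative_diff: "L2_derivative a b I (\<lambda>\<tau> x. u \<tau> x - v \<tau> x) (\<lambda>x. u' x - v' x) t"
  using L2_derivative_linear[OF assms, of 1 1] L2_derivative_linear[OF assms, of 1 "-1"] by simp_all

text \<open>Only \<open>w0\<close> is known to be differentiable in time, so the term with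
  \<open>w1\<close> cannot be differentiated under the integral. Integration by parts in
  \<open>x\<close> first turns the energy difference into a pairing of
  \<open>w0 \<tau> - w0 t\<close> with a function that converges uniformly as \<tau> tends to
  \<open>t\<close>, by the Hoelder bounds on \<open>w0\<close> and \<open>w2\<close>.\<close>

lemma energy_has_derivative:
  fixes w0 w1 w2 :: "real \<Rightarrow> real \<Rightarrow> real"
  assumes ab: "a < b" and t: "t \<in> I" and \<nu>: "\<nu> > 0" and K: "K \<ge> 0"
    and d0: "\<And>\<tau> x. \<tau> \<in> I \<Longrightarrow> x \<in> {a..b} \<Longrightarrow> (w0 \<tau> has_real_derivative w1 \<tau> x) (at x within {a..b})"
    and d1: "\<And>\<tau> x. \<tau> \<in> I \<Longrightarrow> x \<in> {a..b} \<Longrightarrow> (w1 \<tau> has_real_derivative w2 \<tau> x) (at x within {a..b})"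
    and c2: "\<And>\<tau>. \<tau> \<in> I \<Longrightarrow> continuous_on {a..b} (w2 \<tau>)"
    and bd: "\<And>\<tau>. \<tau> \<in> I \<Longrightarrow> w1 \<tau> a = 0 \<and> w1 \<tau> b = 0"
    and h: "\<And>\<tau> x. \<tau> \<in> I \<Longrightarrow> x \<in> {a..b} \<Longrightarrow> \<bar>w0 \<tau> x - w0 t x\<bar> \<le> K * \<bar>\<tau> - t\<bar> powr \<nu>"
      "\<And>\<tau> x. \<tau> \<in> I \<Longrightarrow> x \<in> {a..b} \<Longrightarrow> \<bar>w2 \<tau> x - w2 t x\<bar> \<le> K * \<bar>\<tau> - t\<bar> powr \<nu>"
    and wt: "L2_derivative a b I w0 w' t"
  shows "((\<lambda>\<tau>. LINT x|lebesgue_on {a<..<b}. (\<alpha> * (w1 \<tau> x)\<^sup>2 + (w0 \<tau> x)\<^sup>2) / 2) has_real_derivative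
    (LINT x|lebesgue_on {a<..<b}. w' x * (w0 t x - \<alpha> * w2 t x))) (at t within I)"
proof -
  let ?L = "lebesgue_on {a<..<b}"
  define E where "E \<tau> = (LINT x|?L. (\<alpha> * (w1 \<tau> x)\<^sup>2 + (w0 \<tau> x)\<^sup>2) / 2)" for \<tau>
  have c0: "continuous_on {a..b} (w0 \<tau>)" if "\<tau> \<in> I" for \<tau>
    by (rule DERIV_continuous_on[OF d0[OF that]])
  have c1: "continuous_on {a..b} (w1 \<tau>)" if "\<tau> \<in> I" for \<tau>
    by (rule DERIV_continuous_on[OF d1[OF that]])
  define \<psi> where "\<psi> x = w0 t x - \<alpha> * w2 t x" for x
  \<comment> \<open>The mean of \<open>w0 - \<alpha> * w2\<close> over the two times: a difference
    of squares is a difference times a sum.\<close>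
  define \<psi>\<tau> where "\<psi>\<tau> \<tau> x = (w0 \<tau> x + w0 t x - \<alpha> * (w2 \<tau> x + w2 t x)) / 2" for \<tau> x
  define Q where "Q \<tau> x = (w0 \<tau> x - w0 t x) / (\<tau> - t)" for \<tau> x
  define n where "n \<tau> = L2_norm_on a b (\<lambda>x. Q \<tau> x - w' x)" for \<tau>
  define r where "r \<tau> = L2_norm_on a b (\<lambda>x. \<psi>\<tau> \<tau> x - \<psi> x)" for \<tau>
  have w': "w' \<in> L2_space a b" and n0: "(n \<longlongrightarrow> 0) (at t within I)"
    using wt by (auto simp: L2_derivative_def n_def[abs_def] Q_def)
  have c\<psi>: "continuous_on {a..b} \<psi>" unfolding \<psi>_def by (intro continuous_intros c0 c2 t)
  have c\<psi>\<tau>: "continuous_on {a..b} (\<psi>\<tau> \<tau>)" if "\<tau> \<in> I" for \<tau>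
    unfolding \<psi>\<tau>_def by (intro continuous_intros c0 c2 t that) auto
  have cQ: "continuous_on {a..b} (Q \<tau>)" if "\<tau> \<in> I" "\<tau> \<noteq> t" for \<tau>
    unfolding Q_def using that by (intro continuous_intros c0 t) auto
  have rle: "r \<tau> \<le> (1 + \<bar>\<alpha>\<bar>) * (K * \<bar>\<tau> - t\<bar> powr \<nu>) * sqrt (b - a)" if \<tau>: "\<tau> \<in> I" for \<tau>
  proof -
    let ?\<kappa> = "(1 + \<bar>\<alpha>\<bar>) * (K * \<bar>\<tau> - t\<bar> powr \<nu>)"
    have \<kappa>: "?\<kappa> \<ge> 0" using K by simp
    have "(LINT x|?L. (\<psi>\<tau> \<tau> x - \<psi> x)\<^sup>2) \<le> ?\<kappa>\<^sup>2 * (b - a)"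
    proof (rule integral_le_const_Ioo)
      show "integrable ?L (\<lambda>x. (\<psi>\<tau> \<tau> x - \<psi> x)\<^sup>2)"
        by (intro continuous_on_integrable_Ioo continuous_intros c\<psi> c\<psi>\<tau> \<tau>)
      fix x
      assume "x \<in> {a<..<b}"
      then have x: "x \<in> {a..b}" by auto
      have "\<psi>\<tau> \<tau> x - \<psi> x = ((w0 \<tau> x - w0 t x) - \<alpha> * (w2 \<tau> x - w2 t x)) / 2"
        by (simp add: \<psi>\<tau>_def \<psi>_def field_simps)
      then have "\<bar>\<psi>\<tau> \<tau> x - \<psi> x\<bar> \<le> \<bar>(w0 \<tau> x - w0 t x) - \<alpha> * (w2 \<tau> x - w2 t x)\<bar>" by simp
      also have "\<dots> \<le> \<bar>w0 \<tau> x - w0 t x\<bar> + \<bar>\<alpha>\<bar> * \<bar>w2 \<tau> x - w2 t x\<bar>"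
        unfolding abs_mult[symmetric] by (rule abs_triangle_ineq4)
      also have "\<dots> \<le> K * \<bar>\<tau> - t\<bar> powr \<nu> + \<bar>\<alpha>\<bar> * (K * \<bar>\<tau> - t\<bar> powr \<nu>)"
        by (intro add_mono mult_left_mono h \<tau> x) auto
      also have "\<dots> = ?\<kappa>" by (simp add: distrib_right)
      finally have "\<bar>\<psi>\<tau> \<tau> x - \<psi> x\<bar>\<^sup>2 \<le> ?\<kappa>\<^sup>2" by (intro power_mono) auto
      then show "(\<psi>\<tau> \<tau> x - \<psi> x)\<^sup>2 \<le> ?\<kappa>\<^sup>2" by simp
    qed (use ab in simp)
    then have "r \<tau> \<le> sqrt (?\<kappa>\<^sup>2 * (b - a))"
      unfolding r_def L2_norm_on_def by (rule real_sqrt_le_mono)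
    also have "\<dots> = ?\<kappa> * sqrt (b - a)" unfolding real_sqrt_mult using \<kappa> by (simp only: real_sqrt_abs abs_of_nonneg)
    finally show ?thesis .
  qed
  have r0: "(r \<longlongrightarrow> 0) (at t within I)"
  proof (rule Lim_null_comparison)
    show "\<forall>\<^sub>F \<tau> in at t within I. norm (r \<tau>) \<le> (1 + \<bar>\<alpha>\<bar>) * (K * \<bar>\<tau> - t\<bar> powr \<nu>) * sqrt (b - a)"
      unfolding eventually_at_filter
    proof (intro always_eventually allI impI)
      fix \<tau>
      assume "\<tau> \<in> I"
      have "r \<tau> \<ge> 0" unfolding r_def L2_norm_on_def by (intro real_sqrt_ge_zero integral_nonneg_AE) simp
      with rle[OF \<open>\<tau> \<in> I\<close>] show "norm (r \<tau>) \<le> (1 + \<bar>\<alpha>\<bar>) * (K * \<bar>\<tau> - t\<bar> powr \<nu>) * sqrt (b - a)" by simp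
    qed
    have "((\<lambda>\<tau>. \<bar>\<tau> - t\<bar> powr \<nu>) \<longlongrightarrow> \<bar>t - t\<bar> powr \<nu>) (at t within I)"
      using \<nu> by (intro tendsto_intros) auto
    then have "((\<lambda>\<tau>. \<bar>\<tau> - t\<bar> powr \<nu>) \<longlongrightarrow> 0) (at t within I)" by simp
    then show "((\<lambda>\<tau>. (1 + \<bar>\<alpha>\<bar>) * (K * \<bar>\<tau> - t\<bar> powr \<nu>) * sqrt (b - a)) \<longlongrightarrow> 0) (at t within I)"
      by (intro tendsto_mult_left_zero tendsto_mult_right_zero)
  qed
  \<comment> \<open>Integrating the derivative of
    \<open>(w0 \<tau> - w0 t) * (w1 \<tau> + w1 t)\<close> trades first derivatives for second ones;
    the condition \<open>bd\<close> removes the boundary terms.\<close>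
  have diff: "E \<tau> - E t = (LINT x|?L. (w0 \<tau> x - w0 t x) * \<psi>\<tau> \<tau> x)" if \<tau>: "\<tau> \<in> I" for \<tau>
  proof -
    have "(LINT x|?L. (w1 \<tau> x - w1 t x) * (w1 \<tau> x + w1 t x) + (w0 \<tau> x - w0 t x) * (w2 \<tau> x + w2 t x))
      = (w0 \<tau> b - w0 t b) * (w1 \<tau> b + w1 t b) - (w0 \<tau> a - w0 t a) * (w1 \<tau> a + w1 t a)"
    proof (rule integral_FTC_Ioo)
      show "((\<lambda>x. (w0 \<tau> x - w0 t x) * (w1 \<tau> x + w1 t x)) has_real_derivative
        (w1 \<tau> x - w1 t x) * (w1 \<tau> x + w1 t x) + (w0 \<tau> x - w0 t x) * (w2 \<tau> x + w2 t x)) (at x within {a..b})"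
        if x: "x \<in> {a..b}" for x
        using DERIV_mult[OF DERIV_diff[OF d0[OF \<tau> x] d0[OF t x]] DERIV_add[OF d1[OF \<tau> x] d1[OF t x]]]
        by (simp add: mult.commute)
      show "continuous_on {a..b} (\<lambda>x. (w1 \<tau> x - w1 t x) * (w1 \<tau> x + w1 t x) + (w0 \<tau> x - w0 t x) * (w2 \<tau> x + w2 t x))"
        by (intro continuous_intros c0 c1 c2 \<tau> t)
    qed (use ab in simp)
    then have zero: "(LINT x|?L. (w1 \<tau> x - w1 t x) * (w1 \<tau> x + w1 t x) + (w0 \<tau> x - w0 t x) * (w2 \<tau> x + w2 t x)) = 0"
      using bd[OF \<tau>] bd[OF t] by simp
    have "E \<tau> - E t = (LINT x|?L. (\<alpha> * (w1 \<tau> x)\<^sup>2 + (w0 \<tau> x)\<^sup>2) / 2 - (\<alpha> * (w1 t x)\<^sup>2 + (w0 t x)\<^sup>2) / 2)"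
      unfolding E_def
      by (intro Bochner_Integration.integral_diff[symmetric] continuous_on_integrable_Ioo continuous_intros c0 c1 \<tau> t) auto
    also have "\<dots> = (LINT x|?L. \<alpha> / 2 * ((w1 \<tau> x - w1 t x) * (w1 \<tau> x + w1 t x) + (w0 \<tau> x - w0 t x) * (w2 \<tau> x + w2 t x))
        + (w0 \<tau> x - w0 t x) * \<psi>\<tau> \<tau> x)"
      by (intro Bochner_Integration.integral_cong refl) (simp add: \<psi>\<tau>_def power2_eq_square field_simps)
    also have "\<dots> = (LINT x|?L. \<alpha> / 2 * ((w1 \<tau> x - w1 t x) * (w1 \<tau> x + w1 t x) + (w0 \<tau> x - w0 t x) * (w2 \<tau> x + w2 t x)))
        + (LINT x|?L. (w0 \<tau> x - w0 t x) * \<psi>\<tau> \<tau> x)"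
      by (intro Bochner_Integration.integral_add continuous_on_integrable_Ioo continuous_intros c0 c1 c2 c\<psi>\<tau> \<tau> t)
    also have "\<dots> = (LINT x|?L. (w0 \<tau> x - w0 t x) * \<psi>\<tau> \<tau> x)"
      unfolding integral_mult_right_zero zero by simp
    finally show ?thesis .
  qed
  have "((\<lambda>\<tau>. (E \<tau> - E t) / (\<tau> - t) - (LINT x|?L. w' x * \<psi> x)) \<longlongrightarrow> 0) (at t within I)"
  proof (rule Lim_null_comparison)
    show "((\<lambda>\<tau>. n \<tau> * r \<tau> + n \<tau> * L2_norm_on a b \<psi> + L2_norm_on a b w' * r \<tau>) \<longlongrightarrow> 0) (at t within I)"
      by (intro tendsto_add_zero tendsto_mult_zero tendsto_mult_left_zero tendsto_mult_right_zero n0 r0)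
    show "\<forall>\<^sub>F \<tau> in at t within I. norm ((E \<tau> - E t) / (\<tau> - t) - (LINT x|?L. w' x * \<psi> x))
        \<le> n \<tau> * r \<tau> + n \<tau> * L2_norm_on a b \<psi> + L2_norm_on a b w' * r \<tau>"
      unfolding eventually_at_filter
    proof (intro always_eventually allI impI)
      fix \<tau>
      assume \<tau>: "\<tau> \<noteq> t" "\<tau> \<in> I"
      have L: "(\<lambda>x. 1 * Q \<tau> x + (- 1) * w' x) \<in> L2_space a b" "(\<lambda>x. 1 * \<psi>\<tau> \<tau> x + (- 1) * \<psi> x) \<in> L2_space a b"
        by (intro L2_space_linear continuous_on_imp_L2 cQ c\<psi> c\<psi>\<tau> w' \<tau>)+
      then have L2: "(\<lambda>x. Q \<tau> x - w' x) \<in> L2_space a b" "(\<lambda>x. \<psi>\<tau> \<tau> x - \<psi> x) \<in> L2_space a b" "\<psi> \<in> L2_space a b"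
        by (auto intro: continuous_on_imp_L2 c\<psi>)
      have ints: "integrable ?L (\<lambda>x. (Q \<tau> x - w' x) * (\<psi>\<tau> \<tau> x - \<psi> x))"
        "integrable ?L (\<lambda>x. (Q \<tau> x - w' x) * \<psi> x)" "integrable ?L (\<lambda>x. w' x * (\<psi>\<tau> \<tau> x - \<psi> x))"
        "integrable ?L (\<lambda>x. w' x * \<psi> x)"
        by (intro L2_mult_integrable L2 w')+
      \<comment> \<open>Apart from the limit \<open>w' * \<psi>\<close>, every summand of the
        expansion below contains a factor that tends to 0 in L2.\<close>
      have "(E \<tau> - E t) / (\<tau> - t) = (LINT x|?L. Q \<tau> x * \<psi>\<tau> \<tau> x)"
        unfolding diff[OF \<tau>(2)] Q_def by simp
      also have "\<dots> = (LINT x|?L. (Q \<tau> x - w' x) * (\<psi>\<tau> \<tau> x - \<psi> x) + (Q \<tau> x - w' x) * \<psi> x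
          + w' x * (\<psi>\<tau> \<tau> x - \<psi> x) + w' x * \<psi> x)"
        by (intro Bochner_Integration.integral_cong refl) (simp add: algebra_simps)
      also have "\<dots> = (LINT x|?L. (Q \<tau> x - w' x) * (\<psi>\<tau> \<tau> x - \<psi> x)) + (LINT x|?L. (Q \<tau> x - w' x) * \<psi> x)
          + (LINT x|?L. w' x * (\<psi>\<tau> \<tau> x - \<psi> x)) + (LINT x|?L. w' x * \<psi> x)"
        by (simp only: ints Bochner_Integration.integral_add Bochner_Integration.integrable_add)
      finally have eq: "(E \<tau> - E t) / (\<tau> - t) - (LINT x|?L. w' x * \<psi> x)
        = (LINT x|?L. (Q \<tau> x - w' x) * (\<psi>\<tau> \<tau> x - \<psi> x)) + (LINT x|?L. (Q \<tau> x - w' x) * \<psi> x)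
          + (LINT x|?L. w' x * (\<psi>\<tau> \<tau> x - \<psi> x))" by simp
      show "norm ((E \<tau> - E t) / (\<tau> - t) - (LINT x|?L. w' x * \<psi> x))
        \<le> n \<tau> * r \<tau> + n \<tau> * L2_norm_on a b \<psi> + L2_norm_on a b w' * r \<tau>"
        unfolding eq n_def r_def real_norm_def
        by (intro order_trans[OF abs_triangle_ineq] add_mono L2_Cauchy_Schwarz L2 w')
    qed
  qed
  then have "((\<lambda>\<tau>. (E \<tau> - E t) / (\<tau> - t)) \<longlongrightarrow> (LINT x|?L. w' x * \<psi> x)) (at t within I)"
    by (subst Lim_null)
  then show ?thesis
    unfolding has_field_derivative_iff E_def \<psi>_def .
qed

text \<open>Works on the half-open interval, since the equations hold for positive times only:
  \<open>exp (- C * s) * Y s\<close> is nonincreasing there, and its value at \<open>t\<close> is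
  compared with the limit at 0 instead of a value at 0.\<close>

lemma Gronwall_zero:
  fixes Y :: "real \<Rightarrow> real"
  assumes T: "T > 0"
    and der: "\<And>t. t \<in> {0<..T} \<Longrightarrow> (Y has_real_derivative Y' t) (at t within {0<..T})"
    and le: "\<And>t. t \<in> {0<..T} \<Longrightarrow> Y' t \<le> C * Y t"
    and C: "C \<ge> 0" and nonneg: "\<And>t. t \<in> {0<..T} \<Longrightarrow> Y t \<ge> 0"
    and lim: "(Y \<longlongrightarrow> 0) (at_right 0)" and t: "t \<in> {0<..T}"
  shows "Y t = 0"
proof -
  define Z where "Z s = exp (- C * s) * Y s" for s
  have Zder: "(Z has_real_derivative exp (- C * s) * (Y' s - C * Y s)) (at s within {0<..T})" if "s \<in> {0<..T}" for s
    unfolding Z_def using der[OF that] by (auto intro!: derivative_eq_intros simp: algebra_simps)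
  have dec: "Z t \<le> Z s" if s: "0 < s" "s < t" for s
  \<comment> \<open>For \<open>t = T\<close> only a one-sided derivative is available at
    \<open>t\<close>; this criterion asks for derivatives strictly between \<open>s\<close> and
    \<open>t\<close> and continuity up to the ends.\<close>
  proof (rule DERIV_nonpos_imp_decreasing_open[OF less_imp_le[OF s(2)]])
    fix x
    assume x: "s < x" "x < t"
    then have x': "x \<in> {0<..<T}" "x \<in> {0<..T}" using s t by auto
    have "(Z has_real_derivative exp (- C * x) * (Y' x - C * Y x)) (at x within {0<..<T})"
      by (rule has_field_derivative_subset[OF Zder[OF x'(2)]]) auto
    then have "(Z has_real_derivative exp (- C * x) * (Y' x - C * Y x)) (at x)"
      using x' by (simp add: at_within_open[of x "{0<..<T}"])
    moreover have "exp (- C * x) * (Y' x - C * Y x) \<le> 0"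
      using le[OF x'(2)] by (simp add: mult_le_0_iff)
    ultimately show "\<exists>y. (Z has_real_derivative y) (at x) \<and> y \<le> 0" by blast
  next
    have "continuous_on {0<..T} Z" using Zder by (rule DERIV_continuous_on)
    then show "continuous_on {s..t} Z"
      by (rule continuous_on_subset) (use s t in auto)
  qed
  have "Z t \<le> 0"
  proof (rule tendsto_lowerbound[OF lim])
    have "\<forall>\<^sub>F s in at_right 0. s \<in> {0<..<t}"
      using eventually_at_right_real[of 0 t] t by auto
    then show "\<forall>\<^sub>F s in at_right 0. Z t \<le> Y s"
    proof eventually_elim
      case (elim s)
      then have s: "0 < s" "s < t" by auto
      have "Z s \<le> 1 * Y s"
        unfolding Z_def using s t C by (intro mult_right_mono nonneg) auto
      with dec[OF s] show ?case by simp
    qed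
  qed simp
  then have "Y t \<le> 0" by (simp add: Z_def mult_le_0_iff)
  with nonneg[OF t] show ?thesis by simp
qed

lemma integral_Ioo_zero_imp_zero:
  fixes h :: "real \<Rightarrow> real"
  assumes ab: "a < b" and c: "continuous_on {a..b} h" and nonneg: "\<And>x. x \<in> {a..b} \<Longrightarrow> h x \<ge> 0"
    and zero: "(LINT x|lebesgue_on {a<..<b}. h x) = 0" and x: "x \<in> {a..b}"
  shows "h x = 0"
proof -
  have "integral {a..b} h = integral {a<..<b} h"
    using integral_open_interval_real[of a b h] by simp
  also have "\<dots> = 0"
    using lebesgue_integral_eq_integral[OF continuous_on_integrable_Ioo[OF c]] zero by simp
  finally have "(h has_integral 0) (cbox a b)"
    using integrable_integral[OF integrable_continuous_real[OF c]] by simp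
  then show ?thesis
    using has_integral_0_cbox_imp_0[of a b h x] c nonneg x ab by (auto simp: box_real)
qed

subsection \<open>Uniqueness\<close>

text \<open>Passes from norms to pointwise statements up to and including time 0. The uniform bound
  is the bound at time 0 plus the largest Hoelder increment over \<open>{0..T}\<close>.\<close>

lemma hoelder_into_HsB_bounds:
  assumes h: "hoelder_into (HsB_space s a b) (Hs_norm s a b) \<nu> {0..T} u"
    and s: "s > 7 / 2" and ab: "a < b" and \<nu>: "\<nu> > 0" and T: "T > 0"
  obtains K M where "K \<ge> 0" "M \<ge> 0"
    "\<And>t. t \<in> {0..T} \<Longrightarrow> C3_on a b (u t)"
    "\<And>t x. t \<in> {0..T} \<Longrightarrow> x \<in> {a, b} \<Longrightarrow> dx a b (u t) x = 0 \<and> (dx a b ^^ 3) (u t) x = 0"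
    "\<And>t \<tau> k x. t \<in> {0..T} \<Longrightarrow> \<tau> \<in> {0..T} \<Longrightarrow> k \<le> 3 \<Longrightarrow> x \<in> {a..b} \<Longrightarrow>
      \<bar>(dx a b ^^ k) (u \<tau>) x - (dx a b ^^ k) (u t) x\<bar> \<le> K * \<bar>\<tau> - t\<bar> powr \<nu>"
    "\<And>t k x. t \<in> {0..T} \<Longrightarrow> k \<le> 3 \<Longrightarrow> x \<in> {a..b} \<Longrightarrow> \<bar>(dx a b ^^ k) (u t) x\<bar> \<le> M"
proof -
  have mem: "u t \<in> HsB_space s a b" "u t \<in> Hs_space s a b" if "t \<in> {0..T}" for t
    using h that by (auto simp: hoelder_into_def HsB_space_def)
  have C3: "C3_on a b (u t)" if "t \<in> {0..T}" for t
    by (rule Hs_imp_C3_on[OF mem(2)[OF that] s ab])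
  obtain K0 where K0: "\<And>t \<tau>. t \<in> {0..T} \<Longrightarrow> \<tau> \<in> {0..T} \<Longrightarrow> Hs_norm s a b (\<lambda>x. u \<tau> x - u t x) \<le> K0 * \<bar>\<tau> - t\<bar> powr \<nu>"
    using h unfolding hoelder_into_def by blast
  \<comment> \<open>\<open>hoelder_into\<close> does not fix the sign of its constant, hence the
    absolute value.\<close>
  define K where "K = (moment_const s + 1) * \<bar>K0\<bar>"
  have K: "K \<ge> 0" using moment_const_nonneg[of s] by (simp add: K_def)
  have hk: "\<bar>(dx a b ^^ k) (u \<tau>) x - (dx a b ^^ k) (u t) x\<bar> \<le> K * \<bar>\<tau> - t\<bar> powr \<nu>"
    if t: "t \<in> {0..T}" and \<tau>: "\<tau> \<in> {0..T}" and k: "k \<le> 3" and x: "x \<in> {a..b}" for t \<tau> k x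
  proof -
    have "\<bar>(dx a b ^^ k) (u \<tau>) x - (dx a b ^^ k) (u t) x\<bar> = \<bar>(dx a b ^^ k) (\<lambda>x. u \<tau> x - u t x) x\<bar>"
      using dx_diff[OF C3[OF \<tau>] C3[OF t] ab k x] by simp
    also have "\<dots> \<le> (moment_const s + 1) * Hs_norm s a b (\<lambda>x. u \<tau> x - u t x)"
      by (intro dx_le_Hs_norm Hs_space_diff mem s ab k x t \<tau>)
    also have "\<dots> \<le> (moment_const s + 1) * (\<bar>K0\<bar> * \<bar>\<tau> - t\<bar> powr \<nu>)"
    proof (intro mult_left_mono order_trans[OF K0[OF t \<tau>]])
      show "K0 * \<bar>\<tau> - t\<bar> powr \<nu> \<le> \<bar>K0\<bar> * \<bar>\<tau> - t\<bar> powr \<nu>" by (intro mult_right_mono) auto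
    qed (use moment_const_nonneg[of s] in auto)
    finally show ?thesis by (simp add: K_def mult.assoc)
  qed
  define N where "N = (moment_const s + 1) * Hs_norm s a b (u 0)"
  have 0: "0 \<in> {0..T}" using T by simp
  have bound: "\<bar>(dx a b ^^ k) (u t) x\<bar> \<le> \<bar>N\<bar> + K * T powr \<nu>"
    if t: "t \<in> {0..T}" and k: "k \<le> 3" and x: "x \<in> {a..b}" for t k x
  proof -
    have "\<bar>(dx a b ^^ k) (u t) x - (dx a b ^^ k) (u 0) x\<bar> \<le> K * \<bar>t - 0\<bar> powr \<nu>"
      by (intro hk 0 t k x)
    also have "\<dots> \<le> K * T powr \<nu>"
      using t K \<nu> by (intro mult_left_mono powr_mono2) auto
    finally have 1: "\<bar>(dx a b ^^ k) (u t) x - (dx a b ^^ k) (u 0) x\<bar> \<le> K * T powr \<nu>" .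
    have 2: "\<bar>(dx a b ^^ k) (u 0) x\<bar> \<le> N"
      unfolding N_def by (intro dx_le_Hs_norm mem 0 s ab k x)
    from 1 2 show ?thesis by linarith
  qed
  show ?thesis
  proof (rule that[of K "\<bar>N\<bar> + K * T powr \<nu>"])
    show "dx a b (u t) x = 0 \<and> (dx a b ^^ 3) (u t) x = 0" if "t \<in> {0..T}" "x \<in> {a, b}" for t x
      using mem(1)[OF that(1)] that(2) unfolding HsB_space_def by blast
  qed (use K C3 hk bound in auto)
qed

text \<open>Hoelder continuity in time is uniform in \<open>x\<close>; together with continuity in
  \<open>x\<close> it yields joint continuity on the compact set
  \<open>{0..T} \<times> {a..b}\<close>, where the minimum is attained and positive.\<close>

lemma positive_lower_bound:
  fixes u :: "real \<Rightarrow> real \<Rightarrow> real"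
  assumes ab: "a < b" and T: "T > 0" and \<nu>: "\<nu> > 0"
    and h: "\<And>t \<tau> x. t \<in> {0..T} \<Longrightarrow> \<tau> \<in> {0..T} \<Longrightarrow> x \<in> {a..b} \<Longrightarrow> \<bar>u \<tau> x - u t x\<bar> \<le> K * \<bar>\<tau> - t\<bar> powr \<nu>"
    and c: "\<And>t. t \<in> {0..T} \<Longrightarrow> continuous_on {a..b} (u t)"
    and pos: "\<And>t x. t \<in> {0..T} \<Longrightarrow> x \<in> {a..b} \<Longrightarrow> u t x > 0"
  obtains \<delta> where "\<delta> > 0" "\<And>t x. t \<in> {0..T} \<Longrightarrow> x \<in> {a..b} \<Longrightarrow> \<delta> \<le> u t x"
proof -
  let ?S = "{0..T} \<times> {a..b}"
  have "continuous_on ?S (\<lambda>z. u (fst z) (snd z))"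
    unfolding continuous_on_def
  proof
    fix z
    assume z: "z \<in> ?S"
    let ?F = "at z within ?S"
    have z': "fst z \<in> {0..T}" "snd z \<in> {a..b}" using z by auto
    have "((\<lambda>y. K * \<bar>fst y - fst z\<bar> powr \<nu>) \<longlongrightarrow> K * \<bar>fst z - fst z\<bar> powr \<nu>) ?F"
      using \<nu> by (intro tendsto_intros) auto
    then have "((\<lambda>y. K * \<bar>fst y - fst z\<bar> powr \<nu>) \<longlongrightarrow> 0) ?F" by simp
    moreover have "\<forall>\<^sub>F y in ?F. norm (u (fst y) (snd y) - u (fst z) (snd y)) \<le> K * \<bar>fst y - fst z\<bar> powr \<nu>"
      unfolding eventually_at_filter
    proof (intro always_eventually allI impI)
      fix y
      assume "y \<in> ?S"
      then show "norm (u (fst y) (snd y) - u (fst z) (snd y)) \<le> K * \<bar>fst y - fst z\<bar> powr \<nu>"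
        using h[OF z'(1), of "fst y" "snd y"] by auto
    qed
    ultimately have "((\<lambda>y. u (fst y) (snd y) - u (fst z) (snd y)) \<longlongrightarrow> 0) ?F"
      by (rule Lim_null_comparison[rotated])
    moreover have "continuous_on ?S (\<lambda>y. u (fst z) (snd y))"
      by (rule continuous_on_compose2[OF c[OF z'(1)] continuous_on_snd[OF continuous_on_id]]) auto
    then have "((\<lambda>y. u (fst z) (snd y)) \<longlongrightarrow> u (fst z) (snd z)) ?F"
      using z unfolding continuous_on_def by blast
    ultimately have "((\<lambda>y. (u (fst y) (snd y) - u (fst z) (snd y)) + u (fst z) (snd y)) \<longlongrightarrow> 0 + u (fst z) (snd z)) ?F"
      by (rule tendsto_add)
    then show "((\<lambda>y. u (fst y) (snd y)) \<longlongrightarrow> u (fst z) (snd z)) ?F" by simp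
  qed
  moreover have "compact ?S" "?S \<noteq> {}" using ab T by (auto intro: compact_Times)
  ultimately obtain z where z: "z \<in> ?S" "\<forall>y\<in>?S. u (fst z) (snd z) \<le> u (fst y) (snd y)"
    using continuous_attains_inf by blast
  show ?thesis
  proof (rule that)
    show "u (fst z) (snd z) > 0" using z by (intro pos) auto
    show "u (fst z) (snd z) \<le> u t x" if "t \<in> {0..T}" "x \<in> {a..b}" for t x
      using z(2) that by force
  qed
qed

section \<open>Fluxes along a solution and the weak form of the equations\<close>

lemma continuous_on_j1:
  fixes f g f3 d3 :: "real \<Rightarrow> real"
  assumes "continuous_on S f" "continuous_on S g" "continuous_on S f3" "continuous_on S d3"
  shows "continuous_on S (\<lambda>x. j1 m sp sm (f x) (g x) (f3 x) (d3 x))"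
  unfolding j1_def p11_def p12_def by (intro continuous_intros assms)

lemma continuous_on_j2:
  fixes f g f3 d3 :: "real \<Rightarrow> real"
  assumes p: "p > 1" and c: "continuous_on S f" "continuous_on S g" "continuous_on S f3" "continuous_on S d3"
    and pos: "\<And>x. x \<in> S \<Longrightarrow> g x > 0"
  shows "continuous_on S (\<lambda>x. j2 m sp sm \<mu>0 \<tau>h p (f x) (g x) (f3 x) (d3 x))"
proof -
  have cPhi: "continuous_on S (\<lambda>x. Phi p (d3 x))"
    by (rule continuous_on_compose2[OF DERIV_imp_continuous_on[OF has_real_derivative_Phi[OF p]] c(4) subset_UNIV])
  have cpowr: "continuous_on S (\<lambda>x. \<bar>g x\<bar> powr (p + 2))"
  proof (rule continuous_on_powr[OF continuous_on_rabs[OF c(2)] continuous_on_const])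
    show "\<forall>x\<in>S. \<bar>g x\<bar> \<noteq> 0"
    proof
      show "\<bar>g x\<bar> \<noteq> 0" if "x \<in> S" for x using pos[OF that] by simp
    qed
  qed
  show ?thesis
    unfolding j2_def p21_def p22_def p11_def p12_def
    by (intro continuous_on_add continuous_on_mult continuous_on_power continuous_on_const c cPhi cpowr)
qed

text \<open>Every term of a flux contains a third derivative as a factor, or \<open>Phi\<close> of
  one with \<open>Phi p 0 = 0\<close>. The third order boundary conditions therefore give the
  vanishing at the end points that integration by parts requires.\<close>

lemma
  assumes ab: "a < b" and p: "p > 1" and f: "C3_on a b f" and g: "C3_on a b g"
    and pos: "\<And>x. x \<in> {a..b} \<Longrightarrow> g x > 0"
    and bd: "\<And>x. x \<in> {a, b} \<Longrightarrow> (dx a b ^^ 3) f x = 0 \<and> (dx a b ^^ 3) g x = 0"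
  shows flux1_eq: "x \<in> {a..b} \<Longrightarrow> flux1 a b m sp sm f g x
      = j1 m sp sm (f x) (g x) ((dx a b ^^ 3) f x) ((dx a b ^^ 3) f x + (dx a b ^^ 3) g x)"
    and flux2_eq: "x \<in> {a..b} \<Longrightarrow> flux2 a b m sp sm \<mu>0 \<tau>h p f g x
      = j2 m sp sm \<mu>0 \<tau>h p (f x) (g x) ((dx a b ^^ 3) f x) ((dx a b ^^ 3) f x + (dx a b ^^ 3) g x)"
    and continuous_on_flux1: "continuous_on {a..b} (flux1 a b m sp sm f g)"
    and continuous_on_flux2: "continuous_on {a..b} (flux2 a b m sp sm \<mu>0 \<tau>h p f g)"
    and flux1_boundary: "x \<in> {a, b} \<Longrightarrow> flux1 a b m sp sm f g x = 0"
    and flux2_boundary: "x \<in> {a, b} \<Longrightarrow> flux2 a b m sp sm \<mu>0 \<tau>h p f g x = 0"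
proof -
  note add = dx_add[OF f g ab order_refl]
  show e1: "flux1 a b m sp sm f g x
      = j1 m sp sm (f x) (g x) ((dx a b ^^ 3) f x) ((dx a b ^^ 3) f x + (dx a b ^^ 3) g x)" if "x \<in> {a..b}" for x
    unfolding flux1_def j1_def add[OF that] ..
  show e2: "flux2 a b m sp sm \<mu>0 \<tau>h p f g x
      = j2 m sp sm \<mu>0 \<tau>h p (f x) (g x) ((dx a b ^^ 3) f x) ((dx a b ^^ 3) f x + (dx a b ^^ 3) g x)" if "x \<in> {a..b}" for x
    unfolding flux2_def j2_def add[OF that] ..
  have cf: "continuous_on {a..b} f" and cg: "continuous_on {a..b} g"
    using C3_on_continuous[OF f, of 0] C3_on_continuous[OF g, of 0] by simp_all
  have cf3: "continuous_on {a..b} ((dx a b ^^ 3) f)" and cg3: "continuous_on {a..b} ((dx a b ^^ 3) g)"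
    using f g by (simp_all add: C3_on_def)
  have cd3: "continuous_on {a..b} (\<lambda>x. (dx a b ^^ 3) f x + (dx a b ^^ 3) g x)"
    by (rule continuous_on_add[OF cf3 cg3])
  show "continuous_on {a..b} (flux1 a b m sp sm f g)"
    by (rule continuous_on_eq[OF continuous_on_j1[OF cf cg cf3 cd3]]) (simp add: e1)
  show "continuous_on {a..b} (flux2 a b m sp sm \<mu>0 \<tau>h p f g)"
    by (rule continuous_on_eq[OF continuous_on_j2[OF p cf cg cf3 cd3 pos]]) (simp_all add: e2)
  show "flux1 a b m sp sm f g x = 0" "flux2 a b m sp sm \<mu>0 \<tau>h p f g x = 0" if "x \<in> {a, b}"
  proof -
    have "x \<in> {a..b}" using that ab by auto
    then show "flux1 a b m sp sm f g x = 0" "flux2 a b m sp sm \<mu>0 \<tau>h p f g x = 0"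
      using bd[OF that] by (simp_all add: e1 e2 j1_def j2_def Phi_def)
  qed
qed

text \<open>Two sign changes cancel, one from the equation \<open>u = - q\<close> and one from the
  integration by parts.\<close>

lemma evolution_weak_form:
  assumes ab: "a < b" and w: "has_weak_derivative_L2 a b J q"
    and J: "continuous_on {a..b} J" "\<And>x. x \<in> {a, b} \<Longrightarrow> J x = 0"
    and eq: "AE x in lebesgue_on {a<..<b}. u x + q x = 0" and u: "u \<in> L2_space a b"
    and \<psi>: "\<And>x. x \<in> {a..b} \<Longrightarrow> (\<psi> has_real_derivative \<psi>' x) (at x within {a..b})"
    and \<psi>': "continuous_on {a..b} \<psi>'"
  shows "(LINT x|lebesgue_on {a<..<b}. u x * \<psi> x) = (LINT x|lebesgue_on {a<..<b}. \<psi>' x * J x)"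
proof -
  have q: "q \<in> L2_space a b" using w by (simp add: has_weak_derivative_L2_def)
  have \<psi>L: "\<psi> \<in> L2_space a b"
    by (rule continuous_on_imp_L2[OF DERIV_continuous_on[OF \<psi>]])
  have "(LINT x|lebesgue_on {a<..<b}. u x * \<psi> x) = (LINT x|lebesgue_on {a<..<b}. - (\<psi> x * q x))"
  proof (rule integral_cong_AE)
    show "AE x in lebesgue_on {a<..<b}. u x * \<psi> x = - (\<psi> x * q x)"
      using eq by eventually_elim (simp add: add_eq_0_iff2 mult.commute)
  qed (use L2_mult_integrable[OF u \<psi>L] L2_mult_integrable[OF \<psi>L q] in auto)
  then show ?thesis
    using weak_derivative_by_parts[OF ab w J(1) J(2) J(2) \<psi> \<psi>'] by simp
qed

text \<open>Initial values are prescribed on \<open>{a..b}\<close> only; this transfers their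
  equality to the spatial derivatives.\<close>

lemma dx_cong:
  assumes "C3_on a b v" "a < b" "\<And>x. x \<in> {a..b} \<Longrightarrow> u x = v x" "k \<le> 3" "x \<in> {a..b}"
  shows "(dx a b ^^ k) u x = (dx a b ^^ k) v x"
  using assms unfolding C3_on_def by (intro dx_iterate[where n = 3]) auto

text \<open>Bundles the quantitative information on one component, so that it is obtained once and
  then applied to the four components \<open>f\<close>, \<open>g\<close>, \<open>F\<close>,
  \<open>G\<close>.\<close>

definition uniformly_regular ::
  "real \<Rightarrow> real \<Rightarrow> real \<Rightarrow> real \<Rightarrow> (real \<Rightarrow> real \<Rightarrow> real) \<Rightarrow> real \<Rightarrow> real \<Rightarrow> real \<Rightarrow> bool" where
  "uniformly_regular a b T \<nu> u K M \<delta> \<longleftrightarrow> K \<ge> 0 \<and> M \<ge> 0 \<and> \<delta> > 0 \<and>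
      (\<forall>t\<in>{0..T}. C3_on a b (u t)) \<and>
      (\<forall>t\<in>{0..T}. \<forall>x\<in>{a, b}. dx a b (u t) x = 0 \<and> (dx a b ^^ 3) (u t) x = 0) \<and>
      (\<forall>t\<in>{0..T}. \<forall>\<tau>\<in>{0..T}. \<forall>k\<le>3. \<forall>x\<in>{a..b}.
        \<bar>(dx a b ^^ k) (u \<tau>) x - (dx a b ^^ k) (u t) x\<bar> \<le> K * \<bar>\<tau> - t\<bar> powr \<nu>) \<and>
      (\<forall>t\<in>{0..T}. \<forall>k\<le>3. \<forall>x\<in>{a..b}. \<bar>(dx a b ^^ k) (u t) x\<bar> \<le> M) \<and>
      (\<forall>t\<in>{0..T}. \<forall>x\<in>{a..b}. \<delta> \<le> u t x)"

lemma uniformly_regularD: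
  assumes "uniformly_regular a b T \<nu> u K M \<delta>"
  shows "K \<ge> 0" "M \<ge> 0" "\<delta> > 0"
    "\<And>t. t \<in> {0..T} \<Longrightarrow> C3_on a b (u t)"
    "\<And>t x. t \<in> {0..T} \<Longrightarrow> x \<in> {a, b} \<Longrightarrow> dx a b (u t) x = 0 \<and> (dx a b ^^ 3) (u t) x = 0"
    "\<And>t \<tau> k x. t \<in> {0..T} \<Longrightarrow> \<tau> \<in> {0..T} \<Longrightarrow> k \<le> 3 \<Longrightarrow> x \<in> {a..b} \<Longrightarrow>
      \<bar>(dx a b ^^ k) (u \<tau>) x - (dx a b ^^ k) (u t) x\<bar> \<le> K * \<bar>\<tau> - t\<bar> powr \<nu>"
    "\<And>t k x. t \<in> {0..T} \<Longrightarrow> k \<le> 3 \<Longrightarrow> x \<in> {a..b} \<Longrightarrow> \<bar>(dx a b ^^ k) (u t) x\<bar> \<le> M"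
    "\<And>t x. t \<in> {0..T} \<Longrightarrow> x \<in> {a..b} \<Longrightarrow> \<delta> \<le> u t x"
  using assms unfolding uniformly_regular_def by blast+

theorem theorem4p2:
  fixes a b m sp sm \<mu>0 \<tau>h p \<theta> \<rho> T :: real
    and f0 g0 :: "real \<Rightarrow> real"
    and f g F G :: "real \<Rightarrow> real \<Rightarrow> real"
  assumes "a < b"
    and "m > 0" and "sp > 0" and "sm > 0" and "\<mu>0 > 0" and "\<tau>h > 0"
    and "1 \<ge> \<theta>" and "\<theta> > \<rho>" and "\<rho> > 7 / 8"
    and "p > 1"
    and "T > 0"
    and "f0 \<in> HsB_space (4 * \<theta>) a b" and "g0 \<in> HsB_space (4 * \<theta>) a b"
    and "\<forall>x\<in>{a..b}. f0 x > 0 \<and> g0 x > 0"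
    and "positive_strong_solution a b m sp sm \<mu>0 \<tau>h p \<theta> \<rho> T f0 g0 f g"
    and "positive_strong_solution a b m sp sm \<mu>0 \<tau>h p \<theta> \<rho> T f0 g0 F G"
  shows "\<forall>t\<in>{0..T}. \<forall>x\<in>{a..b}. f t x = F t x \<and> g t x = G t x"
proof -
  note ab = assms(1) and T = assms(11)
  let ?L = "lebesgue_on {a<..<b}" and ?I = "{0<..T}"
  let ?D = "dx a b ^^ 3"
  \<comment> \<open>Any exponent in \<open>{0<..<\<theta> - \<rho>}\<close> is admissible; this is
    the midpoint. The assumption \<open>\<rho> > 7 / 8\<close> is exactly the embedding threshold
    for \<open>4 * \<rho>\<close>.\<close>
  define \<nu> where "\<nu> = (\<theta> - \<rho>) / 2"
  have \<nu>: "\<nu> > 0" "\<nu> \<in> {0<..<\<theta> - \<rho>}" and s: "4 * \<rho> > 7 / 2"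
    using assms(8,9) by (auto simp: \<nu>_def)
  have regular: "\<exists>K M \<delta>. uniformly_regular a b T \<nu> u K M \<delta>"
    if sol: "positive_strong_solution a b m sp sm \<mu>0 \<tau>h p \<theta> \<rho> T f0 g0 f g" and u: "u = f \<or> u = g" for f g u
  proof -
    have "hoelder_into (HsB_space (4 * \<rho>) a b) (Hs_norm (4 * \<rho>) a b) \<nu> {0..T} u"
      using sol u \<nu>(2) unfolding positive_strong_solution_def by blast
    then obtain K M where KM: "K \<ge> 0" "M \<ge> 0"
      "\<And>t. t \<in> {0..T} \<Longrightarrow> C3_on a b (u t)"
      "\<And>t x. t \<in> {0..T} \<Longrightarrow> x \<in> {a, b} \<Longrightarrow> dx a b (u t) x = 0 \<and> ?D (u t) x = 0"
      "\<And>t \<tau> k x. t \<in> {0..T} \<Longrightarrow> \<tau> \<in> {0..T} \<Longrightarrow> k \<le> 3 \<Longrightarrow> x \<in> {a..b} \<Longrightarrow>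
        \<bar>(dx a b ^^ k) (u \<tau>) x - (dx a b ^^ k) (u t) x\<bar> \<le> K * \<bar>\<tau> - t\<bar> powr \<nu>"
      "\<And>t k x. t \<in> {0..T} \<Longrightarrow> k \<le> 3 \<Longrightarrow> x \<in> {a..b} \<Longrightarrow> \<bar>(dx a b ^^ k) (u t) x\<bar> \<le> M"
      by (rule hoelder_into_HsB_bounds[OF _ s ab \<nu>(1) T]) (rule that)
    have pos: "u t x > 0" if "t \<in> {0..T}" "x \<in> {a..b}" for t x
      using sol u that unfolding positive_strong_solution_def by blast
    have h0: "\<bar>u \<tau> x - u t x\<bar> \<le> K * \<bar>\<tau> - t\<bar> powr \<nu>" if "t \<in> {0..T}" "\<tau> \<in> {0..T}" "x \<in> {a..b}" for t \<tau> x
      using KM(5)[OF that(1,2) _ that(3), of 0] by simp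
    have c0: "continuous_on {a..b} (u t)" if "t \<in> {0..T}" for t
      using C3_on_continuous[OF KM(3)[OF that], of 0] by simp
    obtain \<delta> where "\<delta> > 0" "\<And>t x. t \<in> {0..T} \<Longrightarrow> x \<in> {a..b} \<Longrightarrow> \<delta> \<le> u t x"
      by (rule positive_lower_bound[OF ab T \<nu>(1) h0 c0 pos]; (assumption | (rule that, assumption+)))
    with KM have "uniformly_regular a b T \<nu> u K M \<delta>" unfolding uniformly_regular_def by simp
    then show ?thesis by blast
  qed
  obtain Kf Mf \<delta>f where gf: "uniformly_regular a b T \<nu> f Kf Mf \<delta>f" using regular[OF assms(15)] by blast
  obtain Kg Mg \<delta>g where gg: "uniformly_regular a b T \<nu> g Kg Mg \<delta>g" using regular[OF assms(15)] by blast
  obtain KF MF \<delta>F where gF: "uniformly_regular a b T \<nu> F KF MF \<delta>F" using regular[OF assms(16)] by blast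
  obtain KG MG \<delta>G where gG: "uniformly_regular a b T \<nu> G KG MG \<delta>G" using regular[OF assms(16)] by blast
  \<comment> \<open>Sums instead of maxima: \<open>M\<close> must also bound the third derivative of
    \<open>f + g\<close>, through \<open>Mf + Mg \<le> M\<close>, and \<open>K\<close> the Hoelder
    increments of \<open>v\<close>, which involves all four components.\<close>
  define K where "K = Kf + Kg + KF + KG"
  define M where "M = Mf + Mg + MF + MG"
  define \<delta> where "\<delta> = min (min \<delta>f \<delta>g) (min \<delta>F \<delta>G)"
  have K: "K \<ge> 0" and M: "M \<ge> 0" and \<delta>: "\<delta> > 0"
    using gf[THEN uniformly_regularD(1)] gg[THEN uniformly_regularD(1)] gF[THEN uniformly_regularD(1)]
      gG[THEN uniformly_regularD(1)] gf[THEN uniformly_regularD(2)] gg[THEN uniformly_regularD(2)]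
      gF[THEN uniformly_regularD(2)] gG[THEN uniformly_regularD(2)] gf[THEN uniformly_regularD(3)]
      gg[THEN uniformly_regularD(3)] gF[THEN uniformly_regularD(3)] gG[THEN uniformly_regularD(3)]
    by (simp_all add: K_def M_def \<delta>_def)
  have C3: "C3_on a b (f t)" "C3_on a b (g t)" "C3_on a b (F t)" "C3_on a b (G t)" if "t \<in> {0..T}" for t
    by (rule uniformly_regularD(4)[OF gf that] uniformly_regularD(4)[OF gg that]
        uniformly_regularD(4)[OF gF that] uniformly_regularD(4)[OF gG that])+
  have bd: "dx a b (f t) x = 0 \<and> ?D (f t) x = 0" "dx a b (g t) x = 0 \<and> ?D (g t) x = 0"
    "dx a b (F t) x = 0 \<and> ?D (F t) x = 0" "dx a b (G t) x = 0 \<and> ?D (G t) x = 0"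
    if "t \<in> {0..T}" "x \<in> {a, b}" for t x
    by (rule uniformly_regularD(5)[OF gf that] uniformly_regularD(5)[OF gg that]
        uniformly_regularD(5)[OF gF that] uniformly_regularD(5)[OF gG that])+
  have Mnn: "Mf \<ge> 0" "Mg \<ge> 0" "MF \<ge> 0" "MG \<ge> 0"
    by (rule uniformly_regularD(2)[OF gf] uniformly_regularD(2)[OF gg] uniformly_regularD(2)[OF gF]
        uniformly_regularD(2)[OF gG])+
  have bnd: "\<bar>(dx a b ^^ k) (f t) x\<bar> \<le> Mf" "\<bar>(dx a b ^^ k) (g t) x\<bar> \<le> Mg"
    "\<bar>(dx a b ^^ k) (F t) x\<bar> \<le> MF" "\<bar>(dx a b ^^ k) (G t) x\<bar> \<le> MG"
    if "t \<in> {0..T}" "k \<le> 3" "x \<in> {a..b}" for t k x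
    by (rule uniformly_regularD(7)[OF gf that] uniformly_regularD(7)[OF gg that]
        uniformly_regularD(7)[OF gF that] uniformly_regularD(7)[OF gG that])+
  have low: "\<delta>f \<le> f t x" "\<delta>g \<le> g t x" "\<delta>F \<le> F t x" "\<delta>G \<le> G t x" if "t \<in> {0..T}" "x \<in> {a..b}" for t x
    by (rule uniformly_regularD(8)[OF gf that] uniformly_regularD(8)[OF gg that]
        uniformly_regularD(8)[OF gF that] uniformly_regularD(8)[OF gG that])+
  have low': "\<delta> \<le> \<delta>f" "\<delta> \<le> \<delta>g" "\<delta> \<le> \<delta>F" "\<delta> \<le> \<delta>G"
    by (simp_all add: \<delta>_def)
  have Mle: "Mf \<le> M" "Mg \<le> M" "MF \<le> M" "MG \<le> M" "Mf + Mg \<le> M" "MF + MG \<le> M"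
    using Mnn by (simp_all add: M_def)
  have range: "f t x \<in> {\<delta>..M}" "g t x \<in> {\<delta>..M}" "F t x \<in> {\<delta>..M}" "G t x \<in> {\<delta>..M}"
    if "t \<in> {0..T}" "x \<in> {a..b}" for t x
  proof -
    have *: "y \<in> {\<delta>..M}" if "\<delta>' \<le> y" "\<delta> \<le> \<delta>'" "\<bar>y\<bar> \<le> N" "N \<le> M" for y \<delta>' N
      using that by simp
    show "f t x \<in> {\<delta>..M}" "g t x \<in> {\<delta>..M}" "F t x \<in> {\<delta>..M}" "G t x \<in> {\<delta>..M}"
      by (rule *[OF low(1)[OF that] low'(1) _ Mle(1)] *[OF low(2)[OF that] low'(2) _ Mle(2)]
          *[OF low(3)[OF that] low'(3) _ Mle(3)] *[OF low(4)[OF that] low'(4) _ Mle(4)],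
          use bnd[OF that(1) le0 that(2)] in simp)+
  qed
  have range3: "?D (f t) x \<in> {-M..M}" "?D (f t) x + ?D (g t) x \<in> {-M..M}"
    "?D (F t) x \<in> {-M..M}" "?D (F t) x + ?D (G t) x \<in> {-M..M}"
    if "t \<in> {0..T}" "x \<in> {a..b}" for t x
  proof -
    have *: "y \<in> {-M..M}" if "\<bar>y\<bar> \<le> M" for y using that by (simp add: abs_le_iff)
    note b = bnd[OF that(1) order_refl that(2)]
    show "?D (f t) x \<in> {-M..M}" "?D (F t) x \<in> {-M..M}"
      by (rule *[OF order_trans[OF b(1) Mle(1)]] *[OF order_trans[OF b(3) Mle(3)]])+
    show "?D (f t) x + ?D (g t) x \<in> {-M..M}" "?D (F t) x + ?D (G t) x \<in> {-M..M}"
      by (rule *[OF order_trans[OF order_trans[OF abs_triangle_ineq add_mono[OF b(1,2)]] Mle(5)]]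
          *[OF order_trans[OF order_trans[OF abs_triangle_ineq add_mono[OF b(3,4)]] Mle(6)]])+
  qed
  \<comment> \<open>The index \<open>k\<close> is the order of the spatial derivative; with termwise
    definitions, \<open>der\<close> links consecutive orders directly to
    \<open>C3_on\<close>.\<close>
  define w where "w k t x = (dx a b ^^ k) (f t) x - (dx a b ^^ k) (F t) x" for k t x
  define v where "v k t x = (dx a b ^^ k) (f t) x + (dx a b ^^ k) (g t) x
    - ((dx a b ^^ k) (F t) x + (dx a b ^^ k) (G t) x)" for k t x
  have der: "(w k t has_real_derivative w (Suc k) t x) (at x within {a..b})"
    "(v k t has_real_derivative v (Suc k) t x) (at x within {a..b})"
    if "t \<in> {0..T}" "k < 3" "x \<in> {a..b}" for k t x
  proof -
    have d: "((dx a b ^^ k) (f t) has_real_derivative (dx a b ^^ Suc k) (f t) x) (at x within {a..b})"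
      "((dx a b ^^ k) (g t) has_real_derivative (dx a b ^^ Suc k) (g t) x) (at x within {a..b})"
      "((dx a b ^^ k) (F t) has_real_derivative (dx a b ^^ Suc k) (F t) x) (at x within {a..b})"
      "((dx a b ^^ k) (G t) has_real_derivative (dx a b ^^ Suc k) (G t) x) (at x within {a..b})"
      using C3[OF that(1)] that(2,3) unfolding C3_on_def by blast+
    show "(w k t has_real_derivative w (Suc k) t x) (at x within {a..b})"
      "(v k t has_real_derivative v (Suc k) t x) (at x within {a..b})"
      unfolding w_def[abs_def] v_def[abs_def] by (intro DERIV_diff DERIV_add d)+
  qed
  have cont: "continuous_on {a..b} (w k t)" "continuous_on {a..b} (v k t)" if "t \<in> {0..T}" "k \<le> 3" for k t
    unfolding w_def[abs_def] v_def[abs_def]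
    by (intro continuous_intros C3_on_continuous C3 that)+
  have hoel: "\<bar>w k \<tau> x - w k t x\<bar> \<le> K * \<bar>\<tau> - t\<bar> powr \<nu>" "\<bar>v k \<tau> x - v k t x\<bar> \<le> K * \<bar>\<tau> - t\<bar> powr \<nu>"
    if "t \<in> {0..T}" "\<tau> \<in> {0..T}" "k \<le> 3" "x \<in> {a..b}" for k t \<tau> x
  proof -
    let ?r = "\<bar>\<tau> - t\<bar> powr \<nu>"
    have h: "\<bar>(dx a b ^^ k) (f \<tau>) x - (dx a b ^^ k) (f t) x\<bar> \<le> Kf * ?r"
      "\<bar>(dx a b ^^ k) (g \<tau>) x - (dx a b ^^ k) (g t) x\<bar> \<le> Kg * ?r"
      "\<bar>(dx a b ^^ k) (F \<tau>) x - (dx a b ^^ k) (F t) x\<bar> \<le> KF * ?r"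
      "\<bar>(dx a b ^^ k) (G \<tau>) x - (dx a b ^^ k) (G t) x\<bar> \<le> KG * ?r"
      by (rule uniformly_regularD(6)[OF gf that] uniformly_regularD(6)[OF gg that]
          uniformly_regularD(6)[OF gF that] uniformly_regularD(6)[OF gG that])+
    have r: "0 \<le> Kf * ?r" "0 \<le> Kg * ?r" "0 \<le> KF * ?r" "0 \<le> KG * ?r"
      using gf[THEN uniformly_regularD(1)] gg[THEN uniformly_regularD(1)] gF[THEN uniformly_regularD(1)]
        gG[THEN uniformly_regularD(1)] by simp_all
    have Kr: "K * ?r = Kf * ?r + Kg * ?r + KF * ?r + KG * ?r"
      by (simp add: K_def distrib_right)
    show "\<bar>w k \<tau> x - w k t x\<bar> \<le> K * ?r" "\<bar>v k \<tau> x - v k t x\<bar> \<le> K * ?r"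
      unfolding Kr w_def v_def using h r unfolding abs_le_iff by linarith+
  qed
  have w00: "w 0 t x = f t x - F t x" and v00: "v 0 t x = f t x + g t x - (F t x + G t x)" for t x
    by (simp_all add: w_def v_def)
  have bd1: "w 1 t x = 0" "v 1 t x = 0" if "t \<in> {0..T}" "x \<in> {a, b}" for t x
    using bd[OF that] by (simp_all add: w_def v_def)
  define Ew where "Ew t = (LINT x|?L. (sm * (w 1 t x)\<^sup>2 + (w 0 t x)\<^sup>2) / 2)" for t
  define Ev where "Ev t = (LINT x|?L. (m * sp * (v 1 t x)\<^sup>2 + (v 0 t x)\<^sup>2) / 2)" for t
  define Y where "Y t = Ew t + Ev t" for t
  have Ewnn: "Ew t \<ge> 0" and Evnn: "Ev t \<ge> 0" for t
    unfolding Ew_def Ev_def using assms(2-4) by (auto intro!: integral_nonneg_AE)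
  obtain C where C: "C \<ge> 0" and diss: "\<And>f g F G f3 d3 F3 D3 w1 v1. f \<in> {\<delta>..M} \<Longrightarrow> g \<in> {\<delta>..M} \<Longrightarrow>
      F \<in> {\<delta>..M} \<Longrightarrow> G \<in> {\<delta>..M} \<Longrightarrow> f3 \<in> {-M..M} \<Longrightarrow> d3 \<in> {-M..M} \<Longrightarrow> F3 \<in> {-M..M} \<Longrightarrow> D3 \<in> {-M..M} \<Longrightarrow>
      - (C * ((f - F)\<^sup>2 + (f + g - (F + G))\<^sup>2 + w1\<^sup>2 + v1\<^sup>2)) \<le>
      (sm * (f3 - F3) - w1) * (j1 m sp sm f g f3 d3 - j1 m sp sm F G F3 D3)
      + (m * sp * (d3 - D3) - v1) * (j2 m sp sm \<mu>0 \<tau>h p f g f3 d3 - j2 m sp sm \<mu>0 \<tau>h p F G F3 D3)"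
    by (rule flux_dissipation[OF assms(2-6,10) \<delta> M]) (rule that)
  \<comment> \<open>The smallest weight in the energy. \<open>flux_dissipation\<close> yields an
    unweighted sum of squares, whereas the energy carries weights and a factor 1/2; hence the 2 and
    the division by \<kappa> in \<open>C2\<close>.\<close>
  define \<kappa> where "\<kappa> = min 1 (min sm (m * sp))"
  have \<kappa>: "\<kappa> > 0" "\<kappa> \<le> 1" "\<kappa> \<le> sm" "\<kappa> \<le> m * sp" using assms(2-4) by (auto simp: \<kappa>_def)
  define C2 where "C2 = 2 * C / \<kappa>"
  have "\<exists>f_t g_t. C1_into (L2_space a b) (L2_norm_on a b) ?I f f_t \<and>
        C1_into (L2_space a b) (L2_norm_on a b) ?I g g_t \<and>
        (\<forall>t\<in>?I. \<exists>q1 q2.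
           has_weak_derivative_L2 a b (flux1 a b m sp sm (f t) (g t)) q1 \<and>
           has_weak_derivative_L2 a b (flux2 a b m sp sm \<mu>0 \<tau>h p (f t) (g t)) q2 \<and>
           (AE x in ?L. f_t t x + q1 x = 0) \<and> (AE x in ?L. (f_t t x + g_t t x) + q2 x = 0))"
    using assms(15) unfolding positive_strong_solution_def by (elim conjE) assumption
  then obtain f_t g_t where ft: "C1_into (L2_space a b) (L2_norm_on a b) ?I f f_t"
      "C1_into (L2_space a b) (L2_norm_on a b) ?I g g_t"
    and pde: "\<forall>t\<in>?I. \<exists>q1 q2.
           has_weak_derivative_L2 a b (flux1 a b m sp sm (f t) (g t)) q1 \<and>
           has_weak_derivative_L2 a b (flux2 a b m sp sm \<mu>0 \<tau>h p (f t) (g t)) q2 \<and>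
           (AE x in ?L. f_t t x + q1 x = 0) \<and> (AE x in ?L. (f_t t x + g_t t x) + q2 x = 0)"
    by (elim exE conjE) (rule that)
  have "\<exists>F_t G_t. C1_into (L2_space a b) (L2_norm_on a b) ?I F F_t \<and>
        C1_into (L2_space a b) (L2_norm_on a b) ?I G G_t \<and>
        (\<forall>t\<in>?I. \<exists>q1 q2.
           has_weak_derivative_L2 a b (flux1 a b m sp sm (F t) (G t)) q1 \<and>
           has_weak_derivative_L2 a b (flux2 a b m sp sm \<mu>0 \<tau>h p (F t) (G t)) q2 \<and>
           (AE x in ?L. F_t t x + q1 x = 0) \<and> (AE x in ?L. (F_t t x + G_t t x) + q2 x = 0))"
    using assms(16) unfolding positive_strong_solution_def by (elim conjE) assumption
  then obtain F_t G_t where Ft: "C1_into (L2_space a b) (L2_norm_on a b) ?I F F_t"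
      "C1_into (L2_space a b) (L2_norm_on a b) ?I G G_t"
    and PDE: "\<forall>t\<in>?I. \<exists>q1 q2.
           has_weak_derivative_L2 a b (flux1 a b m sp sm (F t) (G t)) q1 \<and>
           has_weak_derivative_L2 a b (flux2 a b m sp sm \<mu>0 \<tau>h p (F t) (G t)) q2 \<and>
           (AE x in ?L. F_t t x + q1 x = 0) \<and> (AE x in ?L. (F_t t x + G_t t x) + q2 x = 0)"
    by (elim exE conjE) (rule that)
  have L2d: "L2_derivative a b ?I u (u_t t) t" if "C1_into (L2_space a b) (L2_norm_on a b) ?I u u_t" "t \<in> ?I" for u u_t t
    using that unfolding C1_into_def continuous_into_def L2_derivative_def by blast
  define Y' where "Y' t = (LINT x|?L. (f_t t x - F_t t x) * (w 0 t x - sm * w 2 t x))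
      + (LINT x|?L. (f_t t x + g_t t x - (F_t t x + G_t t x)) * (v 0 t x - m * sp * v 2 t x))" for t
  have Yder: "(Y has_real_derivative Y' t) (at t within ?I)" if t: "t \<in> ?I" for t
  proof -
    have I: "\<tau> \<in> ?I \<Longrightarrow> \<tau> \<in> {0..T}" for \<tau> by auto
    have "L2_derivative a b ?I (\<lambda>\<tau> x. f \<tau> x - F \<tau> x) (\<lambda>x. f_t t x - F_t t x) t"
      "L2_derivative a b ?I (\<lambda>\<tau> x. f \<tau> x + g \<tau> x - (F \<tau> x + G \<tau> x))
        (\<lambda>x. f_t t x + g_t t x - (F_t t x + G_t t x)) t"
      by (intro L2_derivative_diff L2_derivative_add L2d ft Ft t)+
    moreover have "(\<lambda>\<tau> x. f \<tau> x - F \<tau> x) = w 0" "(\<lambda>\<tau> x. f \<tau> x + g \<tau> x - (F \<tau> x + G \<tau> x)) = v 0"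
      by (simp_all add: fun_eq_iff w00 v00)
    ultimately have L2: "L2_derivative a b ?I (w 0) (\<lambda>x. f_t t x - F_t t x) t"
      "L2_derivative a b ?I (v 0) (\<lambda>x. f_t t x + g_t t x - (F_t t x + G_t t x)) t"
      by (simp_all only:)
    have d01: "(w 0 \<tau> has_real_derivative w 1 \<tau> x) (at x within {a..b})"
      "(v 0 \<tau> has_real_derivative v 1 \<tau> x) (at x within {a..b})"
      "(w 1 \<tau> has_real_derivative w 2 \<tau> x) (at x within {a..b})"
      "(v 1 \<tau> has_real_derivative v 2 \<tau> x) (at x within {a..b})" if "\<tau> \<in> ?I" "x \<in> {a..b}" for \<tau> x
      using der[OF I[OF that(1)] _ that(2), of 0] der[OF I[OF that(1)] _ that(2), of 1] by (simp_all add: numeral_2_eq_2)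
    have c2: "continuous_on {a..b} (w 2 \<tau>)" "continuous_on {a..b} (v 2 \<tau>)" if "\<tau> \<in> ?I" for \<tau>
      by (rule cont[OF I[OF that]]; simp)+
    have b1: "w 1 \<tau> a = 0 \<and> w 1 \<tau> b = 0" "v 1 \<tau> a = 0 \<and> v 1 \<tau> b = 0" if "\<tau> \<in> ?I" for \<tau>
      by (intro conjI bd1 I[OF that]; simp)+
    have h02: "\<bar>w 0 \<tau> x - w 0 t x\<bar> \<le> K * \<bar>\<tau> - t\<bar> powr \<nu>" "\<bar>w 2 \<tau> x - w 2 t x\<bar> \<le> K * \<bar>\<tau> - t\<bar> powr \<nu>"
      "\<bar>v 0 \<tau> x - v 0 t x\<bar> \<le> K * \<bar>\<tau> - t\<bar> powr \<nu>" "\<bar>v 2 \<tau> x - v 2 t x\<bar> \<le> K * \<bar>\<tau> - t\<bar> powr \<nu>"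
      if "\<tau> \<in> ?I" "x \<in> {a..b}" for \<tau> x
      by (rule hoel[OF I[OF t] I[OF that(1)] _ that(2)]; simp)+
    have "(Ew has_real_derivative (LINT x|?L. (f_t t x - F_t t x) * (w 0 t x - sm * w 2 t x))) (at t within ?I)"
      unfolding Ew_def[abs_def]
      by (rule energy_has_derivative[OF ab t \<nu>(1) K d01(1,3) c2(1) b1(1) h02(1,2) L2(1)])
    moreover have "(Ev has_real_derivative (LINT x|?L. (f_t t x + g_t t x - (F_t t x + G_t t x)) * (v 0 t x - m * sp * v 2 t x))) (at t within ?I)"
      unfolding Ev_def[abs_def]
      by (rule energy_has_derivative[OF ab t \<nu>(1) K d01(2,4) c2(2) b1(2) h02(3,4) L2(2)])
    ultimately show ?thesis
      unfolding Y_def[abs_def] Y'_def by (rule DERIV_add)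
  qed
  have Yle: "Y' t \<le> C2 * Y t" if t: "t \<in> ?I" for t
  proof -
    have t': "t \<in> {0..T}" using t by auto
    note C3t = C3[OF t'] and bdt = bd[OF t']
    have pos: "g t x > 0" "G t x > 0" if "x \<in> {a..b}" for x
      using range[OF t' that] \<delta> by auto
    \<comment> \<open>The functions paired with the time derivatives in \<open>Y'\<close>. As
      \<open>w\<close> and \<open>v\<close> have three spatial derivatives, these have one, which is
      what \<open>evolution_weak_form\<close> asks for.\<close>
    define \<phi>1 where "\<phi>1 x = w 0 t x - sm * w 2 t x" for x
    define \<phi>2 where "\<phi>2 x = v 0 t x - m * sp * v 2 t x" for x
    define \<phi>1' where "\<phi>1' x = w 1 t x - sm * w 3 t x" for x
    define \<phi>2' where "\<phi>2' x = v 1 t x - m * sp * v 3 t x" for x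
    have \<phi>d: "(\<phi>1 has_real_derivative \<phi>1' x) (at x within {a..b})" "(\<phi>2 has_real_derivative \<phi>2' x) (at x within {a..b})"
      if x: "x \<in> {a..b}" for x
      unfolding \<phi>1_def[abs_def] \<phi>2_def[abs_def] \<phi>1'_def \<phi>2'_def
      using der[OF t' _ x, of 0] der[OF t' _ x, of 2]
      by (auto intro!: DERIV_diff DERIV_cmult simp: numeral_3_eq_3 numeral_2_eq_2)
    have c\<phi>: "continuous_on {a..b} \<phi>1" "continuous_on {a..b} \<phi>2"
      "continuous_on {a..b} \<phi>1'" "continuous_on {a..b} \<phi>2'"
      unfolding \<phi>1_def[abs_def] \<phi>2_def[abs_def] \<phi>1'_def[abs_def] \<phi>2'_def[abs_def]
      by (intro continuous_intros cont t'; simp)+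
    let ?j1 = "flux1 a b m sp sm (f t) (g t)" and ?J1 = "flux1 a b m sp sm (F t) (G t)"
    let ?j2 = "flux2 a b m sp sm \<mu>0 \<tau>h p (f t) (g t)" and ?J2 = "flux2 a b m sp sm \<mu>0 \<tau>h p (F t) (G t)"
    have bd3: "x \<in> {a, b} \<Longrightarrow> ?D (f t) x = 0 \<and> ?D (g t) x = 0" "x \<in> {a, b} \<Longrightarrow> ?D (F t) x = 0 \<and> ?D (G t) x = 0" for x
      using bdt by auto
    note fl = ab assms(10) C3t(1,2) pos(1) bd3(1) and Fl = ab assms(10) C3t(3,4) pos(2) bd3(2)
    have u: "f_t t \<in> L2_space a b" "g_t t \<in> L2_space a b" "F_t t \<in> L2_space a b" "G_t t \<in> L2_space a b"
      using L2d[OF ft(1) t] L2d[OF ft(2) t] L2d[OF Ft(1) t] L2d[OF Ft(2) t] by (auto simp: L2_derivative_def)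
    have u2: "(\<lambda>x. f_t t x + g_t t x) \<in> L2_space a b" "(\<lambda>x. F_t t x + G_t t x) \<in> L2_space a b"
      using L2_space_linear[OF u(1,2), of 1 1] L2_space_linear[OF u(3,4), of 1 1] by simp_all
    obtain q1 q2 where q: "has_weak_derivative_L2 a b ?j1 q1" "has_weak_derivative_L2 a b ?j2 q2"
      "AE x in ?L. f_t t x + q1 x = 0" "AE x in ?L. (f_t t x + g_t t x) + q2 x = 0"
      using bspec[OF pde t] by (elim exE conjE) (rule that)
    obtain Q1 Q2 where Q: "has_weak_derivative_L2 a b ?J1 Q1" "has_weak_derivative_L2 a b ?J2 Q2"
      "AE x in ?L. F_t t x + Q1 x = 0" "AE x in ?L. (F_t t x + G_t t x) + Q2 x = 0"
      using bspec[OF PDE t] by (elim exE conjE) (rule that)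
    have cj: "continuous_on {a..b} ?j1" "continuous_on {a..b} ?j2" "continuous_on {a..b} ?J1" "continuous_on {a..b} ?J2"
      by (rule continuous_on_flux1[OF fl] continuous_on_flux2[OF fl] continuous_on_flux1[OF Fl] continuous_on_flux2[OF Fl]; assumption)+
    have jbd: "?j1 x = 0" "?j2 x = 0" "?J1 x = 0" "?J2 x = 0" if "x \<in> {a, b}" for x
      by (rule flux1_boundary[OF fl] flux2_boundary[OF fl] flux1_boundary[OF Fl] flux2_boundary[OF Fl];
          (assumption | rule that))+
    have jeq: "?j1 x = j1 m sp sm (f t x) (g t x) (?D (f t) x) (?D (f t) x + ?D (g t) x)"
      "?j2 x = j2 m sp sm \<mu>0 \<tau>h p (f t x) (g t x) (?D (f t) x) (?D (f t) x + ?D (g t) x)"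
      "?J1 x = j1 m sp sm (F t x) (G t x) (?D (F t) x) (?D (F t) x + ?D (G t) x)"
      "?J2 x = j2 m sp sm \<mu>0 \<tau>h p (F t x) (G t x) (?D (F t) x) (?D (F t) x + ?D (G t) x)"
      if "x \<in> {a..b}" for x
      by (rule flux1_eq[OF fl] flux2_eq[OF fl] flux1_eq[OF Fl] flux2_eq[OF Fl]; (assumption | rule that))+
    have wf: "(LINT x|?L. f_t t x * \<phi>1 x) = (LINT x|?L. \<phi>1' x * ?j1 x)"
      by (rule evolution_weak_form[OF ab q(1) cj(1) jbd(1) q(3) u(1) \<phi>d(1) c\<phi>(3)])
    have wf2: "(LINT x|?L. (f_t t x + g_t t x) * \<phi>2 x) = (LINT x|?L. \<phi>2' x * ?j2 x)"
      by (rule evolution_weak_form[OF ab q(2) cj(2) jbd(2) q(4) u2(1) \<phi>d(2) c\<phi>(4)])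
    have WF: "(LINT x|?L. F_t t x * \<phi>1 x) = (LINT x|?L. \<phi>1' x * ?J1 x)"
      by (rule evolution_weak_form[OF ab Q(1) cj(3) jbd(3) Q(3) u(3) \<phi>d(1) c\<phi>(3)])
    have WF2: "(LINT x|?L. (F_t t x + G_t t x) * \<phi>2 x) = (LINT x|?L. \<phi>2' x * ?J2 x)"
      by (rule evolution_weak_form[OF ab Q(2) cj(4) jbd(4) Q(4) u2(2) \<phi>d(2) c\<phi>(4)])
    have i1: "integrable ?L (\<lambda>x. f_t t x * \<phi>1 x)" "integrable ?L (\<lambda>x. F_t t x * \<phi>1 x)"
      "integrable ?L (\<lambda>x. (f_t t x + g_t t x) * \<phi>2 x)" "integrable ?L (\<lambda>x. (F_t t x + G_t t x) * \<phi>2 x)"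
      by (intro L2_mult_integrable u u2 continuous_on_imp_L2 c\<phi>)+
    have i2: "integrable ?L (\<lambda>x. \<phi>1' x * ?j1 x)" "integrable ?L (\<lambda>x. \<phi>1' x * ?J1 x)"
      "integrable ?L (\<lambda>x. \<phi>2' x * ?j2 x)" "integrable ?L (\<lambda>x. \<phi>2' x * ?J2 x)"
      by (intro continuous_on_integrable_Ioo continuous_on_mult c\<phi> cj)+
    have iE: "integrable ?L (\<lambda>x. (sm * (w 1 t x)\<^sup>2 + (w 0 t x)\<^sup>2) / 2)"
      "integrable ?L (\<lambda>x. (m * sp * (v 1 t x)\<^sup>2 + (v 0 t x)\<^sup>2) / 2)"
      by (intro continuous_on_integrable_Ioo continuous_on_divide continuous_on_add continuous_on_mult
          continuous_on_power continuous_on_const cont t'; simp)+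
    \<comment> \<open>The weak form is inserted for each solution separately, so that the difference
      of the fluxes is formed only after the derivatives have moved to the common test
      functions.\<close>
    have "Y' t = (LINT x|?L. f_t t x * \<phi>1 x) - (LINT x|?L. F_t t x * \<phi>1 x)
        + ((LINT x|?L. (f_t t x + g_t t x) * \<phi>2 x) - (LINT x|?L. (F_t t x + G_t t x) * \<phi>2 x))"
      unfolding Y'_def \<phi>1_def[symmetric] \<phi>2_def[symmetric] left_diff_distrib
      by (simp only: Bochner_Integration.integral_diff i1)
    also have "\<dots> = (LINT x|?L. (\<phi>1' x * ?j1 x - \<phi>1' x * ?J1 x) + (\<phi>2' x * ?j2 x - \<phi>2' x * ?J2 x))"
      unfolding wf wf2 WF WF2
      by (simp only: Bochner_Integration.integral_diff Bochner_Integration.integral_add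
          Bochner_Integration.integrable_diff i2)
    also have "\<dots> \<le> (LINT x|?L. C2 * ((sm * (w 1 t x)\<^sup>2 + (w 0 t x)\<^sup>2) / 2 + (m * sp * (v 1 t x)\<^sup>2 + (v 0 t x)\<^sup>2) / 2))"
    proof (rule integral_mono)
      show "integrable ?L (\<lambda>x. (\<phi>1' x * ?j1 x - \<phi>1' x * ?J1 x) + (\<phi>2' x * ?j2 x - \<phi>2' x * ?J2 x))"
        by (intro Bochner_Integration.integrable_add Bochner_Integration.integrable_diff i2)
      show "integrable ?L (\<lambda>x. C2 * ((sm * (w 1 t x)\<^sup>2 + (w 0 t x)\<^sup>2) / 2 + (m * sp * (v 1 t x)\<^sup>2 + (v 0 t x)\<^sup>2) / 2))"
        by (intro integrable_mult_right Bochner_Integration.integrable_add iE)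
      fix x
      assume "x \<in> space ?L"
      then have x: "x \<in> {a..b}" by auto
      \<comment> \<open>\<open>\<phi>1'\<close> and \<open>\<phi>2'\<close> carry the third
        derivatives with a minus sign, so the lower bound on the dissipation becomes an upper bound
        by derivatives of order at most one.\<close>
      have "(\<phi>1' x * ?j1 x - \<phi>1' x * ?J1 x) + (\<phi>2' x * ?j2 x - \<phi>2' x * ?J2 x)
        = - ((sm * w 3 t x - w 1 t x) * (?j1 x - ?J1 x) + (m * sp * v 3 t x - v 1 t x) * (?j2 x - ?J2 x))"
        unfolding \<phi>1'_def \<phi>2'_def by (simp add: left_diff_distrib right_diff_distrib)
      also have "\<dots> \<le> C * ((w 0 t x)\<^sup>2 + (v 0 t x)\<^sup>2 + (w 1 t x)\<^sup>2 + (v 1 t x)\<^sup>2)"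
        using diss[OF range[OF t' x] range3[OF t' x], of "w 1 t x" "v 1 t x"]
        unfolding jeq[OF x] w_def[of 3] v_def[of 3] w00 v00 by (rule minus_le_iff[THEN iffD1])
      also have "\<dots> \<le> C2 * ((sm * (w 1 t x)\<^sup>2 + (w 0 t x)\<^sup>2) / 2 + (m * sp * (v 1 t x)\<^sup>2 + (v 0 t x)\<^sup>2) / 2)"
      proof -
        have "\<kappa> * (w 0 t x)\<^sup>2 \<le> 1 * (w 0 t x)\<^sup>2" "\<kappa> * (v 0 t x)\<^sup>2 \<le> 1 * (v 0 t x)\<^sup>2"
          "\<kappa> * (w 1 t x)\<^sup>2 \<le> sm * (w 1 t x)\<^sup>2" "\<kappa> * (v 1 t x)\<^sup>2 \<le> m * sp * (v 1 t x)\<^sup>2"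
          using \<kappa> by (intro mult_right_mono; simp)+
        then have "\<kappa> * ((w 0 t x)\<^sup>2 + (v 0 t x)\<^sup>2 + (w 1 t x)\<^sup>2 + (v 1 t x)\<^sup>2)
          \<le> sm * (w 1 t x)\<^sup>2 + (w 0 t x)\<^sup>2 + (m * sp * (v 1 t x)\<^sup>2 + (v 0 t x)\<^sup>2)"
          unfolding distrib_left by linarith
        note le = mult_left_mono[OF this, of "C / \<kappa>"]
        have "C / \<kappa> * (\<kappa> * S) = C * S" "C / \<kappa> * (A + B) = C2 * (A / 2 + B / 2)" for S A B
          using \<kappa>(1) unfolding C2_def by (simp_all add: add_divide_distrib[symmetric])
        then show ?thesis
          using le divide_nonneg_pos[OF C \<kappa>(1)] by (simp only:)
      qed
      finally show "(\<phi>1' x * ?j1 x - \<phi>1' x * ?J1 x) + (\<phi>2' x * ?j2 x - \<phi>2' x * ?J2 x)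
        \<le> C2 * ((sm * (w 1 t x)\<^sup>2 + (w 0 t x)\<^sup>2) / 2 + (m * sp * (v 1 t x)\<^sup>2 + (v 0 t x)\<^sup>2) / 2)" .
    qed
    also have "\<dots> = C2 * Y t"
      unfolding integral_mult_right_zero Y_def Ew_def Ev_def
      by (simp only: Bochner_Integration.integral_add iE)
    finally show ?thesis .
  qed
  have zero_initial: "w k 0 x = 0" "v k 0 x = 0" if "k \<le> 3" "x \<in> {a..b}" for k x
  proof -
    have T0: "0 \<in> {0..T}" using T by simp
    have "(dx a b ^^ k) (f 0) x = (dx a b ^^ k) (F 0) x" "(dx a b ^^ k) (g 0) x = (dx a b ^^ k) (G 0) x"
      using assms(15,16) unfolding positive_strong_solution_def
      by (auto intro!: dx_cong C3 T0 ab that)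
    then show "w k 0 x = 0" "v k 0 x = 0" by (simp_all add: w_def v_def)
  qed
  \<comment> \<open>At time 0 all \<open>w k\<close> and \<open>v k\<close> with
    \<open>k \<le> 3\<close> vanish, so the Hoelder bounds make the energy at most a multiple of
    \<open>(K * \<bar>t\<bar> powr \<nu>)\<^sup>2\<close>.\<close>
  have Ylim: "(Y \<longlongrightarrow> 0) (at_right 0)"
  proof (rule Lim_null_comparison)
    let ?c = "(sm + 1) / 2 * (b - a) + (m * sp + 1) / 2 * (b - a)"
    have "((\<lambda>t. (K * \<bar>t\<bar> powr \<nu>)\<^sup>2 * ?c) \<longlongrightarrow> (K * \<bar>0\<bar> powr \<nu>)\<^sup>2 * ?c) (at_right 0)"
      using \<nu> by (intro tendsto_intros) auto
    then show "((\<lambda>t. (K * \<bar>t\<bar> powr \<nu>)\<^sup>2 * ?c) \<longlongrightarrow> 0) (at_right 0)" by simp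
    have "\<forall>\<^sub>F t in at_right 0. t \<in> {0<..<T}"
      using eventually_at_right_real[of 0 T] T by auto
    then show "\<forall>\<^sub>F t in at_right 0. norm (Y t) \<le> (K * \<bar>t\<bar> powr \<nu>)\<^sup>2 * ?c"
    proof eventually_elim
      case (elim t)
      then have t: "t \<in> {0..T}" and T0: "0 \<in> {0..T}" using T by auto
      let ?r = "(K * \<bar>t\<bar> powr \<nu>)\<^sup>2"
      have le: "(LINT x|?L. (\<alpha> * (u 1 t x)\<^sup>2 + (u 0 t x)\<^sup>2) / 2) \<le> ((\<alpha> + 1) / 2 * ?r) * (b - a)"
        if \<alpha>: "\<alpha> > 0" and cu: "\<And>k. k \<le> 3 \<Longrightarrow> continuous_on {a..b} (u k t)"
          and hu: "\<And>k x. k \<le> 3 \<Longrightarrow> x \<in> {a..b} \<Longrightarrow> \<bar>u k t x\<bar> \<le> K * \<bar>t\<bar> powr \<nu>"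
        for \<alpha> and u :: "nat \<Rightarrow> real \<Rightarrow> real \<Rightarrow> real"
      proof (rule integral_le_const_Ioo)
        show "integrable ?L (\<lambda>x. (\<alpha> * (u 1 t x)\<^sup>2 + (u 0 t x)\<^sup>2) / 2)"
          by (intro continuous_on_integrable_Ioo continuous_intros cu) auto
        fix x
        assume "x \<in> {a<..<b}"
        then have x: "x \<in> {a..b}" by auto
        have "\<bar>u 1 t x\<bar>\<^sup>2 \<le> ?r" "\<bar>u 0 t x\<bar>\<^sup>2 \<le> ?r"
          using x by (intro power_mono hu; simp)+
        then have "\<alpha> * (u 1 t x)\<^sup>2 \<le> \<alpha> * ?r" "(u 0 t x)\<^sup>2 \<le> ?r" using \<alpha> by auto
        then show "(\<alpha> * (u 1 t x)\<^sup>2 + (u 0 t x)\<^sup>2) / 2 \<le> (\<alpha> + 1) / 2 * ?r"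
          by (simp add: distrib_right)
      qed (use ab in simp)
      have small: "\<bar>w k t x\<bar> \<le> K * \<bar>t\<bar> powr \<nu>" "\<bar>v k t x\<bar> \<le> K * \<bar>t\<bar> powr \<nu>"
        if "k \<le> 3" "x \<in> {a..b}" for k x
        using hoel[OF T0 t that] zero_initial[OF that] by simp_all
      have "Ew t \<le> ((sm + 1) / 2 * ?r) * (b - a)"
        unfolding Ew_def by (rule le[where u = w and \<alpha> = sm, OF assms(4) cont(1)[OF t] small(1)])
      moreover have "Ev t \<le> ((m * sp + 1) / 2 * ?r) * (b - a)"
        unfolding Ev_def by (rule le[where u = v and \<alpha> = "m * sp", OF mult_pos_pos[OF assms(2,3)] cont(2)[OF t] small(2)])
      moreover have "?r * ?c = ((sm + 1) / 2 * ?r) * (b - a) + ((m * sp + 1) / 2 * ?r) * (b - a)"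
        by (simp only: distrib_left mult_ac)
      ultimately show ?case
        using Ewnn[of t] Evnn[of t] unfolding Y_def by simp
    qed
  qed
  have C2: "C2 \<ge> 0" using C \<kappa> by (simp add: C2_def)
  have Ynn: "Y t \<ge> 0" for t using Ewnn[of t] Evnn[of t] by (simp add: Y_def)
  show ?thesis
  proof (intro ballI)
    fix t x
    assume t: "t \<in> {0..T}" and x: "x \<in> {a..b}"
    have "w 0 t x = 0 \<and> v 0 t x = 0"
    \<comment> \<open>Time 0 is settled by the common initial value; the Gronwall argument covers
      positive times.\<close>
    proof (cases "t = 0")
      case True
      then show ?thesis using zero_initial[of 0 x] x by simp
    next
      case False
      then have t': "t \<in> ?I" using t by auto
      have "Y t = 0"
        by (rule Gronwall_zero[OF T Yder Yle C2 Ynn Ylim t'])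
      then have E0: "Ew t = 0" "Ev t = 0" using Ewnn[of t] Evnn[of t] by (simp_all add: Y_def)
      \<comment> \<open>Both integrands are continuous and nonnegative, so vanishing integrals force
        them to vanish at every point, end points included.\<close>
      have "(sm * (w 1 t x)\<^sup>2 + (w 0 t x)\<^sup>2) / 2 = 0"
        by (rule integral_Ioo_zero_imp_zero[OF ab _ _ E0(1)[unfolded Ew_def] x])
           (use assms(4) in \<open>auto intro!: continuous_intros cont t\<close>)
      moreover have "(m * sp * (v 1 t x)\<^sup>2 + (v 0 t x)\<^sup>2) / 2 = 0"
        by (rule integral_Ioo_zero_imp_zero[OF ab _ _ E0(2)[unfolded Ev_def] x])
           (use assms(2,3) in \<open>auto intro!: continuous_intros cont t\<close>)
      ultimately show ?thesis
        using assms(2-4) by (simp add: add_nonneg_eq_0_iff)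
    qed
    then show "f t x = F t x \<and> g t x = G t x" by (simp add: w00 v00)
  qed
qed

end
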